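(* Assume the setting described in the context. For each $n\ge 1$ let $z^{(n)}=(z_{n,1},\ldots,z_{n,n})\in\mathbb{C}^n$ be a random vector with density $P_n^V$ (all these vectors being defined on a common probability space, with arbitrary joint law across different $n$), and set $z_{n,n+i}:=\overline{z_{n,i}}$ for $i=1,\ldots,n$. Then, almost surely, the empirical measure \[\frac{1}{2n}\sum_{i=1}^{2n}\delta_{z_{n,i}}\] converges weakly, as $n\to\infty$, to the compactly supported probability measure $\mu^V$, the unique minimizer over all probability measures on $\mathbb{C}$ of the weighted logarithmic energy $I$.
   Context: Let $V:\mathbb{C}\to[0,+\infty]$ be continuous, conjugation invariant ($V(\bar z)=V(z)$), such that for some $\delta>0$ one has $V(z)\ge(1+\delta)\log(|z|^2+1)$ for all $|z|$ large enough, and such that $E_0=\{z: V(z)<\infty\}$ has positive capacity, i.e. there is a compactly supported probability measure $\mu$ with support in $E_0$ and $\iint\log|x-y|^{-1}d\mu(x)d\mu(y)<\infty$. For $z=(z_1,\ldots,z_n)\in\mathbb{C}^n$ use the convention $z_{n+i}=\bar z_i$, $i=1,\ldots,n$. Put $k(x,y)=\log|x-y|^{-1}+\frac12(V(x)+V(y))$ and $K_n(z)=\sum_{1\le i\ne j\le 2n}k(z_i,z_j)$. The probability density $P_n^V$ on $\mathbb{C}^n$ (w.r.t. Lebesgue measure) is \[P_n^V(z)=\frac{1}{c_n^V}\exp\Big(-\frac12\Big(K_n(z)+\sum_{i=1}^{2n}V(z_i)+\sum_{i=1}^{2n}\log|z_i-\bar z_i|^{-1}\Big)\Big),\] with $c_n^V$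 the normalizing constant. The weighted logarithmic energy of a probability measure $\mu$ on $\mathbb{C}$ is $I(\mu)=\iint\log|x-y|^{-1}d\mu(x)d\mu(y)+\int V\,d\mu$; it is known that $I$ has a unique minimizer $\mu^V$ among probability measures on $\mathbb{C}$, which is compactly supported. *)

theory Defs
  imports "HOL-Probability.Probability"
begin

definition log_kernel :: "complex \<Rightarrow> complex \<Rightarrow> ereal" where
  "log_kernel x y = (if x = y then \<infinity> else ereal (- ln (cmod (x - y))))"

definition kern :: "(complex \<Rightarrow> ereal) \<Rightarrow> complex \<Rightarrow> complex \<Rightarrow> ereal" where
  "kern V x y = log_kernel x y + (V x + V y) / 2"

definition eintegral :: "'a measure \<Rightarrow> ('a \<Rightarrow> ereal) \<Rightarrow> ereal" where
  "eintegral M f = enn2ereal (\<integral>\<^sup>+ x. e2ennreal (f x) \<partial>M)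
                   - enn2ereal (\<integral>\<^sup>+ x. e2ennreal (- f x) \<partial>M)"

text \<open>Weighted logarithmic energy
  I(mu) = double integral of k(x,y) dmu(x) dmu(y)
        (= double integral of log|x-y|^{-1} plus integral of V).\<close>
definition energy :: "(complex \<Rightarrow> ereal) \<Rightarrow> complex measure \<Rightarrow> ereal" where
  "energy V \<mu> = eintegral (\<mu> \<Otimes>\<^sub>M \<mu>) (\<lambda>(x, y). kern V x y)"

definition prob_on_C :: "complex measure \<Rightarrow> bool" where
  "prob_on_C \<mu> \<longleftrightarrow> sets \<mu> = sets borel \<and> prob_space \<mu>"

definition ext_conj :: "nat \<Rightarrow> (nat \<Rightarrow> complex) \<Rightarrow> nat \<Rightarrow> complex" where
  "ext_conj n z j = (if j < n then z j else cnj (z (j - n)))"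

definition K_n :: "(complex \<Rightarrow> ereal) \<Rightarrow> nat \<Rightarrow> (nat \<Rightarrow> complex) \<Rightarrow> ereal" where
  "K_n V n z = (\<Sum>i<2*n. \<Sum>j\<in>{..<2*n} - {i}. kern V (ext_conj n z i) (ext_conj n z j))"

definition H_n :: "(complex \<Rightarrow> ereal) \<Rightarrow> nat \<Rightarrow> (nat \<Rightarrow> complex) \<Rightarrow> ereal" where
  "H_n V n z = K_n V n z + (\<Sum>i<2*n. V (ext_conj n z i))
              + (\<Sum>i<2*n. log_kernel (ext_conj n z i) (cnj (ext_conj n z i)))"

definition exp_neg_half :: "ereal \<Rightarrow> ennreal" where
  "exp_neg_half h = (if h = \<infinity> then 0 else ennreal (exp (- real_of_ereal h / 2)))"

definition lebesgue_Cn :: "nat \<Rightarrow> (nat \<Rightarrow> complex) measure" where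
  "lebesgue_Cn n = (\<Pi>\<^sub>M i\<in>{..<n}. (lborel :: complex measure))"

definition norm_const :: "(complex \<Rightarrow> ereal) \<Rightarrow> nat \<Rightarrow> ennreal" where
  "norm_const V n = (\<integral>\<^sup>+ z. exp_neg_half (H_n V n z) \<partial>lebesgue_Cn n)"

definition P_density :: "(complex \<Rightarrow> ereal) \<Rightarrow> nat \<Rightarrow> (nat \<Rightarrow> complex) \<Rightarrow> ennreal" where
  "P_density V n z = exp_neg_half (H_n V n z) / norm_const V n"

definition empirical :: "nat \<Rightarrow> (nat \<Rightarrow> complex) \<Rightarrow> complex measure" where
  "empirical m x = measure_of UNIV (sets borel)
      (\<lambda>A. ennreal (real (card {i\<in>{..<m}. x i \<in> A}) / real m))"

definition weak_conv_C :: "(nat \<Rightarrow> complex measure) \<Rightarrow> complex measure \<Rightarrow> bool" where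
  "weak_conv_C \<mu>s \<mu> \<longleftrightarrow>
     (\<forall>f :: complex \<Rightarrow> real. continuous_on UNIV f \<and> bounded (range f) \<longrightarrow>
        (\<lambda>n. \<integral>x. f x \<partial>(\<mu>s n)) \<longlonglongrightarrow> (\<integral>x. f x \<partial>\<mu>))"

end

theory Submission
  imports Defs "HOL-Complex_Analysis.Complex_Analysis" "HOL-Real_Asymp.Real_Asymp"
begin

text \<open>
  The energy form \<open>D(\<mu> - \<nu>) = \<integral>\<integral> k d(\<mu> - \<nu>) d(\<mu> - \<nu>)\<close> of the regularised kernel
  \<open>k(x, y) = - ln (|x - y|\<^sup>2 + e) / 2\<close> is nonnegative, because differences of such kernels are positive
  mixtures of Gaussians and a Gaussian is an autocorrelation; and if \<open>D(\<mu>\<^sub>n - \<nu>)\<close> becomes arbitrarily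
  small, then \<open>\<mu>\<^sub>n\<close> converges weakly to \<open>\<nu>\<close>. Comparing \<open>\<mu>\<^sup>V\<close> with small circles shows that the
  regularised potential satisfies \<open>2 U + V \<ge> 2 m - \<integral> V d\<mu>\<^sup>V\<close> everywhere up to a small error, where \<open>m\<close> is
  the minimal energy. Expanding the form gives \<open>D(\<mu>\<^sub>n - \<mu>\<^sup>V) \<le> H'/N\<^sup>2 - m + o(1)\<close> for the empirical
  measure \<open>\<mu>\<^sub>n\<close> of \<open>N = 2 n\<close> points with energy \<open>H' = K\<^sub>n + \<Sum> V\<close>.

  It remains to bound \<open>H'/N\<^sup>2\<close> by \<open>m + \<epsilon>\<close> almost surely. Smearing \<open>\<mu>\<^sup>V\<close> over small discs produces a
  measure of bounded density whose energy is hardly larger (the logarithm is superharmonic), and Jensen's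
  inequality then bounds the normalising constant below by \<open>exp (- N\<^sup>2 (m + \<epsilon>) / 2 - O(n))\<close>. Since a small part
  of \<open>H'\<close> suffices to make the density integrable, \<open>H' > N\<^sup>2 (m + 2 \<epsilon>)\<close> has probability
  \<open>exp (- c n\<^sup>2 + O(n))\<close>, and the Borel--Cantelli lemma applies whatever the joint law is.
\<close>

subsection \<open>Lebesgue measure on the plane\<close>

text \<open>An empirical measure has infinite logarithmic energy because of its diagonal. Hence all
  comparisons use the kernel regularised at a scale \<open>e\<close> that is fixed before
  \<open>n\<close> grows, so that the diagonal costs only \<open>- ln e / (4 * n)\<close>. Small
  circles are the competitors because their energy is finite and their potential is at most that of
  a point mass at the centre; they give the lower bound on the potential at every point where
  \<open>V\<close> is finite, not merely outside a null set, as is necessary for inserting arbitrary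
  random points. The measure \<open>\<mu>V\<close> may be singular and may charge the real line,
  where the logarithm of \<open>1 / |z - cnj z|\<close> is infinite; a bounded density makes the
  mean of that term finite and permits the passage from a product law to Lebesgue measure. The
  interaction of one point with the conjugate of another, independent one is dominated by the
  ordinary interaction, since the form is nonnegative at the difference of a measure and its
  conjugate. A point interacts with its own conjugate in only O(n) of the terms, which does not
  matter on the scale of the square of \<open>n\<close>.\<close>

lemma measurable_Complex_pair [measurable]: "(\<lambda>(x, y). Complex x y) \<in> borel_measurable (borel \<Otimes>\<^sub>M borel)"
proof -
  have "continuous_on UNIV (\<lambda>p::real \<times> real. Complex (fst p) (snd p))"
    by (intro continuous_intros)
  then have "(\<lambda>p. Complex (fst p) (snd p)) \<in> borel_measurable (borel \<Otimes>\<^sub>M borel)"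
    unfolding borel_prod by (rule borel_measurable_continuous_onI)
  then show ?thesis by (simp add: case_prod_beta')
qed

text \<open>Lebesgue measure is determined by its values on boxes, and boxes in the plane are
  products of intervals.\<close>

lemma lborel_complex_eq:
  "(lborel :: complex measure) = distr (lborel \<Otimes>\<^sub>M lborel) borel (\<lambda>(x, y). Complex x y)"
proof (rule lborel_eqI)
  fix l u :: complex
  assume le: "\<And>b. b \<in> Basis \<Longrightarrow> l \<bullet> b \<le> u \<bullet> b"
  have le': "Re l \<le> Re u" "Im l \<le> Im u" using le[of 1] le[of \<i>] by (auto simp: Basis_complex_def)
  have pre: "(\<lambda>(x, y). Complex x y) -` box l u \<inter> space (lborel \<Otimes>\<^sub>M lborel)
      = {Re l <..< Re u} \<times> {Im l <..< Im u}"
    by (auto simp: box_def Basis_complex_def space_pair_measure)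
  have "emeasure (distr (lborel \<Otimes>\<^sub>M lborel) borel (\<lambda>(x, y). Complex x y)) (box l u)
     = emeasure (lborel \<Otimes>\<^sub>M lborel) ({Re l <..< Re u} \<times> {Im l <..< Im u})"
    by (subst emeasure_distr) (auto simp: pre)
  also have "\<dots> = ennreal (Re u - Re l) * ennreal (Im u - Im l)"
    using le' by (subst lborel.emeasure_pair_measure_Times) auto
  also have "\<dots> = (\<Prod>b\<in>Basis. (u - l) \<bullet> b)"
    using le' by (simp add: Basis_complex_def ennreal_mult)
  finally show "emeasure (distr (lborel \<Otimes>\<^sub>M lborel) borel (\<lambda>(x, y). Complex x y)) (box l u)
     = (\<Prod>b\<in>Basis. (u - l) \<bullet> b)" .
qed simp

lemma nn_integral_lborel_complex:
  assumes [measurable]: "f \<in> borel_measurable borel"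
  shows "(\<integral>\<^sup>+z. f z \<partial>lborel) = (\<integral>\<^sup>+x. \<integral>\<^sup>+y. f (Complex x y) \<partial>lborel \<partial>lborel)"
proof -
  have "(\<integral>\<^sup>+z. f z \<partial>lborel) = (\<integral>\<^sup>+p. f (case p of (x, y) \<Rightarrow> Complex x y) \<partial>(lborel \<Otimes>\<^sub>M lborel))"
    by (subst lborel_complex_eq, subst nn_integral_distr) auto
  also have "\<dots> = (\<integral>\<^sup>+x. \<integral>\<^sup>+y. f (Complex x y) \<partial>lborel \<partial>lborel)"
    by (subst lborel.nn_integral_fst[symmetric]) (auto simp: case_prod_beta')
  finally show ?thesis .
qed

lemma nn_integral_lborel_translate:
  fixes t :: "'a::euclidean_space"
  assumes "f \<in> borel_measurable borel"
  shows "(\<integral>\<^sup>+z. f (t + z) \<partial>lborel) = (\<integral>\<^sup>+z. f z \<partial>lborel)"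
proof -
  have "(\<integral>\<^sup>+z. f z \<partial>lborel) = (\<integral>\<^sup>+z. f z \<partial>(distr lborel borel ((+) t)))"
    by (simp add: lborel_distr_plus)
  also have "\<dots> = (\<integral>\<^sup>+z. f (t + z) \<partial>lborel)"
    using assms by (subst nn_integral_distr) auto
  finally show ?thesis by simp
qed

text \<open>By Fubini: on each vertical line the shear is a translation, which preserves
  one-dimensional Lebesgue measure.\<close>

lemma nn_integral_lborel_shear_Im:
  assumes [measurable]: "f \<in> borel_measurable borel"
  shows "(\<integral>\<^sup>+z. f (Complex (Re z) (Im z + k * Re z)) \<partial>lborel) = (\<integral>\<^sup>+z. f z \<partial>lborel)"
proof -
  have "(\<lambda>z. Complex (Re z) (Im z + k * Re z)) \<in> borel_measurable borel"
    by (intro borel_measurable_continuous_onI continuous_intros)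
  note [measurable] = measurable_compose[OF this assms]
  have "(\<integral>\<^sup>+z. f (Complex (Re z) (Im z + k * Re z)) \<partial>lborel)
     = (\<integral>\<^sup>+x. \<integral>\<^sup>+y. f (Complex x (k * x + y)) \<partial>lborel \<partial>lborel)"
    by (subst nn_integral_lborel_complex) (auto simp: add.commute)
  also have "\<dots> = (\<integral>\<^sup>+x. \<integral>\<^sup>+y. f (Complex x y) \<partial>lborel \<partial>lborel)"
  proof (rule nn_integral_cong)
    fix x :: real
    have "(\<lambda>y. Complex x y) \<in> borel_measurable borel"
      by (intro borel_measurable_continuous_onI continuous_intros)
    note m = measurable_compose[OF this assms]
    show "(\<integral>\<^sup>+y. f (Complex x (k * x + y)) \<partial>lborel) = (\<integral>\<^sup>+y. f (Complex x y) \<partial>lborel)"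
      by (rule nn_integral_lborel_translate[where f = "\<lambda>y. f (Complex x y)"]) (rule m)
  qed
  finally show ?thesis by (simp add: nn_integral_lborel_complex[OF assms])
qed

lemma nn_integral_lborel_swap:
  assumes [measurable]: "f \<in> borel_measurable borel"
  shows "(\<integral>\<^sup>+z. f (Complex (Im z) (Re z)) \<partial>lborel) = (\<integral>\<^sup>+z. f z \<partial>lborel)"
proof -
  have "(\<lambda>z. Complex (Im z) (Re z)) \<in> borel_measurable borel"
    by (intro borel_measurable_continuous_onI continuous_intros)
  note [measurable] = measurable_compose[OF this assms]
  have "(\<integral>\<^sup>+z. f (Complex (Im z) (Re z)) \<partial>lborel) = (\<integral>\<^sup>+x. \<integral>\<^sup>+y. f (Complex y x) \<partial>lborel \<partial>lborel)"
    by (subst nn_integral_lborel_complex) auto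
  also have "\<dots> = (\<integral>\<^sup>+x. \<integral>\<^sup>+y. f (Complex x y) \<partial>lborel \<partial>lborel)"
  proof -
    have "(\<lambda>(x, y). f (Complex x y)) \<in> borel_measurable (lborel \<Otimes>\<^sub>M lborel)"
      using measurable_compose[OF measurable_Complex_pair assms] by (simp add: case_prod_beta' cong: measurable_cong_sets)
    from lborel_pair.Fubini'[OF this] show ?thesis .
  qed
  finally show ?thesis by (simp add: nn_integral_lborel_complex[OF assms])
qed

lemma nn_integral_lborel_shear_Re:
  assumes [measurable]: "f \<in> borel_measurable borel"
  shows "(\<integral>\<^sup>+z. f (Complex (Re z + k * Im z) (Im z)) \<partial>lborel) = (\<integral>\<^sup>+z. f z \<partial>lborel)"
proof -
  have s: "(\<lambda>z. Complex (Im z) (Re z)) \<in> borel_measurable borel"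
    by (intro borel_measurable_continuous_onI continuous_intros)
  have h: "(\<lambda>z. Complex (Re z) (Im z + k * Re z)) \<in> borel_measurable borel"
    by (intro borel_measurable_continuous_onI continuous_intros)
  let ?g = "\<lambda>z. f (Complex (Im z) (Re z))"
  have g: "?g \<in> borel_measurable borel" by (rule measurable_compose[OF s assms])
  have "(\<integral>\<^sup>+z. f z \<partial>lborel) = (\<integral>\<^sup>+z. ?g z \<partial>lborel)"
    by (simp add: nn_integral_lborel_swap)
  also have "\<dots> = (\<integral>\<^sup>+z. ?g (Complex (Re z) (Im z + k * Re z)) \<partial>lborel)"
    using g by (rule nn_integral_lborel_shear_Im[symmetric])
  also have "\<dots> = (\<integral>\<^sup>+z. ?g (Complex (Re (Complex (Im z) (Re z))) (Im (Complex (Im z) (Re z)) + k * Re (Complex (Im z) (Re z)))) \<partial>lborel)"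
    by (rule nn_integral_lborel_swap[symmetric]) (rule measurable_compose[OF h g])
  finally show ?thesis by simp
qed

text \<open>Averages over discs are later decomposed into averages over circles by means of this
  invariance. The factorisation into shears has slope \<open>- b / (1 + a)\<close> and so leaves out
  \<open>c = -1\<close>, which is the square of the rotation by \<open>\<i>\<close>.\<close>

lemma nn_integral_lborel_rotate:
  assumes [measurable]: "f \<in> borel_measurable borel" and c: "cmod c = 1"
  shows "(\<integral>\<^sup>+z. f (c * z) \<partial>lborel) = (\<integral>\<^sup>+z. f z \<partial>lborel)"
proof -
  have ne: "(\<integral>\<^sup>+z. f (c * z) \<partial>lborel) = (\<integral>\<^sup>+z. f z \<partial>lborel)"
    if [measurable]: "f \<in> borel_measurable borel" and c: "cmod c = 1" "Re c \<noteq> -1" for c f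
  proof -
    define a b where "a = Re c" and "b = Im c"
    define k where "k = - b / (1 + a)"
    have ab: "a\<^sup>2 + b\<^sup>2 = 1" using c(1) by (simp add: a_def b_def cmod_def)
    have a1: "1 + a \<noteq> 0" using c(2) by (auto simp: a_def)
    \<comment> \<open>A rotation other than \<open>-1\<close> is a product of three shears.\<close>
    have k1: "1 + b * k = a"
      using a1 ab by (simp add: k_def field_simps power2_eq_square) 
    have "k + k * a = k * (1 + a)" by (simp add: algebra_simps)
    then have k2: "k + k * a = - b" using a1 by (simp add: k_def)
    let ?S = "\<lambda>z. Complex (Re z + k * Im z) (Im z)" and ?T = "\<lambda>z. Complex (Re z) (Im z + b * Re z)"
    have S: "?S \<in> borel_measurable borel" and T: "?T \<in> borel_measurable borel"
      by (intro borel_measurable_continuous_onI continuous_intros)+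
    have "?S (?T (?S z)) = c * z" for z
    proof -
      have "Re (?S (?T (?S z))) = (1 + b * k) * Re z + (k + k * (1 + b * k)) * Im z"
        by (simp add: algebra_simps)
      also have "\<dots> = Re (c * z)" unfolding k1 k2 by (simp add: a_def b_def)
      finally have 1: "Re (?S (?T (?S z))) = Re (c * z)" .
      have "Im (?S (?T (?S z))) = (1 + b * k) * Im z + b * Re z"
        by (simp add: algebra_simps)
      also have "\<dots> = Im (c * z)" unfolding k1 by (simp add: a_def b_def)
      finally show ?thesis using 1 by (intro complex_eqI)
    qed
    then have "(\<integral>\<^sup>+z. f (c * z) \<partial>lborel) = (\<integral>\<^sup>+z. f (?S (?T (?S z))) \<partial>lborel)"
      by simp
    also have "\<dots> = (\<integral>\<^sup>+z. f (?S (?T z)) \<partial>lborel)"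
      by (rule nn_integral_lborel_shear_Re[where f = "\<lambda>z. f (?S (?T z))"])
         (rule measurable_compose[OF T] measurable_compose[OF S] that)+
    also have "\<dots> = (\<integral>\<^sup>+z. f (?S z) \<partial>lborel)"
      by (rule nn_integral_lborel_shear_Im[where f = "\<lambda>z. f (?S z)"])
         (rule measurable_compose[OF S] that)+
    also have "\<dots> = (\<integral>\<^sup>+z. f z \<partial>lborel)"
      by (rule nn_integral_lborel_shear_Re) (rule that)
    finally show ?thesis .
  qed
  show ?thesis
  proof (cases "Re c = -1")
    case True
    then have "Im c = 0" using c by (simp add: cmod_def)
    then have "c = \<i> * \<i>" using True by (intro complex_eqI) auto
    then have "(\<integral>\<^sup>+z. f (c * z) \<partial>lborel) = (\<integral>\<^sup>+z. f (\<i> * (\<i> * z)) \<partial>lborel)"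
      by (simp add: mult.assoc)
    also have "\<dots> = (\<integral>\<^sup>+z. f (\<i> * z) \<partial>lborel)"
      by (rule ne[where f = "\<lambda>z. f (\<i> * z)"]) auto
    finally show ?thesis by (simp add: ne)
  qed (simp add: ne c)
qed

subsection \<open>Logarithmic means over circles\<close>

text \<open>Mean value property: \<open>1 - u * z\<close> has positive real part on the closed unit
  disc, so \<open>Ln (1 - u * z)\<close> is holomorphic there, and Cauchy's formula gives its mean
  over the circle as the value \<open>Ln 1 = 0\<close> at the centre. The real part is the logarithm
  of the modulus.\<close>

lemma has_integral_ln_circle:
  assumes "cmod u < 1"
  shows "((\<lambda>t. ln (cmod (1 - u * cis (2 * pi * t)))) has_integral 0) {0..1}"
proof -
  let ?f = "\<lambda>z. Ln (1 - u * z)"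
  have *: "1 - u * z \<notin> \<real>\<^sub>\<le>\<^sub>0" if "cmod z \<le> 1" for z
  proof -
    have "cmod u * cmod z \<le> cmod u * 1" using that by (intro mult_left_mono) auto
    then have "cmod (u * z) < 1" using assms by (simp add: norm_mult)
    then have "Re (u * z) < 1" using complex_Re_le_cmod[of "u * z"] by linarith
    then show ?thesis by (auto simp: complex_nonpos_Reals_iff)
  qed
  have "?f holomorphic_on cball 0 1"
    by (intro holomorphic_intros) (use * in auto)
  then have "((\<lambda>z. ?f z / (z - 0)) has_contour_integral 2 * of_real pi * \<i> * ?f 0) (circlepath 0 1)"
    by (intro Cauchy_integral_circlepath_simple) auto
  then have hi: "((\<lambda>t. ?f (circlepath 0 1 t) / circlepath 0 1 t * vector_derivative (circlepath 0 1) (at t within {0..1}))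
      has_integral 0) {0..1}"
    by (simp add: has_contour_integral_def)
  have cp: "circlepath 0 1 t = cis (2 * pi * t)" for t
    by (simp add: circlepath cis_conv_exp mult_ac)
  have vd: "vector_derivative (circlepath 0 1) (at t within {0..1}) = 2 * of_real pi * \<i> * cis (2 * pi * t)"
    if "t \<in> {0..1}" for t
    using that by (subst vector_derivative_circlepath01) (auto simp: cis_conv_exp mult_ac)
  from hi have "((\<lambda>t. 2 * of_real pi * \<i> * ?f (cis (2 * pi * t))) has_integral 0) {0..1}"
    by (rule has_integral_eq[rotated])
       (auto simp: vd cp)
  then have "((\<lambda>t. (1 / (2 * of_real pi * \<i>)) * (2 * of_real pi * \<i> * ?f (cis (2 * pi * t)))) has_integral
      (1 / (2 * of_real pi * \<i>)) * 0) {0..1}"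
    by (rule has_integral_mult_right)
  then have "((\<lambda>t. ?f (cis (2 * pi * t))) has_integral 0) {0..1}"
    by (simp add: field_simps)
  then have "((\<lambda>t. Re (?f (cis (2 * pi * t)))) has_integral Re 0) {0..1}"
    by (rule has_integral_Re)
  then have "((\<lambda>t. Re (?f (cis (2 * pi * t)))) has_integral 0) {0..1}" by simp
  then show ?thesis
  proof (rule has_integral_eq[rotated])
    fix t :: real
    have "1 - u * cis (2 * pi * t) \<noteq> 0" using *[of "cis (2 * pi * t)"] by auto
    then show "Re (?f (cis (2 * pi * t))) = ln (cmod (1 - u * cis (2 * pi * t)))"
      by (rule Re_Ln)
  qed
qed

definition circle_measure :: "complex \<Rightarrow> real \<Rightarrow> complex measure" where
  "circle_measure x r = distr (uniform_measure lborel {0..1}) borel (\<lambda>t. x + of_real r * cis (2 * pi * t))"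

lemma measurable_circle [measurable]: "(\<lambda>t. x + of_real r * cis (2 * pi * t)) \<in> borel_measurable borel"
  by (intro borel_measurable_continuous_onI continuous_intros)

lemma measurable_cis [measurable]: "(\<lambda>t. cis (2 * pi * t)) \<in> borel_measurable borel"
  by (intro borel_measurable_continuous_onI continuous_intros)

lemma prob_space_uniform01: "prob_space (uniform_measure lborel {0..1::real})"
  by (rule prob_space_uniform_measure) auto

lemma prob_space_circle_measure: "prob_space (circle_measure x r)"
  unfolding circle_measure_def
  by (rule prob_space.prob_space_distr[OF prob_space_uniform01]) simp

lemma sets_circle_measure [simp, measurable_cong]: "sets (circle_measure x r) = sets borel"
  by (simp add: circle_measure_def)

lemma AE_circle_measure:
  assumes "\<And>z. cmod (z - x) = r \<Longrightarrow> P z" "r \<ge> 0" "Measurable.pred borel P"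
  shows "AE z in circle_measure x r. P z"
  unfolding circle_measure_def using assms
  by (subst AE_distr_iff) (auto intro!: AE_I2 simp: norm_mult)

text \<open>If \<open>s\<close> is one solution of \<open>u * cis (2 * pi * t) = 1\<close>, all
  others differ from it by integers, so they form a countable set. This discards the point where the
  convention \<open>ln 0 = 0\<close> misrepresents the logarithm.\<close>

lemma AE_uniform01_circle_neq:
  "AE t in uniform_measure lborel {0..1}. u * cis (2 * pi * t) \<noteq> 1"
proof (cases "\<exists>s. u * cis (2 * pi * s) = 1")
  case True
  then obtain s where s: "u * cis (2 * pi * s) = 1" by auto
  then have "u \<noteq> 0" by auto
  have "{t. u * cis (2 * pi * t) = 1} \<subseteq> range (\<lambda>k::int. s + real_of_int k)"
  proof
    fix t assume "t \<in> {t. u * cis (2 * pi * t) = 1}"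
    then have "cis (2 * pi * t) = cis (2 * pi * s)" using s \<open>u \<noteq> 0\<close>
      by (metis (mono_tags) mem_Collect_eq mult_left_cancel)
    then have "sin (2 * pi * t) = sin (2 * pi * s)" "cos (2 * pi * t) = cos (2 * pi * s)"
      by (simp_all add: complex_eq_iff)
    then obtain n where "2 * pi * t = 2 * pi * s + 2 * pi * real_of_int n"
      using sin_cos_eq_iff by metis
    then have "2 * pi * t = 2 * pi * (s + real_of_int n)" by (simp add: algebra_simps)
    then have "t = s + real_of_int n" by simp
    then show "t \<in> range (\<lambda>k::int. s + real_of_int k)" by auto
  qed
  then have "countable {t. u * cis (2 * pi * t) = 1}"
    by (rule countable_subset) auto
  then have "AE t in lborel. u * cis (2 * pi * t) \<noteq> 1"
    by (intro AE_I[where N = "{t. u * cis (2 * pi * t) = 1}"])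
       (auto simp: emeasure_lborel_countable)
  then show ?thesis
    by (intro AE_uniform_measureI) auto
qed auto

text \<open>Inside the disc this is the mean value property. For \<open>|u| = 1\<close> the
  logarithm is singular on the circle, and Fatou's lemma along \<open>(1 - 1 / (n + 2)) * u\<close>
  gives the inequality. With \<open>c \<ge> ln 2\<close> the integrand is nonnegative, so
  \<open>ennreal\<close> clips nothing.\<close>

lemma nn_integral_ln_circle_le:
  assumes "cmod u \<le> 1" "ln 2 \<le> c"
  shows "(\<integral>\<^sup>+t. ennreal (c - ln (cmod (1 - u * cis (2 * pi * t)))) \<partial>uniform_measure lborel {0..1}) \<le> ennreal c"
proof -
  have c0: "0 \<le> c" using assms(2) ln_ge_zero[of "2::real"] by linarith
  have strict: "(\<integral>\<^sup>+t. ennreal (c - ln (cmod (1 - u * cis (2 * pi * t)))) \<partial>uniform_measure lborel {0..1}) = ennreal c"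
    if u: "cmod u < 1" for u
  proof -
    have "((\<lambda>t. c - ln (cmod (1 - u * cis (2 * pi * t)))) has_integral (c * (1 - 0) - 0)) {0..1}"
      using has_integral_const_real[of c 0 1] by (intro has_integral_diff has_integral_ln_circle u) simp
    then have i: "((\<lambda>t. c - ln (cmod (1 - u * cis (2 * pi * t)))) has_integral c) {0..1}" by simp
    have n: "0 \<le> c - ln (cmod (1 - u * cis (2 * pi * t)))" for t
    proof -
      have lt: "cmod (u * cis (2 * pi * t)) < 1" using u by (simp add: norm_mult)
      have "cmod (1 - u * cis (2 * pi * t)) \<le> 2"
        using norm_triangle_ineq4[of 1 "u * cis (2 * pi * t)"] lt by simp
      moreover have "0 < cmod (1 - u * cis (2 * pi * t))" using lt by auto
      ultimately have "ln (cmod (1 - u * cis (2 * pi * t))) \<le> ln 2" by (subst ln_le_cancel_iff) auto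
      then show ?thesis using assms by simp
    qed
    have eq: "(\<integral>\<^sup>+t\<in>{0..1}. ennreal (c - ln (cmod (1 - u * cis (2 * pi * t)))) \<partial>lborel) = ennreal c"
      by (rule nn_integral_has_integral_lebesgue'[OF _ i]) (use n in auto)
    have m: "(\<lambda>t. ennreal (c - ln (cmod (1 - u * cis (2 * pi * t))))) \<in> borel_measurable lborel"
      by measurable
    have "(\<integral>\<^sup>+t. ennreal (c - ln (cmod (1 - u * cis (2 * pi * t)))) \<partial>uniform_measure lborel {0..1})
       = (\<integral>\<^sup>+t\<in>{0..1}. ennreal (c - ln (cmod (1 - u * cis (2 * pi * t)))) \<partial>lborel) / emeasure lborel {0..1::real}"
      by (rule nn_integral_uniform_measure[OF m]) simp
    also have "\<dots> = ennreal c / 1" unfolding eq by simp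
    finally show ?thesis by (simp only: divide_ennreal_def ennreal_inverse_1 mult_1_right)
  qed
  define w where "w n = of_real (1 - 1 / (real n + 2)) * u" for n :: nat
  have w1: "cmod (w n) < 1" for n
  proof -
    have "cmod (w n) = (1 - 1 / (real n + 2)) * cmod u" by (simp add: w_def norm_mult del: of_real_diff)
    also have "\<dots> \<le> (1 - 1 / (real n + 2)) * 1" by (intro mult_left_mono assms) (auto simp: field_simps)
    also have "\<dots> < 1" by simp
    finally show ?thesis .
  qed
  have wlim: "w \<longlonglongrightarrow> u"
  proof -
    have "(\<lambda>n. 1 - 1 / (real n + 2)) \<longlonglongrightarrow> 1" by real_asymp
    then have "(\<lambda>n. complex_of_real (1 - 1 / (real n + 2)) * u) \<longlonglongrightarrow> of_real 1 * u"
      by (intro tendsto_intros)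
    then show ?thesis unfolding w_def[abs_def] by simp
  qed
  let ?U = "uniform_measure lborel {0..1::real}"
  have "(\<integral>\<^sup>+t. ennreal (c - ln (cmod (1 - u * cis (2 * pi * t)))) \<partial>?U)
     \<le> (\<integral>\<^sup>+t. liminf (\<lambda>n. ennreal (c - ln (cmod (1 - w n * cis (2 * pi * t))))) \<partial>?U)"
  proof (rule nn_integral_mono_AE, use AE_uniform01_circle_neq[of u] in eventually_elim)
    fix t assume t: "u * cis (2 * pi * t) \<noteq> 1"
    have "(\<lambda>n. ennreal (c - ln (cmod (1 - w n * cis (2 * pi * t))))) \<longlonglongrightarrow> ennreal (c - ln (cmod (1 - u * cis (2 * pi * t))))"
      by (intro tendsto_intros wlim) (use t in auto)
    then show "ennreal (c - ln (cmod (1 - u * cis (2 * pi * t))))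
       \<le> liminf (\<lambda>n. ennreal (c - ln (cmod (1 - w n * cis (2 * pi * t)))))"
      by (simp add: lim_imp_Liminf)
  qed
  also have "\<dots> \<le> liminf (\<lambda>n. \<integral>\<^sup>+t. ennreal (c - ln (cmod (1 - w n * cis (2 * pi * t)))) \<partial>?U)"
    by (rule nn_integral_liminf) simp
  also have "\<dots> = ennreal c" by (simp add: strict w1 Liminf_const)
  finally show ?thesis .
qed

lemma AE_circle_measure_neq:
  assumes "r > 0"
  shows "AE z in circle_measure x r. z \<noteq> y"
proof -
  have "AE t in uniform_measure lborel {0..1}. of_real r / (y - x) * cis (2 * pi * t) \<noteq> 1"
    by (rule AE_uniform01_circle_neq)
  then have "AE t in uniform_measure lborel {0..1}. x + of_real r * cis (2 * pi * t) \<noteq> y"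
    by eventually_elim (use assms in \<open>auto simp: field_simps\<close>)
  then show ?thesis unfolding circle_measure_def by (subst AE_distr_iff) auto
qed

text \<open>Factoring out the larger of \<open>|x - y|\<close> and \<open>r\<close> leaves
  \<open>|1 - u * cis s|\<close> with \<open>|u| \<le> 1\<close>, to which the preceding estimate
  applies. The resulting bound covers both the subharmonicity of the logarithm and, for
  \<open>y\<close> inside the circle, the value \<open>ln r\<close>.\<close>

lemma
  assumes r: "r > 0"
  shows integrable_ln_circle_measure: "integrable (circle_measure x r) (\<lambda>z. ln (cmod (z - y)))"
    and integral_ln_circle_measure: "ln (max (cmod (x - y)) r) \<le> (\<integral>z. ln (cmod (z - y)) \<partial>circle_measure x r)"
proof -
  let ?U = "uniform_measure lborel {0..1::real}"
  interpret U: prob_space ?U by (rule prob_space_uniform01)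
  define a where "a = max (cmod (x - y)) r"
  have a0: "a > 0" using r by (simp add: a_def)
  obtain u where u: "cmod u \<le> 1" "\<And>t. cmod (x + of_real r * cis (2 * pi * t) - y) = a * cmod (1 - u * cis (2 * pi * t))"
  proof (cases "cmod (x - y) \<le> r")
    \<comment> \<open>For \<open>y\<close> inside the circle the factor is \<open>r * cis s\<close>,
      which leaves \<open>cis (- s)\<close> behind; conjugation, invisible to \<open>cmod\<close>,
      restores \<open>cis s\<close>.\<close>
    case True
    show ?thesis
    proof (rule that[of "cnj (- (x - y) / of_real r)"])
      show "cmod (cnj (- (x - y) / of_real r)) \<le> 1" using True r complex_mod_cnj[of "x - y"] by (simp add: norm_divide norm_minus_commute)
      fix t :: real
      let ?s = "2 * pi * t"
      have "x + of_real r * cis ?s - y = of_real r * cis ?s * (1 - (- (x - y) / of_real r) * cis (- ?s))"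
        using r by (simp add: field_simps cis_mult)
      then have "cmod (x + of_real r * cis ?s - y) = r * cmod (1 - (- (x - y) / of_real r) * cis (- ?s))"
        using r by (simp add: norm_mult)
      also have "cmod (1 - (- (x - y) / of_real r) * cis (- ?s)) = cmod (cnj (1 - (- (x - y) / of_real r) * cis (- ?s)))"
        by (rule complex_mod_cnj[symmetric])
      also have "cnj (1 - (- (x - y) / of_real r) * cis (- ?s)) = 1 - cnj (- (x - y) / of_real r) * cis ?s"
        by (simp add: cis_cnj)
      finally show "cmod (x + of_real r * cis ?s - y) = a * cmod (1 - cnj (- (x - y) / of_real r) * cis ?s)"
        using True by (simp add: a_def max_def)
    qed
  next
    case False
    then have ne: "x - y \<noteq> 0" using r by auto
    show ?thesis
    proof (rule that[of "- of_real r / (x - y)"])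
      show "cmod (- of_real r / (x - y)) \<le> 1" using False r by (simp add: norm_divide divide_le_eq)
      fix t :: real
      have "x + of_real r * cis (2 * pi * t) - y = (x - y) * (1 - (- of_real r / (x - y)) * cis (2 * pi * t))"
        using ne by (simp add: field_simps)
      then have "cmod (x + of_real r * cis (2 * pi * t) - y) = cmod (x - y) * cmod (1 - (- of_real r / (x - y)) * cis (2 * pi * t))"
        by (simp only: norm_mult)
      then show "cmod (x + of_real r * cis (2 * pi * t) - y) = a * cmod (1 - (- of_real r / (x - y)) * cis (2 * pi * t))"
        using False by (simp add: a_def max_def)
    qed
  qed
  let ?g = "\<lambda>t. ln (cmod (1 - u * cis (2 * pi * t)))"
  have nn: "0 \<le> ln 2 - ?g t" for t
  proof (cases "1 - u * cis (2 * pi * t) = 0")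
    case False
    have "cmod (1 - u * cis (2 * pi * t)) \<le> 2"
      using norm_triangle_ineq4[of 1 "u * cis (2 * pi * t)"] u(1) by (simp add: norm_mult)
    then have "?g t \<le> ln 2" using False by (subst ln_le_cancel_iff) auto
    then show ?thesis by simp
  qed auto
  have int: "integrable ?U (\<lambda>t. ln 2 - ?g t)"
    using nn_integral_ln_circle_le[OF u(1), of "ln 2"] nn
    by (intro integrableI_nonneg) (auto simp: top_unique intro: le_less_trans)
  have "ennreal (\<integral>t. ln 2 - ?g t \<partial>?U) = (\<integral>\<^sup>+t. ennreal (ln 2 - ?g t) \<partial>?U)"
    using int nn by (intro nn_integral_eq_integral[symmetric]) auto
  also have "\<dots> \<le> ennreal (ln 2)" by (rule nn_integral_ln_circle_le[OF u(1)]) simp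
  finally have le: "(\<integral>t. ln 2 - ?g t \<partial>?U) \<le> ln 2"
    by (simp add: ennreal_le_iff)
  have intg: "integrable ?U ?g"
    using Bochner_Integration.integrable_diff[OF U.integrable_const[of "ln 2"] int] by (simp add: U.emeasure_space_1)
  have geq: "(\<integral>t. ?g t \<partial>?U) \<ge> 0"
    using le intg by (simp add: U.prob_space)
  have ae: "AE t in ?U. ln (cmod (x + of_real r * cis (2 * pi * t) - y)) = ln a + ?g t"
    using AE_uniform01_circle_neq[of u]
    by eventually_elim (use a0 in \<open>auto simp: u(2) ln_mult\<close>)
  have i2: "integrable ?U (\<lambda>t. ln a + ?g t)" using intg by (intro Bochner_Integration.integrable_add) auto
  have i3: "integrable ?U (\<lambda>t. ln (cmod (x + of_real r * cis (2 * pi * t) - y)))"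
    by (subst integrable_cong_AE[OF _ _ ae]) (auto intro: i2)
  show "integrable (circle_measure x r) (\<lambda>z. ln (cmod (z - y)))"
    unfolding circle_measure_def using i3 by (subst integrable_distr_eq) auto
  have "(\<integral>z. ln (cmod (z - y)) \<partial>circle_measure x r) = (\<integral>t. ln (cmod (x + of_real r * cis (2 * pi * t) - y)) \<partial>?U)"
    unfolding circle_measure_def by (subst integral_distr) auto
  also have "\<dots> = (\<integral>t. ln a + ?g t \<partial>?U)" by (rule integral_cong_AE[OF _ _ ae]) auto
  also have "\<dots> = ln a + (\<integral>t. ?g t \<partial>?U)" using intg by (simp add: U.prob_space)
  finally show "ln (max (cmod (x - y)) r) \<le> (\<integral>z. ln (cmod (z - y)) \<partial>circle_measure x r)"
    using geq by (simp add: a_def)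
qed

subsection \<open>Positive definiteness of the logarithmic energy\<close>

text \<open>The two mixed terms are merged into one, so this is the quadratic form of
  \<open>\<mu> - \<nu>\<close> for symmetric \<open>k\<close>.\<close>

definition edist :: "(complex \<Rightarrow> complex \<Rightarrow> real) \<Rightarrow> complex measure \<Rightarrow> complex measure \<Rightarrow> real" where
  "edist k \<mu> \<nu> = (\<integral>x. \<integral>y. k x y \<partial>\<mu> \<partial>\<mu>) - 2 * (\<integral>x. \<integral>y. k x y \<partial>\<nu> \<partial>\<mu>) + (\<integral>x. \<integral>y. k x y \<partial>\<nu> \<partial>\<nu>)"

lemma nn_integral_kernel_eq_integral:
  fixes k :: "complex \<Rightarrow> complex \<Rightarrow> real"
  assumes "prob_space \<mu>" "prob_space \<nu>" and [measurable_cong]: "sets \<mu> = sets borel" "sets \<nu> = sets borel"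
    and [measurable]: "(\<lambda>(x, y). k x y) \<in> borel_measurable (borel \<Otimes>\<^sub>M borel)"
    and k: "\<And>x y. 0 \<le> k x y" "\<And>x y. k x y \<le> B"
  shows "(\<integral>\<^sup>+x. \<integral>\<^sup>+y. ennreal (k x y) \<partial>\<nu> \<partial>\<mu>) = ennreal (\<integral>x. \<integral>y. k x y \<partial>\<nu> \<partial>\<mu>)"
proof -
  interpret \<mu>: prob_space \<mu> by fact
  interpret \<nu>: prob_space \<nu> by fact
  have 1: "integrable \<nu> (k x)" for x
    by (rule \<nu>.integrable_const_bound[where B = B]) (use k in auto)
  have 2: "(\<integral>\<^sup>+y. ennreal (k x y) \<partial>\<nu>) = ennreal (\<integral>y. k x y \<partial>\<nu>)" for x
    using 1 k by (intro nn_integral_eq_integral) auto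
  have 3: "(\<integral>y. k x y \<partial>\<nu>) \<le> B" for x
    using integral_mono[OF 1[of x] \<nu>.integrable_const[of B]] k by (simp add: \<nu>.prob_space)
  have "integrable \<mu> (\<lambda>x. \<integral>y. k x y \<partial>\<nu>)"
    by (rule \<mu>.integrable_const_bound[where B = B]) (use 3 k in \<open>auto intro!: integral_nonneg\<close>)
  then show ?thesis
    unfolding 2 using k by (intro nn_integral_eq_integral) (auto intro!: integral_nonneg)
qed

text \<open>If \<open>k\<close> is an inner product of nonnegative features
  \<open>F \<theta>\<close>, Tonelli turns each of the three double integrals into an integral over
  \<theta> of a product of means, and together they form a square. The computation runs in
  \<open>ennreal\<close>; since \<open>k\<close> is bounded all terms are finite, so that it
  descends to real integrals.\<close>

lemma
  fixes F :: "'b \<Rightarrow> complex \<Rightarrow> real" and k :: "complex \<Rightarrow> complex \<Rightarrow> real"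
  assumes \<Theta>: "sigma_finite_measure \<Theta>"
    and \<mu>: "prob_space \<mu>" "sets \<mu> = sets borel" and \<nu>: "prob_space \<nu>" "sets \<nu> = sets borel"
    and F [measurable]: "(\<lambda>(\<theta>, x). F \<theta> x) \<in> borel_measurable (\<Theta> \<Otimes>\<^sub>M borel)"
    and F0: "\<And>\<theta> x. 0 \<le> F \<theta> x"
    and Fk: "\<And>x y. (\<integral>\<^sup>+\<theta>. ennreal (F \<theta> x) * ennreal (F \<theta> y) \<partial>\<Theta>) = ennreal (k x y)"
    and [measurable]: "(\<lambda>(x, y). k x y) \<in> borel_measurable (borel \<Otimes>\<^sub>M borel)"
    and k: "\<And>x y. 0 \<le> k x y" "\<And>x y. k x y \<le> B"
  shows integrable_edist_feature: "integrable \<Theta> (\<lambda>\<theta>. ((\<integral>x. F \<theta> x \<partial>\<mu>) - (\<integral>x. F \<theta> x \<partial>\<nu>))\<^sup>2)"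
    and edist_eq_integral_feature: "edist k \<mu> \<nu> = (\<integral>\<theta>. ((\<integral>x. F \<theta> x \<partial>\<mu>) - (\<integral>x. F \<theta> x \<partial>\<nu>))\<^sup>2 \<partial>\<Theta>)"
proof -
  interpret T: sigma_finite_measure \<Theta> by fact
  have Fm: "F \<theta> \<in> borel_measurable borel" if "\<theta> \<in> space \<Theta>" for \<theta>
    using measurable_compose[OF measurable_Pair1'[OF that] F] by simp
  have cross: "(\<integral>\<^sup>+\<theta>. (\<integral>\<^sup>+x. F \<theta> x \<partial>\<mu>) * (\<integral>\<^sup>+x. F \<theta> x \<partial>\<nu>) \<partial>\<Theta>) = ennreal (\<integral>x. \<integral>y. k x y \<partial>\<nu> \<partial>\<mu>)"
    if \<mu>: "prob_space \<mu>" and [measurable_cong]: "sets \<mu> = sets borel"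
      and \<nu>: "prob_space \<nu>" and [measurable_cong]: "sets \<nu> = sets borel" for \<mu> \<nu>
  proof -
    interpret \<mu>: prob_space \<mu> by fact
    interpret \<nu>: prob_space \<nu> by fact
    interpret P: pair_sigma_finite \<Theta> \<mu> ..
    interpret P': pair_sigma_finite \<Theta> \<nu> ..
    have "(\<integral>\<^sup>+\<theta>. (\<integral>\<^sup>+x. F \<theta> x \<partial>\<mu>) * (\<integral>\<^sup>+x. F \<theta> x \<partial>\<nu>) \<partial>\<Theta>)
        = (\<integral>\<^sup>+\<theta>. \<integral>\<^sup>+x. \<integral>\<^sup>+y. ennreal (F \<theta> x) * ennreal (F \<theta> y) \<partial>\<nu> \<partial>\<mu> \<partial>\<Theta>)"
    proof (rule nn_integral_cong)
      fix \<theta> assume "\<theta> \<in> space \<Theta>"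
      note [measurable] = Fm[OF this]
      show "(\<integral>\<^sup>+x. F \<theta> x \<partial>\<mu>) * (\<integral>\<^sup>+x. F \<theta> x \<partial>\<nu>) = (\<integral>\<^sup>+x. \<integral>\<^sup>+y. ennreal (F \<theta> x) * ennreal (F \<theta> y) \<partial>\<nu> \<partial>\<mu>)"
        by (simp add: nn_integral_cmult nn_integral_multc)
    qed
    also have "\<dots> = (\<integral>\<^sup>+x. \<integral>\<^sup>+\<theta>. \<integral>\<^sup>+y. ennreal (F \<theta> x) * ennreal (F \<theta> y) \<partial>\<nu> \<partial>\<Theta> \<partial>\<mu>)"
      by (rule P.Fubini'[symmetric]) measurable
    also have "\<dots> = (\<integral>\<^sup>+x. \<integral>\<^sup>+y. \<integral>\<^sup>+\<theta>. ennreal (F \<theta> x) * ennreal (F \<theta> y) \<partial>\<Theta> \<partial>\<nu> \<partial>\<mu>)"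
      by (intro nn_integral_cong P'.Fubini'[symmetric]) measurable
    also have "\<dots> = ennreal (\<integral>x. \<integral>y. k x y \<partial>\<nu> \<partial>\<mu>)"
      unfolding Fk using \<mu> \<nu> that k by (intro nn_integral_kernel_eq_integral) auto
    finally show ?thesis .
  qed
  note [measurable_cong] = \<mu>(2) \<nu>(2)
  \<comment> \<open>A Bochner integral of a non-integrable function is 0; finiteness of the diagonal
    case of \<open>cross\<close> shows that this default value occurs only on a null set of
    parameters.\<close>
  have fin: "AE \<theta> in \<Theta>. (\<integral>\<^sup>+x. F \<theta> x \<partial>\<mu>) \<noteq> \<infinity>" if "prob_space \<mu>" and [measurable_cong]: "sets \<mu> = sets borel" for \<mu>
  proof -
    interpret \<mu>: prob_space \<mu> by fact
    have "AE \<theta> in \<Theta>. (\<integral>\<^sup>+x. F \<theta> x \<partial>\<mu>) * (\<integral>\<^sup>+x. F \<theta> x \<partial>\<mu>) \<noteq> \<infinity>"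
      by (rule nn_integral_PInf_AE) (use cross[OF that that] in auto)
    then show ?thesis by eventually_elim (auto simp: ennreal_top_mult)
  qed
  have int: "integrable \<Theta> (\<lambda>\<theta>. (\<integral>x. F \<theta> x \<partial>\<mu>) * (\<integral>x. F \<theta> x \<partial>\<nu>)) \<and>
      (\<integral>\<theta>. (\<integral>x. F \<theta> x \<partial>\<mu>) * (\<integral>x. F \<theta> x \<partial>\<nu>) \<partial>\<Theta>) = (\<integral>x. \<integral>y. k x y \<partial>\<nu> \<partial>\<mu>)"
    if \<mu>: "prob_space \<mu>" and [measurable_cong]: "sets \<mu> = sets borel"
      and \<nu>: "prob_space \<nu>" and [measurable_cong]: "sets \<nu> = sets borel" for \<mu> \<nu>
  proof -
    interpret \<mu>: prob_space \<mu> by fact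
    interpret \<nu>: prob_space \<nu> by fact
    have "(\<integral>\<^sup>+\<theta>. ennreal ((\<integral>x. F \<theta> x \<partial>\<mu>) * (\<integral>x. F \<theta> x \<partial>\<nu>)) \<partial>\<Theta>)
       = (\<integral>\<^sup>+\<theta>. (\<integral>\<^sup>+x. F \<theta> x \<partial>\<mu>) * (\<integral>\<^sup>+x. F \<theta> x \<partial>\<nu>) \<partial>\<Theta>)"
    proof (rule nn_integral_cong_AE, use fin[OF that(1,2)] fin[OF that(3,4)] AE_space in eventually_elim)
      fix \<theta> assume "(\<integral>\<^sup>+x. F \<theta> x \<partial>\<mu>) \<noteq> \<infinity>" "(\<integral>\<^sup>+x. F \<theta> x \<partial>\<nu>) \<noteq> \<infinity>" 
      moreover assume "\<theta> \<in> space \<Theta>"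
      note [measurable] = Fm[OF this]
      ultimately show "ennreal ((\<integral>x. F \<theta> x \<partial>\<mu>) * (\<integral>x. F \<theta> x \<partial>\<nu>)) = (\<integral>\<^sup>+x. F \<theta> x \<partial>\<mu>) * (\<integral>\<^sup>+x. F \<theta> x \<partial>\<nu>)"
        using F0 by (subst (1 2) integral_eq_nn_integral)
          (auto simp: ennreal_mult ennreal_enn2real_if)
    qed
    also note cross[OF that]
    finally have eq: "(\<integral>\<^sup>+\<theta>. ennreal ((\<integral>x. F \<theta> x \<partial>\<mu>) * (\<integral>x. F \<theta> x \<partial>\<nu>)) \<partial>\<Theta>) = ennreal (\<integral>x. \<integral>y. k x y \<partial>\<nu> \<partial>\<mu>)" .
    have i: "integrable \<Theta> (\<lambda>\<theta>. (\<integral>x. F \<theta> x \<partial>\<mu>) * (\<integral>x. F \<theta> x \<partial>\<nu>))"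
      by (rule integrableI_nonneg) (use eq F0 in \<open>auto intro!: AE_I2 mult_nonneg_nonneg integral_nonneg\<close>)
    moreover have "0 \<le> (\<integral>x. \<integral>y. k x y \<partial>\<nu> \<partial>\<mu>)" using k by (auto intro!: integral_nonneg)
    ultimately show ?thesis
      using eq F0 by (subst integral_eq_nn_integral) (auto intro!: AE_I2 mult_nonneg_nonneg integral_nonneg)
  qed
  note i = int[OF \<mu> \<mu>] int[OF \<mu> \<nu>] int[OF \<nu> \<nu>]
  show "integrable \<Theta> (\<lambda>\<theta>. ((\<integral>x. F \<theta> x \<partial>\<mu>) - (\<integral>x. F \<theta> x \<partial>\<nu>))\<^sup>2)"
    unfolding power2_diff using i by (simp add: power2_eq_square mult.assoc)
  show "edist k \<mu> \<nu> = (\<integral>\<theta>. ((\<integral>x. F \<theta> x \<partial>\<mu>) - (\<integral>x. F \<theta> x \<partial>\<nu>))\<^sup>2 \<partial>\<Theta>)"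
    unfolding power2_diff edist_def using i by (simp add: power2_eq_square mult.assoc)
qed

section \<open>Gaussian kernels as autocorrelations\<close>

lemma nn_integral_gaussian_real:
  assumes "0 < a"
  shows "(\<integral>\<^sup>+x. ennreal (exp (- a * x\<^sup>2)) \<partial>lborel) = ennreal (sqrt (pi / a))"
proof -
  define \<sigma> where "\<sigma> = sqrt (1 / (2 * a))"
  have s: "0 < \<sigma>" "\<sigma>\<^sup>2 = 1 / (2 * a)" using assms by (auto simp: \<sigma>_def)
  interpret prob_space "density lborel (normal_density 0 \<sigma>)"
    by (rule prob_space_normal_density) (rule s)
  have one: "(\<integral>\<^sup>+x. ennreal (normal_density 0 \<sigma> x) \<partial>lborel) = 1"
    using emeasure_space_1 by (simp add: emeasure_density)
  have "exp (- a * x\<^sup>2) = sqrt (pi / a) * normal_density 0 \<sigma> x" for x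
    using assms by (simp add: normal_density_def s real_sqrt_divide field_simps)
  then have "(\<integral>\<^sup>+x. ennreal (exp (- a * x\<^sup>2)) \<partial>lborel) = (\<integral>\<^sup>+x. ennreal (sqrt (pi / a)) * ennreal (normal_density 0 \<sigma> x) \<partial>lborel)"
    using assms by (simp add: ennreal_mult)
  then show ?thesis by (simp add: nn_integral_cmult one)
qed

lemma nn_integral_gaussian_complex:
  assumes "0 < a"
  shows "(\<integral>\<^sup>+z. ennreal (exp (- a * (cmod (z - c))\<^sup>2)) \<partial>lborel) = ennreal (pi / a)"
proof -
  have "(\<integral>\<^sup>+z. ennreal (exp (- a * (cmod (z - c))\<^sup>2)) \<partial>lborel) = (\<integral>\<^sup>+z. ennreal (exp (- a * (cmod z)\<^sup>2)) \<partial>lborel)"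
    using nn_integral_lborel_translate[of "\<lambda>z. ennreal (exp (- a * (cmod z)\<^sup>2))" "-c"] by simp
  also have "\<dots> = (\<integral>\<^sup>+x. \<integral>\<^sup>+y. ennreal (exp (- a * x\<^sup>2)) * ennreal (exp (- a * y\<^sup>2)) \<partial>lborel \<partial>lborel)"
    by (subst nn_integral_lborel_complex)
       (auto simp: cmod_def ennreal_mult'[symmetric] exp_add[symmetric] algebra_simps)
  also have "\<dots> = ennreal (sqrt (pi / a)) * ennreal (sqrt (pi / a))"
    by (simp add: nn_integral_cmult nn_integral_multc nn_integral_gaussian_real[OF assms, simplified])
  also have "\<dots> = ennreal (pi / a)"
    using assms by (simp add: ennreal_mult'[symmetric])
  finally show ?thesis .
qed

text \<open>The parallelogram identity for \<open>x - w\<close> and \<open>y - w\<close> splits the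
  product into a factor free of \<open>w\<close> and a Gaussian centred at the midpoint of
  \<open>x\<close> and \<open>y\<close>.\<close>

lemma nn_integral_gaussian_autocorrelation:
  assumes "0 < t"
  shows "(\<integral>\<^sup>+w. ennreal (exp (- 2 * t * (cmod (x - w))\<^sup>2)) * ennreal (exp (- 2 * t * (cmod (y - w))\<^sup>2)) \<partial>lborel)
     = ennreal (pi / (4 * t) * exp (- t * (cmod (x - y))\<^sup>2))"
proof -
  have "2 * ((cmod (x - w))\<^sup>2 + (cmod (y - w))\<^sup>2) = 4 * (cmod (w - (x + y) / 2))\<^sup>2 + (cmod (x - y))\<^sup>2" for w
  proof -
    have r: "2 * ((a - c)\<^sup>2 + (b - c)\<^sup>2) = 4 * (c - (a + b) / 2)\<^sup>2 + (a - b)\<^sup>2" for a b c :: real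
      by (simp add: power2_eq_square algebra_simps)
    show ?thesis
      using r[of "Re x" "Re w" "Re y"] r[of "Im x" "Im w" "Im y"] by (simp add: cmod_power2)
  qed
  then have "t * (2 * ((cmod (x - w))\<^sup>2 + (cmod (y - w))\<^sup>2)) = t * (4 * (cmod (w - (x + y) / 2))\<^sup>2 + (cmod (x - y))\<^sup>2)" for w
    by metis
  then have "- 2 * t * (cmod (x - w))\<^sup>2 + - 2 * t * (cmod (y - w))\<^sup>2
     = - t * (cmod (x - y))\<^sup>2 + - (4 * t) * (cmod (w - (x + y) / 2))\<^sup>2" for w
    by (simp add: algebra_simps)
  then have *: "ennreal (exp (- 2 * t * (cmod (x - w))\<^sup>2)) * ennreal (exp (- 2 * t * (cmod (y - w))\<^sup>2))
     = ennreal (exp (- t * (cmod (x - y))\<^sup>2)) * ennreal (exp (- (4 * t) * (cmod (w - (x + y) / 2))\<^sup>2))" for w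
    by (simp only: ennreal_mult'[symmetric] exp_ge_zero exp_add[symmetric])
  have "(\<integral>\<^sup>+w. ennreal (exp (- 2 * t * (cmod (x - w))\<^sup>2)) * ennreal (exp (- 2 * t * (cmod (y - w))\<^sup>2)) \<partial>lborel)
     = ennreal (exp (- t * (cmod (x - y))\<^sup>2)) * (\<integral>\<^sup>+w. ennreal (exp (- (4 * t) * (cmod (w - (x + y) / 2))\<^sup>2)) \<partial>lborel)"
    unfolding * by (rule nn_integral_cmult) simp
  also have "(\<integral>\<^sup>+w. ennreal (exp (- (4 * t) * (cmod (w - (x + y) / 2))\<^sup>2)) \<partial>lborel) = ennreal (pi / (4 * t))"
    using assms by (intro nn_integral_gaussian_complex) simp
  also have "ennreal (exp (- t * (cmod (x - y))\<^sup>2)) * ennreal (pi / (4 * t)) = ennreal (pi / (4 * t) * exp (- t * (cmod (x - y))\<^sup>2))"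
    by (subst mult.commute) (rule ennreal_mult''[symmetric], simp)
  finally show ?thesis .
qed

text \<open>The logarithmic kernels are unbounded on the plane but bounded on a disc that carries
  both measures; therefore the bound is asked for only on a set \<open>S\<close> of full
  measure.\<close>

lemma
  fixes k :: "complex \<Rightarrow> complex \<Rightarrow> real"
  assumes "prob_space \<mu>" "prob_space \<nu>" and [measurable_cong]: "sets \<mu> = sets borel" "sets \<nu> = sets borel"
    and [measurable]: "(\<lambda>(x, y). k x y) \<in> borel_measurable (borel \<Otimes>\<^sub>M borel)"
    and S: "AE x in \<mu>. x \<in> S" "AE y in \<nu>. y \<in> S"
    and k: "\<And>x y. x \<in> S \<Longrightarrow> y \<in> S \<Longrightarrow> \<bar>k x y\<bar> \<le> B"
  shows integrable_kernel_inner: "\<And>x. x \<in> S \<Longrightarrow> integrable \<nu> (k x)"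
    and integrable_kernel: "integrable \<mu> (\<lambda>x. \<integral>y. k x y \<partial>\<nu>)"
    and abs_integral_kernel: "\<bar>\<integral>x. \<integral>y. k x y \<partial>\<nu> \<partial>\<mu>\<bar> \<le> B"
proof -
  interpret \<mu>: prob_space \<mu> by fact
  interpret \<nu>: prob_space \<nu> by fact
  have bound: "\<bar>integral\<^sup>L M f\<bar> \<le> B" if "prob_space M" "AE x in M. \<bar>f x\<bar> \<le> B" "integrable M f" for M :: "complex measure" and f
  proof -
    interpret prob_space M by fact
    have "integral\<^sup>L M f \<le> (\<integral>x. B \<partial>M)" "(\<integral>x. - B \<partial>M) \<le> integral\<^sup>L M f"
      using that by (intro integral_mono_AE; auto)+
    then show ?thesis by (simp add: prob_space)
  qed
  show 1: "integrable \<nu> (k x)" if "x \<in> S" for x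
    by (rule \<nu>.integrable_const_bound[where B = B]) (use S(2) k that in auto)
  have 2: "\<bar>\<integral>y. k x y \<partial>\<nu>\<bar> \<le> B" if "x \<in> S" for x
  proof (rule bound)
    show "AE y in \<nu>. \<bar>k x y\<bar> \<le> B" using S(2) by eventually_elim (use k that in simp)
  qed (use 1 that assms in auto)
  show 3: "integrable \<mu> (\<lambda>x. \<integral>y. k x y \<partial>\<nu>)"
    by (rule \<mu>.integrable_const_bound[where B = B]) (use S(1) 2 in auto)
  show "\<bar>\<integral>x. \<integral>y. k x y \<partial>\<nu> \<partial>\<mu>\<bar> \<le> B"
  proof (rule bound)
    show "AE x in \<mu>. \<bar>\<integral>y. k x y \<partial>\<nu>\<bar> \<le> B" using S(1) by eventually_elim (use 2 in simp)
  qed (use 3 assms in auto)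
qed

lemma integral_kernel_diff:
  fixes k k' :: "complex \<Rightarrow> complex \<Rightarrow> real"
  assumes "prob_space \<mu>" "prob_space \<nu>" and [measurable_cong]: "sets \<mu> = sets borel" "sets \<nu> = sets borel"
    and [measurable]: "(\<lambda>(x, y). k x y) \<in> borel_measurable (borel \<Otimes>\<^sub>M borel)"
      "(\<lambda>(x, y). k' x y) \<in> borel_measurable (borel \<Otimes>\<^sub>M borel)"
    and S: "AE x in \<mu>. x \<in> S" "AE y in \<nu>. y \<in> S"
    and k: "\<And>x y. x \<in> S \<Longrightarrow> y \<in> S \<Longrightarrow> \<bar>k x y\<bar> \<le> B" "\<And>x y. x \<in> S \<Longrightarrow> y \<in> S \<Longrightarrow> \<bar>k' x y\<bar> \<le> B'"
  shows "(\<integral>x. \<integral>y. k x y - k' x y \<partial>\<nu> \<partial>\<mu>) = (\<integral>x. \<integral>y. k x y \<partial>\<nu> \<partial>\<mu>) - (\<integral>x. \<integral>y. k' x y \<partial>\<nu> \<partial>\<mu>)"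
proof -
  note i = integrable_kernel_inner[OF assms(1-5) S k(1)] integrable_kernel_inner[OF assms(1-4,6) S k(2)]
  have "(\<integral>x. \<integral>y. k x y - k' x y \<partial>\<nu> \<partial>\<mu>) = (\<integral>x. (\<integral>y. k x y \<partial>\<nu>) - (\<integral>y. k' x y \<partial>\<nu>) \<partial>\<mu>)"
  proof (rule integral_cong_AE)
    show "AE x in \<mu>. (\<integral>y. k x y - k' x y \<partial>\<nu>) = (\<integral>y. k x y \<partial>\<nu>) - (\<integral>y. k' x y \<partial>\<nu>)"
      using S(1) by eventually_elim (use i in simp)
    interpret \<nu>: prob_space \<nu> by fact
    show "(\<lambda>x. \<integral>y. k x y - k' x y \<partial>\<nu>) \<in> borel_measurable \<mu>"
      "(\<lambda>x. (\<integral>y. k x y \<partial>\<nu>) - (\<integral>y. k' x y \<partial>\<nu>)) \<in> borel_measurable \<mu>" by measurable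
  qed
  then show ?thesis
    using integrable_kernel[OF assms(1-5) S k(1)] integrable_kernel[OF assms(1-4,6) S k(2)] by simp
qed

lemma edist_diff:
  fixes k k' :: "complex \<Rightarrow> complex \<Rightarrow> real"
  assumes \<mu>: "prob_space \<mu>" "sets \<mu> = sets borel" and \<nu>: "prob_space \<nu>" "sets \<nu> = sets borel"
    and [measurable]: "(\<lambda>(x, y). k x y) \<in> borel_measurable (borel \<Otimes>\<^sub>M borel)"
      "(\<lambda>(x, y). k' x y) \<in> borel_measurable (borel \<Otimes>\<^sub>M borel)"
    and S: "AE x in \<mu>. x \<in> S" "AE y in \<nu>. y \<in> S"
    and k: "\<And>x y. x \<in> S \<Longrightarrow> y \<in> S \<Longrightarrow> \<bar>k x y\<bar> \<le> B" "\<And>x y. x \<in> S \<Longrightarrow> y \<in> S \<Longrightarrow> \<bar>k' x y\<bar> \<le> B'"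
  shows "edist (\<lambda>x y. k x y - k' x y) \<mu> \<nu> = edist k \<mu> \<nu> - edist k' \<mu> \<nu>"
  unfolding edist_def
  using integral_kernel_diff[OF \<mu>(1) \<mu>(1) \<mu>(2) \<mu>(2) assms(5,6) S(1) S(1) k]
    integral_kernel_diff[OF \<mu>(1) \<nu>(1) \<mu>(2) \<nu>(2) assms(5,6) S k]
    integral_kernel_diff[OF \<nu>(1) \<nu>(1) \<nu>(2) \<nu>(2) assms(5,6) S(2) S(2) k] by simp

lemma abs_edist_le:
  fixes k :: "complex \<Rightarrow> complex \<Rightarrow> real"
  assumes \<mu>: "prob_space \<mu>" "sets \<mu> = sets borel" and \<nu>: "prob_space \<nu>" "sets \<nu> = sets borel"
    and [measurable]: "(\<lambda>(x, y). k x y) \<in> borel_measurable (borel \<Otimes>\<^sub>M borel)"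
    and S: "AE x in \<mu>. x \<in> S" "AE y in \<nu>. y \<in> S"
    and k: "\<And>x y. x \<in> S \<Longrightarrow> y \<in> S \<Longrightarrow> \<bar>k x y\<bar> \<le> B"
  shows "\<bar>edist k \<mu> \<nu>\<bar> \<le> 4 * B"
  unfolding edist_def
  using abs_integral_kernel[OF \<mu>(1) \<mu>(1) \<mu>(2) \<mu>(2) assms(5) S(1) S(1) k]
    abs_integral_kernel[OF \<mu>(1) \<nu>(1) \<mu>(2) \<nu>(2) assms(5) S k]
    abs_integral_kernel[OF \<nu>(1) \<nu>(1) \<nu>(2) \<nu>(2) assms(5) S(2) S(2) k] by linarith

definition gauss_kernel :: "real \<Rightarrow> complex \<Rightarrow> complex \<Rightarrow> real" where
  "gauss_kernel t x y = exp (- t * (cmod (x - y))\<^sup>2)"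

lemma measurable_gauss_kernel [measurable]:
  "(\<lambda>(x, y). gauss_kernel t x y) \<in> borel_measurable (borel \<Otimes>\<^sub>M borel)"
  unfolding gauss_kernel_def by measurable

text \<open>The features are Gaussians with twice the exponent, indexed by their centre. Their
  autocorrelation carries the factor \<open>pi / (4 * t)\<close>, whose inverse stands in front of
  the integral. Square integrability of the difference is what later permits pairing it with test
  functions.\<close>

lemma
  assumes t: "0 < t" and \<mu>: "prob_space \<mu>" "sets \<mu> = sets borel" and \<nu>: "prob_space \<nu>" "sets \<nu> = sets borel"
  shows integrable_gauss_diff: "integrable lborel (\<lambda>w. ((\<integral>x. gauss_kernel (2 * t) x w \<partial>\<mu>) - (\<integral>x. gauss_kernel (2 * t) x w \<partial>\<nu>))\<^sup>2)"
    and edist_gauss_eq: "edist (gauss_kernel t) \<mu> \<nu>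
      = 4 * t / pi * (\<integral>w. ((\<integral>x. gauss_kernel (2 * t) x w \<partial>\<mu>) - (\<integral>x. gauss_kernel (2 * t) x w \<partial>\<nu>))\<^sup>2 \<partial>lborel)"
proof -
  have m: "(\<lambda>(\<theta>, x). gauss_kernel (2 * t) x \<theta>) \<in> borel_measurable (lborel \<Otimes>\<^sub>M borel)"
    unfolding gauss_kernel_def by measurable
  have Fk: "(\<integral>\<^sup>+\<theta>. ennreal (gauss_kernel (2 * t) x \<theta>) * ennreal (gauss_kernel (2 * t) y \<theta>) \<partial>lborel)
      = ennreal (pi / (4 * t) * gauss_kernel t x y)" for x y
    unfolding gauss_kernel_def using nn_integral_gaussian_autocorrelation[OF t, of x y] by (simp add: mult.assoc)
  have m2: "(\<lambda>(x, y). pi / (4 * t) * gauss_kernel t x y) \<in> borel_measurable (borel \<Otimes>\<^sub>M borel)"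
    by measurable
  have b: "0 \<le> pi / (4 * t) * gauss_kernel t x y" "pi / (4 * t) * gauss_kernel t x y \<le> pi / (4 * t)" for x y
    using t mult_left_mono[of "gauss_kernel t x y" 1 "pi / (4 * t)"] by (auto simp: gauss_kernel_def)
  have p: "0 \<le> gauss_kernel (2 * t) x \<theta>" for x \<theta> by (simp add: gauss_kernel_def)
  note f = sigma_finite_lborel \<mu> \<nu> m p Fk m2 b
  show "integrable lborel (\<lambda>w. ((\<integral>x. gauss_kernel (2 * t) x w \<partial>\<mu>) - (\<integral>x. gauss_kernel (2 * t) x w \<partial>\<nu>))\<^sup>2)"
    by (rule integrable_edist_feature[OF f])
  have "edist (\<lambda>x y. pi / (4 * t) * gauss_kernel t x y) \<mu> \<nu> = pi / (4 * t) * edist (gauss_kernel t) \<mu> \<nu>"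
    by (simp add: edist_def algebra_simps)
  with edist_eq_integral_feature[OF f]
  show "edist (gauss_kernel t) \<mu> \<nu>
      = 4 * t / pi * (\<integral>w. ((\<integral>x. gauss_kernel (2 * t) x w \<partial>\<mu>) - (\<integral>x. gauss_kernel (2 * t) x w \<partial>\<nu>))\<^sup>2 \<partial>lborel)"
    using t by (simp add: field_simps)
qed

text \<open>Stability in the width: with \<open>q\<close> the squared distance,
  \<open>exp (- T * q) * (1 - exp (- ((t - T) * q)))\<close> is at most
  \<open>(t - T) * q * exp (- T * q)\<close>, hence at most \<open>(t - T) / T\<close>, and a kernel
  bounded by \<open>b\<close> has a form of size at most \<open>4 * b\<close>.\<close>

lemma edist_gauss_mono:
  assumes t: "0 < T" "T \<le> t" and \<mu>: "prob_space \<mu>" "sets \<mu> = sets borel" and \<nu>: "prob_space \<nu>" "sets \<nu> = sets borel"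
  shows "edist (gauss_kernel T) \<mu> \<nu> - 4 * ((t - T) / T) \<le> edist (gauss_kernel t) \<mu> \<nu>"
proof -
  have b: "\<bar>gauss_kernel T x y - gauss_kernel t x y\<bar> \<le> (t - T) / T" for x y
  proof -
    define q where "q = (cmod (x - y))\<^sup>2"
    have q: "0 \<le> q" by (simp add: q_def)
    have "1 + (- ((t - T) * q)) \<le> exp (- ((t - T) * q))" by (rule exp_ge_add_one_self)
    then have 1: "1 - exp (- ((t - T) * q)) \<le> (t - T) * q" by simp
    have "T * q \<le> exp (T * q)" using exp_ge_add_one_self[of "T * q"] by linarith
    then have 2: "q * exp (- T * q) \<le> 1 / T"
      using t by (simp add: exp_minus field_simps)
    have "gauss_kernel T x y - gauss_kernel t x y = exp (- T * q) * (1 - exp (- ((t - T) * q)))"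
      by (simp add: gauss_kernel_def q_def[symmetric] algebra_simps flip: exp_add)
    also have "\<dots> \<le> exp (- T * q) * ((t - T) * q)" using 1 by (intro mult_left_mono) auto
    also have "\<dots> = (t - T) * (q * exp (- T * q))" by simp
    also have "\<dots> \<le> (t - T) * (1 / T)" using 2 t by (intro mult_left_mono) auto
    finally have "gauss_kernel T x y - gauss_kernel t x y \<le> (t - T) / T" by simp
    moreover have "gauss_kernel t x y \<le> gauss_kernel T x y"
      using t by (auto simp: gauss_kernel_def intro!: mult_right_mono)
    ultimately show ?thesis by simp
  qed
  have g: "\<bar>gauss_kernel T x y\<bar> \<le> 1" "\<bar>gauss_kernel t x y\<bar> \<le> 1" for x y
    using t by (auto simp: gauss_kernel_def)
  have "edist (\<lambda>x y. gauss_kernel T x y - gauss_kernel t x y) \<mu> \<nu> = edist (gauss_kernel T) \<mu> \<nu> - edist (gauss_kernel t) \<mu> \<nu>"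
    by (rule edist_diff[OF \<mu> \<nu>, where S = UNIV and B = 1 and B' = 1]) (use g in auto)
  moreover have "\<bar>edist (\<lambda>x y. gauss_kernel T x y - gauss_kernel t x y) \<mu> \<nu>\<bar> \<le> 4 * ((t - T) / T)"
    by (rule abs_edist_le[OF \<mu> \<nu>, where S = UNIV]) (use b in auto)
  ultimately show ?thesis by linarith
qed

section \<open>The regularised logarithm as a mixture of Gaussians\<close>

definition reg_log :: "real \<Rightarrow> complex \<Rightarrow> complex \<Rightarrow> real" where
  "reg_log e x y = - ln ((cmod (x - y))\<^sup>2 + e) / 2"

lemma measurable_reg_log [measurable]:
  "(\<lambda>(x, y). reg_log e x y) \<in> borel_measurable (borel \<Otimes>\<^sub>M borel)"
  unfolding reg_log_def by measurable

lemma reg_log_le_neg_ln: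
  assumes "x \<noteq> y" "0 < e"
  shows "reg_log e x y \<le> - ln (cmod (x - y))"
proof -
  have "2 * ln (cmod (x - y)) = ln ((cmod (x - y))\<^sup>2)" using assms by (simp add: ln_realpow)
  also have "\<dots> \<le> ln ((cmod (x - y))\<^sup>2 + e)" using assms by (subst ln_le_cancel_iff) (auto simp: add_nonneg_pos)
  finally show ?thesis by (simp add: reg_log_def)
qed

lemma nn_integral_exp_inverse:
  assumes "0 < (a::real)"
  shows "(\<integral>\<^sup>+t\<in>{0..}. ennreal (exp (- t * a)) \<partial>lborel) = ennreal (1 / a)"
proof -
  have "(\<integral>\<^sup>+t. ennreal (exp (- t * a)) * indicator {0..} t \<partial>lborel) = ennreal (0 - (- exp (- 0 * a) / a))"
  proof (rule nn_integral_FTC_atLeast)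
    show "((\<lambda>t. - exp (- t * a) / a) has_real_derivative exp (- t * a)) (at t)" for t
      using assms by (auto intro!: derivative_eq_intros)
    show "((\<lambda>t. - exp (- t * a) / a) \<longlongrightarrow> 0) at_top"
      using assms by real_asymp
  qed auto
  then show ?thesis by simp
qed

lemma nn_integral_inverse_ln:
  assumes "0 < e" "e \<le> E" "0 \<le> q"
  shows "(\<integral>\<^sup>+s\<in>{e..E}. ennreal (1 / (q + s)) \<partial>lborel) = ennreal (ln ((q + E) / (q + e)))"
proof -
  have "(\<integral>\<^sup>+s. ennreal (1 / (q + s)) * indicator {e..E} s \<partial>lborel) = ennreal (ln (q + E) - ln (q + e))"
    by (rule nn_integral_FTC_Icc) (use assms in \<open>auto intro!: derivative_eq_intros\<close>)
  then show ?thesis using assms by (simp add: ln_div)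
qed

text \<open>With \<open>q\<close> the squared distance, half the logarithm of
  \<open>(q + E) / (q + e)\<close> is half the integral of \<open>exp (- t * (q + s))\<close> over
  \<open>t > 0\<close> and \<open>s\<close> in \<open>[e, E]\<close>, and
  \<open>exp (- t * q)\<close> is \<open>4 * t / pi\<close> times the autocorrelation of a Gaussian
  with exponent \<open>2 * t\<close>. The feature therefore carries the square root of
  \<open>2 * t / pi * exp (- t * s)\<close>.\<close>

definition log_feature :: "real \<Rightarrow> real \<Rightarrow> real \<times> real \<times> complex \<Rightarrow> complex \<Rightarrow> real" where
  "log_feature e E = (\<lambda>(s, t, w) x. indicator {e..E} s * indicator {0<..} t * sqrt (2 * t / pi * exp (- t * s))
      * gauss_kernel (2 * t) x w)"

lemma measurable_log_feature [measurable]: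
  "(\<lambda>(\<theta>, x). log_feature e E \<theta> x) \<in> borel_measurable ((lborel \<Otimes>\<^sub>M lborel \<Otimes>\<^sub>M lborel) \<Otimes>\<^sub>M borel)"
  unfolding log_feature_def gauss_kernel_def case_prod_beta' by measurable

text \<open>With \<open>q\<close> the squared distance, integrating out \<open>w\<close> leaves
  \<open>exp (- t * (q + s)) / 2\<close>, then \<open>t\<close> leaves
  \<open>1 / (2 * (q + s))\<close>, and \<open>s\<close> gives half the logarithm of
  \<open>(q + E) / (q + e)\<close>.\<close>

lemma nn_integral_log_feature:
  assumes e: "0 < e" "e \<le> E"
  shows "(\<integral>\<^sup>+\<theta>. ennreal (log_feature e E \<theta> x) * ennreal (log_feature e E \<theta> y) \<partial>(lborel \<Otimes>\<^sub>M lborel \<Otimes>\<^sub>M lborel))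
     = ennreal (reg_log e x y - reg_log E x y)"
proof -
  have L: "sigma_finite_measure (lborel \<Otimes>\<^sub>M lborel :: (real \<times> complex) measure)"
    by (rule sigma_finite_pair_measure) standard+
  have [measurable]: "(\<lambda>\<theta>. log_feature e E \<theta> x) \<in> borel_measurable (lborel \<Otimes>\<^sub>M lborel \<Otimes>\<^sub>M lborel)" for x
    unfolding log_feature_def gauss_kernel_def case_prod_beta' by measurable
  define q where "q = (cmod (x - y))\<^sup>2"
  have q: "0 \<le> q" by (simp add: q_def)
  have inner: "(\<integral>\<^sup>+w. ennreal (log_feature e E (s, t, w) x) * ennreal (log_feature e E (s, t, w) y) \<partial>lborel)
     = ennreal (exp (- t * (q + s)) / 2) * indicator {0<..} t * indicator {e..E} s" (is "?L = ?R") for s t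
  proof (cases "s \<in> {e..E} \<and> 0 < t")
    case True
    then have "ennreal (log_feature e E (s, t, w) x) * ennreal (log_feature e E (s, t, w) y)
      = ennreal (2 * t / pi * exp (- t * s)) * (ennreal (gauss_kernel (2 * t) x w) * ennreal (gauss_kernel (2 * t) y w))" for w
    proof -
      let ?g = "gauss_kernel (2 * t)" and ?c = "2 * t / pi * exp (- t * s)"
      have f: "log_feature e E (s, t, w) z = sqrt ?c * ?g z w" for z using True by (simp add: log_feature_def)
      have c: "0 \<le> ?c" using True by simp
      have g: "0 \<le> ?g z w" for z by (simp add: gauss_kernel_def)
      have "sqrt ?c * ?g x w * (sqrt ?c * ?g y w) = (sqrt ?c * sqrt ?c) * (?g x w * ?g y w)" by (simp only: ac_simps)
      also have "sqrt ?c * sqrt ?c = ?c" using c by (rule real_sqrt_mult_self[THEN trans, OF abs_of_nonneg])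
      finally have "sqrt ?c * ?g x w * (sqrt ?c * ?g y w) = ?c * (?g x w * ?g y w)" .
      then show ?thesis unfolding f using c g[of x] g[of y]
        by (simp only: ennreal_mult[symmetric] real_sqrt_ge_zero mult_nonneg_nonneg)
    qed
    then have "?L = ennreal (2 * t / pi * exp (- t * s)) * (\<integral>\<^sup>+w. ennreal (gauss_kernel (2 * t) x w) * ennreal (gauss_kernel (2 * t) y w) \<partial>lborel)"
      by (simp only:) (rule nn_integral_cmult, simp add: gauss_kernel_def)
    also have "(\<integral>\<^sup>+w. ennreal (gauss_kernel (2 * t) x w) * ennreal (gauss_kernel (2 * t) y w) \<partial>lborel)
        = ennreal (pi / (4 * t) * exp (- t * q))"
      using True nn_integral_gaussian_autocorrelation[of t x y] by (simp add: gauss_kernel_def q_def mult.assoc)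
    also have "ennreal (2 * t / pi * exp (- t * s)) * ennreal (pi / (4 * t) * exp (- t * q))
        = ennreal (2 * t / pi * exp (- t * s) * (pi / (4 * t) * exp (- t * q)))"
      using True by (intro ennreal_mult[symmetric]) auto
    also have "2 * t / pi * exp (- t * s) * (pi / (4 * t) * exp (- t * q)) = exp (- t * s) * exp (- t * q) / 2"
      using True by (simp add: field_simps)
    also have "exp (- t * s) * exp (- t * q) = exp (- t * (q + s))"
      by (simp add: algebra_simps flip: exp_add)
    finally show ?thesis using True by simp
  next
    case False
    then show ?thesis by (auto simp: log_feature_def)
  qed
  have t: "(\<integral>\<^sup>+t. ennreal (exp (- t * (q + s)) / 2) * indicator {0<..} t * indicator {e..E} s \<partial>lborel)
      = ennreal (1 / 2) * (ennreal (1 / (q + s)) * indicator {e..E} s)" for s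
  proof (cases "s \<in> {e..E}")
    case True
    then have s: "0 < q + s" using q e by auto
    have "(\<integral>\<^sup>+t. ennreal (exp (- t * (q + s)) / 2) * indicator {0<..} t * indicator {e..E} s \<partial>lborel)
      = (\<integral>\<^sup>+t. ennreal (1 / 2) * (ennreal (exp (- t * (q + s))) * indicator {0..} t) \<partial>lborel)"
    proof (rule nn_integral_cong_AE, use AE_lborel_singleton[of 0] in eventually_elim)
      fix t :: real assume "t \<noteq> 0"
      then show "ennreal (exp (- t * (q + s)) / 2) * indicator {0<..} t * indicator {e..E} s
        = ennreal (1 / 2) * (ennreal (exp (- t * (q + s))) * indicator {0..} t)"
        using True ennreal_mult'[of "1 / 2" "exp (- t * (q + s))"] by (simp add: indicator_def del: ennreal_half)
    qed
    also have "\<dots> = ennreal (1 / 2) * ennreal (1 / (q + s))"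
      by (subst nn_integral_cmult) (use nn_integral_exp_inverse[OF s] in auto)
    finally show ?thesis using True by simp
  qed auto
  have "(\<integral>\<^sup>+\<theta>. ennreal (log_feature e E \<theta> x) * ennreal (log_feature e E \<theta> y) \<partial>(lborel \<Otimes>\<^sub>M lborel \<Otimes>\<^sub>M lborel))
    = (\<integral>\<^sup>+s. \<integral>\<^sup>+tw. ennreal (log_feature e E (s, tw) x) * ennreal (log_feature e E (s, tw) y) \<partial>(lborel \<Otimes>\<^sub>M lborel) \<partial>lborel)"
    by (rule sigma_finite_measure.nn_integral_fst[OF L, symmetric]) measurable
  also have "\<dots> = (\<integral>\<^sup>+s. \<integral>\<^sup>+t. \<integral>\<^sup>+w. ennreal (log_feature e E (s, t, w) x) * ennreal (log_feature e E (s, t, w) y) \<partial>lborel \<partial>lborel \<partial>lborel)"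
    by (intro nn_integral_cong lborel.nn_integral_fst[symmetric]) measurable
  also have "\<dots> = (\<integral>\<^sup>+s. ennreal (1 / 2) * (ennreal (1 / (q + s)) * indicator {e..E} s) \<partial>lborel)"
    by (simp only: inner t)
  also have "\<dots> = ennreal (1 / 2) * ennreal (ln ((q + E) / (q + e)))"
    by (subst nn_integral_cmult) (use nn_integral_inverse_ln[OF e q] in auto)
  also have "\<dots> = ennreal (reg_log e x y - reg_log E x y)"
  proof -
    have "0 < q + e" "0 < q + E" using e q by auto
    then have "1 / 2 * ln ((q + E) / (q + e)) = reg_log e x y - reg_log E x y"
      by (simp add: reg_log_def q_def[symmetric] ln_div field_simps)
    then show ?thesis using ennreal_mult'[of "1 / 2" "ln ((q + E) / (q + e))"] by (simp only:)
  qed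
  finally show ?thesis .
qed

text \<open>All features contribute nonnegatively, so the integral may be cut down to
  \<open>s\<close> in \<open>[e, e + 1]\<close> and \<open>t\<close> in
  \<open>[T, T + \<tau>]\<close>. On this box of area \<tau> the weight is at least
  \<open>exp (- (T + 1) * (e + 1)) / 2\<close>, and the Gaussian form is at least its value at
  \<open>T\<close> minus \<open>4 * (\<tau> / T)\<close>. A single width has measure zero in the
  mixture, hence the slab of width \<tau>.\<close>

lemma edist_log_ge_gauss:
  assumes e: "0 < e" "e + 1 \<le> E" and T: "0 < T" "0 < \<tau>" "\<tau> \<le> 1"
    and \<mu>: "prob_space \<mu>" "sets \<mu> = sets borel" and \<nu>: "prob_space \<nu>" "sets \<nu> = sets borel"
  shows "exp (- (T + 1) * (e + 1)) / 2 * \<tau> * (edist (gauss_kernel T) \<mu> \<nu> - 4 * (\<tau> / T))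
    \<le> edist (\<lambda>x y. reg_log e x y - reg_log E x y) \<mu> \<nu>"
    and edist_log_diff_nonneg: "0 \<le> edist (\<lambda>x y. reg_log e x y - reg_log E x y) \<mu> \<nu>"
proof -
  have L: "sigma_finite_measure (lborel \<Otimes>\<^sub>M lborel :: (real \<times> complex) measure)"
    by (rule sigma_finite_pair_measure) standard+
  interpret \<mu>: prob_space \<mu> by fact
  interpret \<nu>: prob_space \<nu> by fact
  note [measurable_cong] = \<mu>(2) \<nu>(2)
  let ?\<Theta> = "lborel \<Otimes>\<^sub>M lborel \<Otimes>\<^sub>M lborel :: (real \<times> real \<times> complex) measure"
  have sf: "sigma_finite_measure ?\<Theta>"
    by (rule sigma_finite_pair_measure) standard+
  have eE: "e \<le> E" using e by simp
  have p: "0 \<le> log_feature e E \<theta> x" for \<theta> x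
    by (auto simp: log_feature_def gauss_kernel_def case_prod_beta' indicator_def)
  have [measurable]: "(\<lambda>(x, y). reg_log e x y - reg_log E x y) \<in> borel_measurable (borel \<Otimes>\<^sub>M borel)"
    by measurable
  have k: "0 \<le> reg_log e x y - reg_log E x y" "reg_log e x y - reg_log E x y \<le> ln (E / e) / 2" for x y
  proof -
    define q where "q = (cmod (x - y))\<^sup>2"
    have q: "0 \<le> q" by (simp add: q_def)
    have "ln (q + e) \<le> ln (q + E)" using e q by simp
    then show "0 \<le> reg_log e x y - reg_log E x y" by (simp add: reg_log_def q_def)
    have "q * e \<le> q * E" using e q by (intro mult_left_mono) auto
    then have "(q + E) / (q + e) \<le> E / e" using e q by (simp add: field_simps)
    then have "ln ((q + E) / (q + e)) \<le> ln (E / e)" using e q by (subst ln_le_cancel_iff) (auto intro!: divide_pos_pos add_nonneg_pos)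
    then show "reg_log e x y - reg_log E x y \<le> ln (E / e) / 2"
      using e q by (simp add: reg_log_def q_def[symmetric] ln_div add_nonneg_pos)
  qed
  let ?d = "\<lambda>\<theta>. ((\<integral>x. log_feature e E \<theta> x \<partial>\<mu>) - (\<integral>x. log_feature e E \<theta> x \<partial>\<nu>))\<^sup>2"
  let ?D = "edist (\<lambda>x y. reg_log e x y - reg_log E x y) \<mu> \<nu>"
  note f = sf \<mu> \<nu> measurable_log_feature p nn_integral_log_feature[OF e(1) eE] _ k
  have I: "integrable ?\<Theta> ?d" by (rule integrable_edist_feature[OF f]) measurable
  have D: "?D = (\<integral>\<theta>. ?d \<theta> \<partial>?\<Theta>)" by (rule edist_eq_integral_feature[OF f]) measurable
  show D0: "0 \<le> ?D" unfolding D by simp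
  define G where "G = edist (gauss_kernel T) \<mu> \<nu>"
  define h where "h t w = ((\<integral>x. gauss_kernel (2 * t) x w \<partial>\<mu>) - (\<integral>x. gauss_kernel (2 * t) x w \<partial>\<nu>))\<^sup>2" for t w
  define c where "c = exp (- (T + 1) * (e + 1)) / 2 * (G - 4 * (\<tau> / T))"
  show "exp (- (T + 1) * (e + 1)) / 2 * \<tau> * (edist (gauss_kernel T) \<mu> \<nu> - 4 * (\<tau> / T)) \<le> ?D"
  proof (cases "0 \<le> G - 4 * (\<tau> / T)")
    case False
    then have "exp (- (T + 1) * (e + 1)) / 2 * \<tau> * (G - 4 * (\<tau> / T)) \<le> 0"
      using T by (intro mult_nonneg_nonpos) auto
    then show ?thesis using D0 unfolding G_def by linarith
  next
    case G: True
    have low: "ennreal c \<le> (\<integral>\<^sup>+w. ennreal (?d (s, t, w)) \<partial>lborel)" if s: "s \<in> {e..e + 1}" and t: "t \<in> {T..T + \<tau>}" for s t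
    proof -
      have t0: "0 < t" using t T by auto
      have feq: "log_feature e E (s, t, w) x = sqrt (2 * t / pi * exp (- t * s)) * gauss_kernel (2 * t) x w" for w x
        using s t e t0 by (simp add: log_feature_def)
      have deq: "?d (s, t, w) = 2 * t / pi * exp (- t * s) * h t w" for w
        using t0 by (simp add: feq h_def power_mult_distrib flip: right_diff_distrib)
      have "(\<integral>\<^sup>+w. ennreal (?d (s, t, w)) \<partial>lborel) = ennreal (\<integral>w. ?d (s, t, w) \<partial>lborel)"
        unfolding deq h_def using integrable_gauss_diff[OF t0 \<mu> \<nu>] t0 by (intro nn_integral_eq_integral) auto
      also have "(\<integral>w. ?d (s, t, w) \<partial>lborel) = 2 * t / pi * exp (- t * s) * (pi / (4 * t) * edist (gauss_kernel t) \<mu> \<nu>)"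
        unfolding deq edist_gauss_eq[OF t0 \<mu> \<nu>] h_def using t0 by simp
      also have "\<dots> = exp (- t * s) / 2 * edist (gauss_kernel t) \<mu> \<nu>" using t0 by simp
      finally have eq: "(\<integral>\<^sup>+w. ennreal (?d (s, t, w)) \<partial>lborel) = ennreal (exp (- t * s) / 2 * edist (gauss_kernel t) \<mu> \<nu>)" .
      have "G - 4 * ((t - T) / T) \<le> edist (gauss_kernel t) \<mu> \<nu>"
        unfolding G_def using t T by (intro edist_gauss_mono \<mu> \<nu>) auto
      moreover have "(t - T) / T \<le> \<tau> / T" using t T by (intro divide_right_mono) auto
      ultimately have g: "G - 4 * (\<tau> / T) \<le> edist (gauss_kernel t) \<mu> \<nu>" by linarith
      have "t * s \<le> (T + 1) * (e + 1)" using s t T e by (intro mult_mono) auto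
      then have "exp (- (T + 1) * (e + 1)) / 2 \<le> exp (- t * s) / 2" by (simp add: algebra_simps)
      then have "c \<le> exp (- t * s) / 2 * edist (gauss_kernel t) \<mu> \<nu>"
        unfolding c_def using g G by (intro mult_mono) auto
      then show ?thesis unfolding eq by (rule ennreal_leI)
    qed
    have c0: "0 \<le> c" using G by (simp add: c_def)
    have [measurable]: "?d \<in> borel_measurable ?\<Theta>" by measurable
    have "ennreal (c * \<tau>) = (\<integral>\<^sup>+s. \<integral>\<^sup>+t. ennreal c * indicator {T..T + \<tau>} t * indicator {e..e + 1} s \<partial>lborel \<partial>lborel)"
      using T c0 by (simp add: nn_integral_multc nn_integral_cmult ennreal_mult)
    also have "\<dots> \<le> (\<integral>\<^sup>+s. \<integral>\<^sup>+t. \<integral>\<^sup>+w. ennreal (?d (s, t, w)) \<partial>lborel \<partial>lborel \<partial>lborel)"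
      by (intro nn_integral_mono) (use low in \<open>auto simp: indicator_def\<close>)
    also have "\<dots> = (\<integral>\<^sup>+s. \<integral>\<^sup>+tw. ennreal (?d (s, tw)) \<partial>(lborel \<Otimes>\<^sub>M lborel) \<partial>lborel)"
      by (intro nn_integral_cong lborel.nn_integral_fst) measurable
    also have "\<dots> = (\<integral>\<^sup>+\<theta>. ennreal (?d \<theta>) \<partial>?\<Theta>)"
      by (rule sigma_finite_measure.nn_integral_fst[OF L]) measurable
    also have "\<dots> = ennreal ?D" unfolding D using I by (intro nn_integral_eq_integral) auto
    finally have "c * \<tau> \<le> ?D" using D0 by (simp add: ennreal_le_iff)
    then show ?thesis unfolding c_def G_def by (simp add: mult_ac)
  qed
qed

lemma edist_const: "prob_space \<mu> \<Longrightarrow> prob_space \<nu> \<Longrightarrow> edist (\<lambda>x y. c) \<mu> \<nu> = 0"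
  by (simp add: edist_def prob_space.prob_space)

lemma abs_reg_log_le:
  assumes "0 < e" "cmod (x - y) \<le> D"
  shows "\<bar>reg_log e x y\<bar> \<le> \<bar>ln e\<bar> + \<bar>ln (D\<^sup>2 + e)\<bar>"
proof -
  have "(cmod (x - y))\<^sup>2 \<le> D\<^sup>2" using assms by (intro power_mono) auto
  then have "ln e \<le> ln ((cmod (x - y))\<^sup>2 + e)" "ln ((cmod (x - y))\<^sup>2 + e) \<le> ln (D\<^sup>2 + e)"
    using assms by (auto simp: add_nonneg_pos)
  then show ?thesis unfolding reg_log_def by linarith
qed

text \<open>Let \<open>E\<close> tend to infinity in the bound for the difference kernel.
  \<open>reg_log E\<close> does not vanish in the limit but approaches the constant
  \<open>- ln E / 2\<close>, which the form ignores because both measures have mass one; on a disc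
  of radius \<open>R\<close> the deviation is at most \<open>2 * R\<^sup>2 / E\<close>.\<close>

lemma
  assumes e: "0 < e" and \<mu>: "prob_space \<mu>" "sets \<mu> = sets borel" and \<nu>: "prob_space \<nu>" "sets \<nu> = sets borel"
    and R: "AE x in \<mu>. cmod x \<le> R" "AE x in \<nu>. cmod x \<le> R"
  shows edist_reg_log_ge_gauss: "\<And>T \<tau>. 0 < T \<Longrightarrow> 0 < \<tau> \<Longrightarrow> \<tau> \<le> 1 \<Longrightarrow>
      exp (- (T + 1) * (e + 1)) / 2 * \<tau> * (edist (gauss_kernel T) \<mu> \<nu> - 4 * (\<tau> / T)) \<le> edist (reg_log e) \<mu> \<nu>"
    and edist_reg_log_nonneg: "0 \<le> edist (reg_log e) \<mu> \<nu>"
proof -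
  have S: "AE x in \<mu>. x \<in> cball (0::complex) R" "AE x in \<nu>. x \<in> cball 0 R" using R by auto
  have xy: "cmod (x - y) \<le> 2 * R" if "x \<in> cball (0::complex) R" "y \<in> cball (0::complex) R" for x y
    using norm_triangle_ineq4[of x y] that by auto
  have "edist (\<lambda>x y. reg_log e x y - reg_log E x y) \<mu> \<nu> \<le> edist (reg_log e) \<mu> \<nu> + 8 * R\<^sup>2 / E"
    if E: "e + 1 \<le> E" for E
  proof -
    have E0: "0 < E" using e E by simp
    have 1: "edist (\<lambda>x y. reg_log e x y - reg_log E x y) \<mu> \<nu> = edist (reg_log e) \<mu> \<nu> - edist (reg_log E) \<mu> \<nu>"
      by (rule edist_diff[OF \<mu> \<nu> _ _ S]) (use abs_reg_log_le[OF _ xy] e E0 in auto)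
    have 2: "edist (\<lambda>x y. reg_log E x y - (- ln E / 2)) \<mu> \<nu> = edist (reg_log E) \<mu> \<nu> - edist (\<lambda>x y. - ln E / 2) \<mu> \<nu>"
      by (rule edist_diff[OF \<mu> \<nu> _ _ S, where B' = "\<bar>ln E / 2\<bar>"]) (use abs_reg_log_le[OF _ xy] e E0 in auto)
    have "\<bar>edist (\<lambda>x y. reg_log E x y - (- ln E / 2)) \<mu> \<nu>\<bar> \<le> 4 * (2 * R\<^sup>2 / E)"
    proof (rule abs_edist_le[OF \<mu> \<nu> _ S])
      fix x y :: complex assume xyS: "x \<in> cball 0 R" "y \<in> cball 0 R"
      define q where "q = (cmod (x - y))\<^sup>2"
      have q: "0 \<le> q" "q \<le> (2 * R)\<^sup>2" using xy[OF xyS] power_mono[of "cmod (x - y)" "2 * R" 2] unfolding q_def by auto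
      have "reg_log E x y - (- ln E / 2) = - ln (1 + q / E) / 2"
      proof -
        have "q + E = E * (1 + q / E)" using E0 by (simp add: field_simps)
        moreover have "0 < 1 + q / E" using E0 q by (simp add: add_pos_nonneg)
        ultimately have "ln (q + E) = ln E + ln (1 + q / E)" using E0 by (metis ln_mult_pos)
        then show ?thesis unfolding reg_log_def q_def[symmetric] by linarith
      qed
      moreover have "ln (1 + q / E) \<le> q / E" "0 \<le> ln (1 + q / E)"
        using E0 q by (auto intro!: ln_add_one_self_le_self)
      moreover have "q / E \<le> 4 * R\<^sup>2 / E" using q E0 by (intro divide_right_mono) (auto simp: power_mult_distrib)
      ultimately show "\<bar>reg_log E x y - (- ln E / 2)\<bar> \<le> 2 * R\<^sup>2 / E" by simp
    qed measurable
    then show ?thesis using 1 2 edist_const[OF \<mu>(1) \<nu>(1)] by (simp add: algebra_simps)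
  qed
  then have ev: "\<forall>\<^sub>F E in at_top. edist (\<lambda>x y. reg_log e x y - reg_log E x y) \<mu> \<nu> \<le> edist (reg_log e) \<mu> \<nu> + 8 * R\<^sup>2 / E"
    using eventually_ge_at_top[of "e + 1"] by (rule eventually_mono[rotated])
  have lim: "((\<lambda>E. edist (reg_log e) \<mu> \<nu> + 8 * R\<^sup>2 / E) \<longlongrightarrow> edist (reg_log e) \<mu> \<nu>) at_top"
  proof -
    have "((\<lambda>E. a + b / E) \<longlongrightarrow> a) at_top" for a b :: real by real_asymp
    then show ?thesis by blast
  qed
  have main: "c \<le> edist (reg_log e) \<mu> \<nu>"
    if "\<And>E. e + 1 \<le> E \<Longrightarrow> c \<le> edist (\<lambda>x y. reg_log e x y - reg_log E x y) \<mu> \<nu>" for c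
  proof (rule tendsto_lowerbound[OF lim])
    show "\<forall>\<^sub>F E in at_top. c \<le> edist (reg_log e) \<mu> \<nu> + 8 * R\<^sup>2 / E"
      using ev eventually_ge_at_top[of "e + 1"] by eventually_elim (use that in force)
  qed simp
  show "exp (- (T + 1) * (e + 1)) / 2 * \<tau> * (edist (gauss_kernel T) \<mu> \<nu> - 4 * (\<tau> / T)) \<le> edist (reg_log e) \<mu> \<nu>"
    if "0 < T" "0 < \<tau>" "\<tau> \<le> 1" for T \<tau>
    by (rule main) (rule edist_log_ge_gauss[OF e _ that \<mu> \<nu>])
  show "0 \<le> edist (reg_log e) \<mu> \<nu>"
    by (rule main) (rule edist_log_diff_nonneg[OF e _ zero_less_one zero_less_one order_refl \<mu> \<nu>])
qed

lemma edist_gauss_nonneg: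
  assumes "0 < t" "prob_space \<mu>" "sets \<mu> = sets borel" "prob_space \<nu>" "sets \<nu> = sets borel"
  shows "0 \<le> edist (gauss_kernel t) \<mu> \<nu>"
  using assms by (subst edist_gauss_eq) auto

subsection \<open>Weak convergence from convergence in energy\<close>

text \<open>The scale \<open>e\<close> supplied by the assumption depends on the accuracy, so the
  constant in \<open>edist_reg_log_ge_gauss\<close> must not degenerate with \<open>e\<close>; the
  bound \<open>e \<le> 1\<close> keeps it above the number \<open>a\<close> of the proof, which is
  fixed before \<open>e\<close> is chosen.\<close>

lemma edist_gauss_tendsto_0:
  assumes \<mu>: "\<And>n. prob_space (\<mu> n)" "\<And>n. sets (\<mu> n) = sets borel" and \<nu>: "prob_space \<nu>" "sets \<nu> = sets borel"
    and R: "\<And>n. \<exists>R. AE x in \<mu> n. cmod x \<le> R" "\<exists>R. AE x in \<nu>. cmod x \<le> R"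
    and lim: "\<And>\<kappa>. 0 < \<kappa> \<Longrightarrow> \<exists>e. 0 < e \<and> e \<le> 1 \<and> (\<forall>\<^sub>F n in sequentially. edist (reg_log e) (\<mu> n) \<nu> \<le> \<kappa>)"
    and T: "0 < T"
  shows "(\<lambda>n. edist (gauss_kernel T) (\<mu> n) \<nu>) \<longlonglongrightarrow> 0"
proof (rule LIMSEQ_I)
  fix \<epsilon> :: real assume \<epsilon>: "0 < \<epsilon>"
  \<comment> \<open>Makes the loss \<open>4 * (\<tau> / T)\<close> from varying the width at most a
    quarter of \<epsilon>.\<close>
  define \<tau> where "\<tau> = min 1 (T * \<epsilon> / 16)"
  have \<tau>: "0 < \<tau>" "\<tau> \<le> 1" using T \<epsilon> by (auto simp: \<tau>_def)
  have "\<tau> \<le> T * \<epsilon> / 16" by (simp add: \<tau>_def)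
  then have "\<tau> / T \<le> \<epsilon> / 16" using T by (simp add: pos_divide_le_eq mult.commute)
  then have \<tau>T: "4 * (\<tau> / T) \<le> \<epsilon> / 4" by linarith
  define a where "a = exp (- (T + 1) * 2) / 2 * \<tau>"
  have a: "0 < a" using \<tau> by (simp add: a_def)
  obtain e where e: "0 < e" "e \<le> 1" and ev: "\<forall>\<^sub>F n in sequentially. edist (reg_log e) (\<mu> n) \<nu> \<le> a * (\<epsilon> / 4)"
    using lim[of "a * (\<epsilon> / 4)"] a \<epsilon> by auto
  have "\<forall>\<^sub>F n in sequentially. norm (edist (gauss_kernel T) (\<mu> n) \<nu> - 0) < \<epsilon>"
    using ev
  proof eventually_elim
    fix n assume le: "edist (reg_log e) (\<mu> n) \<nu> \<le> a * (\<epsilon> / 4)"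
    obtain R1 R2 where "AE x in \<mu> n. cmod x \<le> R1" "AE x in \<nu>. cmod x \<le> R2" using R by metis
    then have R': "AE x in \<mu> n. cmod x \<le> max R1 R2" "AE x in \<nu>. cmod x \<le> max R1 R2" by auto
    let ?G = "edist (gauss_kernel T) (\<mu> n) \<nu>"
    have g: "exp (- (T + 1) * (e + 1)) / 2 * \<tau> * (?G - 4 * (\<tau> / T)) \<le> a * (\<epsilon> / 4)"
      using edist_reg_log_ge_gauss[OF e(1) \<mu> \<nu> R' T \<tau>] le by linarith
    have "?G < \<epsilon>"
    proof (cases "?G - 4 * (\<tau> / T) \<le> 0")
      case False
      have "(T + 1) * (e + 1) \<le> (T + 1) * 2" using e T by (intro mult_left_mono) auto
      then have "a \<le> exp (- (T + 1) * (e + 1)) / 2 * \<tau>"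
        unfolding a_def using \<tau> by (intro mult_right_mono) (auto simp: algebra_simps)
      then have "a * (?G - 4 * (\<tau> / T)) \<le> exp (- (T + 1) * (e + 1)) / 2 * \<tau> * (?G - 4 * (\<tau> / T))"
        using False by (intro mult_right_mono) auto
      then have "a * (?G - 4 * (\<tau> / T)) \<le> a * (\<epsilon> / 4)" using g by linarith
      then have "?G - 4 * (\<tau> / T) \<le> \<epsilon> / 4" using a by simp
      then show ?thesis using \<tau>T \<epsilon> by linarith
    qed (use \<tau>T \<epsilon> in linarith)
    then show "norm (?G - 0) < \<epsilon>" using edist_gauss_nonneg[OF T \<mu> \<nu>] by simp
  qed
  then show "\<exists>n0. \<forall>n\<ge>n0. norm (edist (gauss_kernel T) (\<mu> n) \<nu> - 0) < \<epsilon>"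
    by (simp add: eventually_sequentially)
qed

lemma
  assumes "0 < t"
  shows integrable_gauss: "integrable lborel (gauss_kernel t x)"
    and integral_gauss: "(\<integral>w. gauss_kernel t x w \<partial>lborel) = pi / t"
proof -
  have eq: "(\<integral>\<^sup>+w. ennreal (gauss_kernel t x w) \<partial>lborel) = ennreal (pi / t)"
    using nn_integral_gaussian_complex[OF assms, of x] by (simp add: gauss_kernel_def norm_minus_commute)
  show "integrable lborel (gauss_kernel t x)"
    by (rule integrableI_nonneg) (auto simp: eq, auto simp: gauss_kernel_def)
  show "(\<integral>w. gauss_kernel t x w \<partial>lborel) = pi / t"
    using assms by (subst integral_eq_nn_integral) (auto simp: eq, auto simp: gauss_kernel_def)
qed

definition gauss_smooth :: "real \<Rightarrow> (complex \<Rightarrow> real) \<Rightarrow> complex \<Rightarrow> real" where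
  "gauss_smooth t f x = t / pi * (\<integral>w. f w * gauss_kernel t x w \<partial>lborel)"

text \<open>Near and far points are merged into one bound
  \<open>|f w - f x| \<le> \<epsilon> + 2 * B * q / \<delta>\<^sup>2\<close>, with \<open>q\<close>
  the squared distance. The factor \<open>q\<close> is absorbed by half of the exponent at the price
  \<open>2 / t\<close>, so that both terms are explicit Gaussian integrals.\<close>

lemma abs_gauss_smooth_diff_le:
  assumes t: "0 < t" and f [measurable]: "f \<in> borel_measurable borel" and B: "\<And>x. \<bar>f x\<bar> \<le> B"
    and \<delta>: "0 < \<delta>" "\<And>w. cmod (x - w) < \<delta> \<Longrightarrow> \<bar>f w - f x\<bar> \<le> \<epsilon>" and \<epsilon>: "0 \<le> \<epsilon>"
  shows "\<bar>gauss_smooth t f x - f x\<bar> \<le> \<epsilon> + 8 * B / (\<delta>\<^sup>2 * t)"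
proof -
  note i = integrable_gauss[OF t, of x]
  have B0: "0 \<le> B" using B[of 0] by linarith
  have i2: "integrable lborel (gauss_kernel (t / 2) x)" using t by (intro integrable_gauss) simp
  have i1: "integrable lborel (\<lambda>w. f w * gauss_kernel t x w)"
    by (rule Bochner_Integration.integrable_bound[OF integrable_mult_right[OF i, of B]])
       (use B in \<open>auto simp: abs_mult B0 intro!: mult_right_mono\<close>)
  have pw: "\<bar>f w * gauss_kernel t x w - f x * gauss_kernel t x w\<bar> \<le> \<epsilon> * gauss_kernel t x w + 4 * B / (\<delta>\<^sup>2 * t) * gauss_kernel (t / 2) x w" for w
  proof -
    define q where "q = (cmod (x - w))\<^sup>2"
    have q0: "0 \<le> q" by (simp add: q_def)
    have g: "gauss_kernel t x w = exp (- (t / 2 * q)) * gauss_kernel (t / 2) x w" "0 < gauss_kernel (t / 2) x w" "0 < gauss_kernel t x w"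
      by (auto simp: gauss_kernel_def q_def[symmetric] simp flip: exp_add)
    have "\<bar>f w - f x\<bar> \<le> \<epsilon> + 2 * B * q / \<delta>\<^sup>2"
    proof (cases "cmod (x - w) < \<delta>")
      case True
      have "0 \<le> 2 * B * q / \<delta>\<^sup>2" using B0 q0 by simp
      then show ?thesis using \<delta>(2)[OF True] by linarith
    next
      case False
      then have "\<delta>\<^sup>2 \<le> q" unfolding q_def using \<delta> by (intro power_mono) auto
      then have "2 * B * \<delta>\<^sup>2 \<le> 2 * B * q" using B0 by (intro mult_left_mono) auto
      then have "2 * B \<le> 2 * B * q / \<delta>\<^sup>2" using \<delta> by (simp add: field_simps)
      then show ?thesis using B[of w] B[of x] \<epsilon> by linarith
    qed
    then have "\<bar>f w - f x\<bar> * gauss_kernel t x w \<le> (\<epsilon> + 2 * B * q / \<delta>\<^sup>2) * gauss_kernel t x w"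
      using g by (intro mult_right_mono) auto
    also have "\<dots> = \<epsilon> * gauss_kernel t x w + 2 * B / \<delta>\<^sup>2 * (q * gauss_kernel t x w)"
      by (simp add: algebra_simps)
    finally have 1: "\<bar>f w - f x\<bar> * gauss_kernel t x w \<le> \<epsilon> * gauss_kernel t x w + 2 * B / \<delta>\<^sup>2 * (q * gauss_kernel t x w)" .
    have "q * gauss_kernel t x w \<le> 2 / t * gauss_kernel (t / 2) x w"
    proof -
      have "t / 2 * q \<le> exp (t / 2 * q)" using exp_ge_add_one_self[of "t / 2 * q"] by linarith
      then have "q * exp (- (t / 2 * q)) \<le> 2 / t" using t by (simp add: exp_minus field_simps)
      then have "q * exp (- (t / 2 * q)) * gauss_kernel (t / 2) x w \<le> 2 / t * gauss_kernel (t / 2) x w"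
        using g(2) by (intro mult_right_mono) auto
      then show ?thesis unfolding g(1) by (simp only: mult.assoc)
    qed
    then have 2: "2 * B / \<delta>\<^sup>2 * (q * gauss_kernel t x w) \<le> 2 * B / \<delta>\<^sup>2 * (2 / t * gauss_kernel (t / 2) x w)"
      using B0 by (intro mult_left_mono) auto
    have 3: "2 * B / \<delta>\<^sup>2 * (2 / t * gauss_kernel (t / 2) x w) = 4 * B / (\<delta>\<^sup>2 * t) * gauss_kernel (t / 2) x w"
      by simp
    have "\<bar>f w * gauss_kernel t x w - f x * gauss_kernel t x w\<bar> = \<bar>f w - f x\<bar> * gauss_kernel t x w"
      using g(3) by (simp add: abs_mult flip: left_diff_distrib)
    with 1 2 3 show ?thesis by linarith
  qed
  have "gauss_smooth t f x - f x = t / pi * (\<integral>w. f w * gauss_kernel t x w - f x * gauss_kernel t x w \<partial>lborel)"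
    using i i1 t by (simp add: gauss_smooth_def integral_gauss algebra_simps)
  also have "\<bar>\<dots>\<bar> \<le> t / pi * (\<integral>w. \<epsilon> * gauss_kernel t x w + 4 * B / (\<delta>\<^sup>2 * t) * gauss_kernel (t / 2) x w \<partial>lborel)"
  proof -
    have "\<bar>\<integral>w. f w * gauss_kernel t x w - f x * gauss_kernel t x w \<partial>lborel\<bar>
      \<le> (\<integral>w. \<bar>f w * gauss_kernel t x w - f x * gauss_kernel t x w\<bar> \<partial>lborel)"
      by (rule integral_abs_bound)
    also have "\<dots> \<le> (\<integral>w. \<epsilon> * gauss_kernel t x w + 4 * B / (\<delta>\<^sup>2 * t) * gauss_kernel (t / 2) x w \<partial>lborel)"
      using i i1 i2 pw by (intro integral_mono) auto
    finally show ?thesis using t by (simp add: abs_mult divide_right_mono)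
  qed
  also have "\<dots> = \<epsilon> + 8 * B / (\<delta>\<^sup>2 * t)"
  proof -
    have "(\<integral>w. \<epsilon> * gauss_kernel t x w + 4 * B / (\<delta>\<^sup>2 * t) * gauss_kernel (t / 2) x w \<partial>lborel)
      = \<epsilon> * (pi / t) + 4 * B / (\<delta>\<^sup>2 * t) * (pi / (t / 2))"
      using i i2 t integral_gauss[of t x] integral_gauss[of "t / 2" x] by simp
    then show ?thesis using t \<delta>(1) by (simp only:) (simp add: field_simps)
  qed
  finally show ?thesis .
qed

text \<open>Fubini moves the smoothing from \<open>f\<close> to the measure, where it becomes the
  Gaussian feature that \<open>edist_gauss_eq\<close> controls.\<close>

lemma integral_gauss_smooth:
  assumes t: "0 < t" and \<mu>: "prob_space \<mu>" and [measurable_cong]: "sets \<mu> = sets borel" and f: "integrable lborel f"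
  shows "(\<integral>x. gauss_smooth t f x \<partial>\<mu>) = t / pi * (\<integral>w. f w * (\<integral>x. gauss_kernel t x w \<partial>\<mu>) \<partial>lborel)"
proof -
  interpret \<mu>: prob_space \<mu> by fact
  interpret P: pair_sigma_finite \<mu> "lborel :: complex measure" ..
  have [measurable]: "f \<in> borel_measurable borel" using borel_measurable_integrable[OF f] by simp
  have [measurable]: "(\<lambda>(x, w). gauss_kernel t x w) \<in> borel_measurable (\<mu> \<Otimes>\<^sub>M lborel)"
    unfolding gauss_kernel_def by measurable
  have g: "0 \<le> gauss_kernel t x w" "gauss_kernel t x w \<le> 1" for x w using t by (auto simp: gauss_kernel_def)
  have "integrable (\<mu> \<Otimes>\<^sub>M lborel) (\<lambda>(x, w). f w)"
  proof (rule P.Fubini_integrable)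
    show "(\<lambda>(x, w). f w) \<in> borel_measurable (\<mu> \<Otimes>\<^sub>M lborel)" by measurable
    show "integrable \<mu> (\<lambda>x. \<integral>y. norm (case (x, y) of (x, w) \<Rightarrow> f w) \<partial>lborel)" by simp
    show "AE x in \<mu>. integrable lborel (\<lambda>y. case (x, y) of (x, w) \<Rightarrow> f w)" using f by simp
  qed
  then have I: "integrable (\<mu> \<Otimes>\<^sub>M lborel) (\<lambda>(x, w). f w * gauss_kernel t x w)"
  proof (rule Bochner_Integration.integrable_bound)
    show "(\<lambda>(x, w). f w * gauss_kernel t x w) \<in> borel_measurable (\<mu> \<Otimes>\<^sub>M lborel)" by measurable
    show "AE p in \<mu> \<Otimes>\<^sub>M lborel. norm (case p of (x, w) \<Rightarrow> f w * gauss_kernel t x w) \<le> norm (case p of (x, w) \<Rightarrow> f w)"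
      using g by (intro AE_I2) (auto simp: abs_mult mult_left_le)
  qed
  have "(\<integral>x. gauss_smooth t f x \<partial>\<mu>) = t / pi * (\<integral>x. (\<integral>w. f w * gauss_kernel t x w \<partial>lborel) \<partial>\<mu>)"
    by (simp add: gauss_smooth_def)
  also have "(\<integral>x. (\<integral>w. f w * gauss_kernel t x w \<partial>lborel) \<partial>\<mu>) = (\<integral>w. (\<integral>x. f w * gauss_kernel t x w \<partial>\<mu>) \<partial>lborel)"
    using P.Fubini_integral[OF I] by simp
  finally show ?thesis by simp
qed

lemma compact_support_uniform_bound:
  fixes f :: "complex \<Rightarrow> real"
  assumes f: "continuous_on UNIV f" and R: "\<And>x. R < cmod x \<Longrightarrow> f x = 0" and \<epsilon>: "0 < \<epsilon>"
  obtains \<delta> where "0 < \<delta>" "\<And>x w. cmod (x - w) < \<delta> \<Longrightarrow> \<bar>f w - f x\<bar> \<le> \<epsilon>"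
proof -
  have "uniformly_continuous_on (cball 0 (R + 1)) f"
    by (intro compact_uniformly_continuous continuous_on_subset[OF f]) auto
  then obtain d where d: "0 < d" "\<And>x w. x \<in> cball 0 (R + 1) \<Longrightarrow> w \<in> cball 0 (R + 1) \<Longrightarrow> dist w x < d \<Longrightarrow> dist (f w) (f x) < \<epsilon>"
    using \<epsilon> unfolding uniformly_continuous_on_def by metis
  show ?thesis
  proof (rule that[of "min d 1"])
    fix x w assume *: "cmod (x - w) < min d 1"
    show "\<bar>f w - f x\<bar> \<le> \<epsilon>"
    proof (cases "x \<in> cball 0 (R + 1) \<and> w \<in> cball 0 (R + 1)")
      case True
      then show ?thesis using d(2)[of x w] * by (simp add: dist_norm norm_minus_commute)
    next
      case False
      then have "R < cmod x \<and> R < cmod w"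
        using * norm_triangle_ineq2[of x w] norm_triangle_ineq2[of w x] by (auto simp: norm_minus_commute)
      then show ?thesis using R \<epsilon> by simp
    qed
  qed (use d in auto)
qed

text \<open>Smoothing \<open>f\<close> changes its integral little against every probability measure
  at once. The integral of the smoothed function against the difference of the two measures is a
  multiple of the L2 product of \<open>f\<close> with \<open>h n\<close>, the difference of the
  smoothed measures, and the squared L2 norm of \<open>h n\<close> is a multiple of the Gaussian
  form. Continuity and compact support put \<open>f\<close> into L2.\<close>

lemma tendsto_compact_support:
  fixes f :: "complex \<Rightarrow> real"
  assumes \<mu>: "\<And>n. prob_space (\<mu> n)" "\<And>n. sets (\<mu> n) = sets borel" and \<nu>: "prob_space \<nu>" "sets \<nu> = sets borel"
    and G: "\<And>T. 0 < T \<Longrightarrow> (\<lambda>n. edist (gauss_kernel T) (\<mu> n) \<nu>) \<longlonglongrightarrow> 0"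
    and f: "continuous_on UNIV f" and B: "\<And>x. \<bar>f x\<bar> \<le> B" and R: "\<And>x. R < cmod x \<Longrightarrow> f x = 0"
  shows "(\<lambda>n. \<integral>x. f x \<partial>\<mu> n) \<longlonglongrightarrow> (\<integral>x. f x \<partial>\<nu>)"
proof (rule LIMSEQ_I)
  fix \<epsilon> :: real assume \<epsilon>: "0 < \<epsilon>"
  have [measurable]: "f \<in> borel_measurable borel" using f by (rule borel_measurable_continuous_onI)
  have B0: "0 \<le> B" using B[of 0] by linarith
  have fi: "f x = indicator (cball 0 R) x *\<^sub>R f x" "(f x)\<^sup>2 = indicator (cball 0 R) x *\<^sub>R (f x)\<^sup>2" for x
    using R[of x] by (auto simp: indicator_def)
  have If: "integrable lborel f"
  proof -
    have "integrable lborel (\<lambda>x. indicator (cball 0 R) x *\<^sub>R f x)"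
      by (intro borel_integrable_compact continuous_on_subset[OF f]) auto
    then show ?thesis by (simp only: fi(1)[symmetric])
  qed
  have If2: "integrable lborel (\<lambda>x. (f x)\<^sup>2)"
  proof -
    have "integrable lborel (\<lambda>x. indicator (cball 0 R) x *\<^sub>R (f x)\<^sup>2)"
      by (intro borel_integrable_compact continuous_intros continuous_on_subset[OF f]) auto
    then show ?thesis by (simp only: fi(2)[symmetric])
  qed
  define A where "A = (\<integral>x. (f x)\<^sup>2 \<partial>lborel)"
  have A0: "0 \<le> A" by (simp add: A_def)
  obtain \<delta> where \<delta>: "0 < \<delta>" "\<And>x w. cmod (x - w) < \<delta> \<Longrightarrow> \<bar>f w - f x\<bar> \<le> \<epsilon> / 8"
    using compact_support_uniform_bound[where \<epsilon> = "\<epsilon> / 8" and R = R, OF f R] \<epsilon> by auto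
  \<comment> \<open>Large enough for the error \<open>8 * B / (\<delta>\<^sup>2 * (2 * T))\<close>
    to stay below \<open>\<epsilon> / 8\<close>; the summand 1 keeps \<open>T\<close> positive when
    \<open>B = 0\<close>.\<close>
  define T where "T = 1 + 64 * B / (\<delta>\<^sup>2 * \<epsilon>)"
  have T: "0 < T" using B0 \<epsilon> \<delta> by (simp add: T_def add_pos_nonneg)
  have "8 * B \<le> \<epsilon> / 8 * (\<delta>\<^sup>2 * T)"
    using \<delta>(1) \<epsilon> by (simp add: T_def field_simps)
  then have TT: "8 * B / (\<delta>\<^sup>2 * (2 * T)) \<le> \<epsilon> / 8"
    using T \<delta>(1) \<epsilon> B0 by (simp add: pos_divide_le_eq field_simps)
  have sm: "\<bar>gauss_smooth (2 * T) f x - f x\<bar> \<le> \<epsilon> / 4" for x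
  proof -
    have "\<bar>gauss_smooth (2 * T) f x - f x\<bar> \<le> \<epsilon> / 8 + 8 * B / (\<delta>\<^sup>2 * (2 * T))"
      by (rule abs_gauss_smooth_diff_le) (use T B \<delta> \<epsilon> in auto)
    then show ?thesis using TT by linarith
  qed
  have [measurable]: "gauss_smooth (2 * T) f \<in> borel_measurable borel"
    unfolding gauss_smooth_def gauss_kernel_def by measurable
  have sm_int: "\<bar>(\<integral>x. gauss_smooth (2 * T) f x \<partial>M) - (\<integral>x. f x \<partial>M)\<bar> \<le> \<epsilon> / 4"
    if "prob_space M" and [measurable_cong]: "sets M = sets borel" for M :: "complex measure" 
  proof -
    interpret prob_space M by fact
    have i1: "integrable M f" by (rule integrable_const_bound[where B = B]) (use B in auto)
    have "\<bar>gauss_smooth (2 * T) f x\<bar> \<le> B + \<epsilon> / 4" for x using sm[of x] B[of x] by linarith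
    then have i2: "integrable M (gauss_smooth (2 * T) f)"
      by (intro integrable_const_bound[where B = "B + \<epsilon> / 4"]) auto
    have "\<bar>(\<integral>x. gauss_smooth (2 * T) f x \<partial>M) - (\<integral>x. f x \<partial>M)\<bar> = \<bar>\<integral>x. gauss_smooth (2 * T) f x - f x \<partial>M\<bar>"
      using i1 i2 by simp
    also have "\<dots> \<le> (\<integral>x. \<bar>gauss_smooth (2 * T) f x - f x\<bar> \<partial>M)" by (rule integral_abs_bound)
    also have "\<dots> \<le> (\<integral>x. \<epsilon> / 4 \<partial>M)" using i1 i2 sm by (intro integral_mono) auto
    finally show ?thesis by (simp add: prob_space)
  qed
  define h where "h n w = (\<integral>x. gauss_kernel (2 * T) x w \<partial>\<mu> n) - (\<integral>x. gauss_kernel (2 * T) x w \<partial>\<nu>)" for n w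
  have h1: "\<bar>\<integral>x. gauss_kernel (2 * T) x w \<partial>M\<bar> \<le> 1" "(\<lambda>w. \<integral>x. gauss_kernel (2 * T) x w \<partial>M) \<in> borel_measurable borel"
    if "prob_space M" and [measurable_cong]: "sets M = sets borel" for M :: "complex measure" and w
  proof -
    interpret prob_space M by fact
    have "\<bar>\<integral>x. gauss_kernel (2 * T) x w \<partial>M\<bar> \<le> (\<integral>x. \<bar>gauss_kernel (2 * T) x w\<bar> \<partial>M)" by (rule integral_abs_bound)
    also have "\<dots> \<le> (\<integral>x. 1 \<partial>M)"
      by (rule integral_mono_AE) (use T in \<open>auto intro!: integrable_const_bound[where B = 1] simp: gauss_kernel_def\<close>)
    finally show "\<bar>\<integral>x. gauss_kernel (2 * T) x w \<partial>M\<bar> \<le> 1" by (simp add: prob_space)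
    show "(\<lambda>w. \<integral>x. gauss_kernel (2 * T) x w \<partial>M) \<in> borel_measurable borel"
      unfolding gauss_kernel_def by measurable
  qed
  have Ig: "integrable lborel (\<lambda>w. f w * (\<integral>x. gauss_kernel (2 * T) x w \<partial>M))"
    if "prob_space M" "sets M = sets borel" for M
    by (rule Bochner_Integration.integrable_bound[OF If])
       (use h1[OF that] in \<open>auto simp: abs_mult mult_left_le\<close>)
  have bound: "\<bar>(\<integral>x. gauss_smooth (2 * T) f x \<partial>\<mu> n) - (\<integral>x. gauss_smooth (2 * T) f x \<partial>\<nu>)\<bar>
     \<le> 2 * T / pi * (\<kappa> * A + (pi / (4 * T) * edist (gauss_kernel T) (\<mu> n) \<nu>) / \<kappa>)" if \<kappa>: "0 < \<kappa>" for n \<kappa>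
  proof -
    have Ih: "integrable lborel (\<lambda>w. (h n w)\<^sup>2)"
      unfolding h_def by (rule integrable_gauss_diff[OF T \<mu> \<nu>])
    have hh: "pi / (4 * T) * edist (gauss_kernel T) (\<mu> n) \<nu> = (\<integral>w. (h n w)\<^sup>2 \<partial>lborel)"
      unfolding h_def edist_gauss_eq[OF T \<mu> \<nu>] using T by simp
    have Ifh: "integrable lborel (\<lambda>w. f w * h n w)"
      unfolding h_def right_diff_distrib using Ig \<mu> \<nu> by auto
    \<comment> \<open>A weighted inequality of arithmetic and geometric means takes the place of
      Cauchy-Schwarz; the weight \<kappa> is fixed below, independently of \<open>n\<close>.\<close>
    have pw: "\<bar>f w * h n w\<bar> \<le> \<kappa> * (f w)\<^sup>2 + (h n w)\<^sup>2 / \<kappa>" for w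
    proof -
      have "(\<kappa> * \<bar>f w\<bar> - \<bar>h n w\<bar>)\<^sup>2 = \<kappa> * \<kappa> * (\<bar>f w\<bar> * \<bar>f w\<bar>) + \<bar>h n w\<bar> * \<bar>h n w\<bar> - 2 * (\<kappa> * (\<bar>f w\<bar> * \<bar>h n w\<bar>))"
        by (simp only: power2_eq_square) (simp add: algebra_simps del: abs_mult_self_eq)
      also have "\<dots> = \<kappa> * \<kappa> * (f w)\<^sup>2 + (h n w)\<^sup>2 - 2 * (\<kappa> * \<bar>f w * h n w\<bar>)"
        by (simp add: power2_eq_square abs_mult)
      finally have "2 * (\<kappa> * \<bar>f w * h n w\<bar>) \<le> \<kappa> * \<kappa> * (f w)\<^sup>2 + (h n w)\<^sup>2"
        using zero_le_power2[of "\<kappa> * \<bar>f w\<bar> - \<bar>h n w\<bar>"] by linarith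
      moreover have "0 \<le> \<kappa> * \<bar>f w * h n w\<bar>" using \<kappa> by simp
      ultimately have "\<kappa> * \<bar>f w * h n w\<bar> \<le> \<kappa> * \<kappa> * (f w)\<^sup>2 + (h n w)\<^sup>2" by linarith
      also have "\<dots> = \<kappa> * (\<kappa> * (f w)\<^sup>2 + (h n w)\<^sup>2 / \<kappa>)" using \<kappa> by (simp add: field_simps)
      finally show ?thesis using \<kappa> by simp
    qed
    have "(\<integral>x. gauss_smooth (2 * T) f x \<partial>\<mu> n) - (\<integral>x. gauss_smooth (2 * T) f x \<partial>\<nu>) = 2 * T / pi * (\<integral>w. f w * h n w \<partial>lborel)"
      using T Ig[OF \<mu>] Ig[OF \<nu>] unfolding h_def right_diff_distrib
      by (simp add: integral_gauss_smooth[OF _ \<mu> If] integral_gauss_smooth[OF _ \<nu> If] right_diff_distrib)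
    also have "\<bar>\<dots>\<bar> = 2 * T / pi * \<bar>\<integral>w. f w * h n w \<partial>lborel\<bar>" using T by (simp add: abs_mult)
    also have "\<dots> \<le> 2 * T / pi * (\<kappa> * A + (pi / (4 * T) * edist (gauss_kernel T) (\<mu> n) \<nu>) / \<kappa>)"
    proof (rule mult_left_mono)
      have "\<bar>\<integral>w. f w * h n w \<partial>lborel\<bar> \<le> (\<integral>w. \<bar>f w * h n w\<bar> \<partial>lborel)" by (rule integral_abs_bound)
      also have "\<dots> \<le> (\<integral>w. \<kappa> * (f w)\<^sup>2 + (h n w)\<^sup>2 / \<kappa> \<partial>lborel)"
        using Ifh If2 Ih pw by (intro integral_mono) auto
      also have "\<dots> = \<kappa> * A + (pi / (4 * T) * edist (gauss_kernel T) (\<mu> n) \<nu>) / \<kappa>"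
        unfolding hh using If2 Ih by (simp add: A_def)
      finally show "\<bar>\<integral>w. f w * h n w \<partial>lborel\<bar> \<le> \<kappa> * A + (pi / (4 * T) * edist (gauss_kernel T) (\<mu> n) \<nu>) / \<kappa>" .
    qed (use T in simp)
    finally show ?thesis .
  qed
  \<comment> \<open>Brings the contribution of \<open>f\<close> below \<open>\<epsilon> / 8\<close>
    for all \<open>n\<close>; \<open>A + 1\<close> avoids dividing by zero.\<close>
  define \<kappa> where "\<kappa> = \<epsilon> / 8 / (2 * T / pi * (A + 1))"
  have \<kappa>: "0 < \<kappa>" using \<epsilon> T A0 by (simp add: \<kappa>_def)
  have "2 * T / pi * (\<kappa> * A) \<le> 2 * T / pi * (\<kappa> * (A + 1))" using T \<kappa> by (intro mult_left_mono) auto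
  also have "\<dots> = \<epsilon> / 8" using T A0 by (simp add: \<kappa>_def)
  finally have \<kappa>A: "2 * T / pi * (\<kappa> * A) \<le> \<epsilon> / 8" .
  have "(\<lambda>n. 2 * T / pi * ((pi / (4 * T) * edist (gauss_kernel T) (\<mu> n) \<nu>) / \<kappa>)) \<longlonglongrightarrow> 2 * T / pi * ((pi / (4 * T) * 0) / \<kappa>)"
    using \<kappa> by (intro tendsto_intros G T) auto
  then have "(\<lambda>n. 2 * T / pi * ((pi / (4 * T) * edist (gauss_kernel T) (\<mu> n) \<nu>) / \<kappa>)) \<longlonglongrightarrow> 0" by simp
  then have "\<forall>\<^sub>F n in sequentially. 2 * T / pi * ((pi / (4 * T) * edist (gauss_kernel T) (\<mu> n) \<nu>) / \<kappa>) < \<epsilon> / 8"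
    by (rule order_tendstoD) (use \<epsilon> in simp)
  then have "\<forall>\<^sub>F n in sequentially. norm ((\<integral>x. f x \<partial>\<mu> n) - (\<integral>x. f x \<partial>\<nu>)) < \<epsilon>"
  proof eventually_elim
    fix n assume "2 * T / pi * ((pi / (4 * T) * edist (gauss_kernel T) (\<mu> n) \<nu>) / \<kappa>) < \<epsilon> / 8"
    then have "\<bar>(\<integral>x. gauss_smooth (2 * T) f x \<partial>\<mu> n) - (\<integral>x. gauss_smooth (2 * T) f x \<partial>\<nu>)\<bar> < \<epsilon> / 4"
      using bound[OF \<kappa>, of n] \<kappa>A by (simp only: distrib_left)
    then show "norm ((\<integral>x. f x \<partial>\<mu> n) - (\<integral>x. f x \<partial>\<nu>)) < \<epsilon>"
      using sm_int[OF \<mu>, of n] sm_int[OF \<nu>] \<epsilon> unfolding real_norm_def by linarith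
  qed
  then show "\<exists>n0. \<forall>n\<ge>n0. norm ((\<integral>x. f x \<partial>\<mu> n) - (\<integral>x. f x \<partial>\<nu>)) < \<epsilon>"
    by (simp add: eventually_sequentially)
qed

text \<open>No mass escapes to infinity: the limit has mass one, so some cutoff has integral close
  to 1 against \<nu>, and the cutoff is itself a compactly supported test function, which carries
  this over to \<open>\<mu> n\<close> for large \<open>n\<close>. Multiplying \<open>f\<close> by
  the cutoff costs at most \<open>B\<close> times the mass cut off.\<close>

lemma weak_conv_C_of_compact_support:
  assumes \<mu>: "\<And>n. prob_space (\<mu> n)" "\<And>n. sets (\<mu> n) = sets borel" and \<nu>: "prob_space \<nu>" "sets \<nu> = sets borel"
    and lim: "\<And>(f :: complex \<Rightarrow> real) B R. continuous_on UNIV f \<Longrightarrow> (\<And>x. \<bar>f x\<bar> \<le> B) \<Longrightarrow> (\<And>x. R < cmod x \<Longrightarrow> f x = 0) \<Longrightarrow>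
       (\<lambda>n. \<integral>x. f x \<partial>\<mu> n) \<longlonglongrightarrow> (\<integral>x. f x \<partial>\<nu>)"
  shows "weak_conv_C \<mu> \<nu>"
  unfolding weak_conv_C_def
proof (intro allI impI)
  fix f :: "complex \<Rightarrow> real" assume f: "continuous_on UNIV f \<and> bounded (range f)"
  then have [measurable]: "f \<in> borel_measurable borel" by (intro borel_measurable_continuous_onI) auto
  obtain B where B: "0 < B" "\<And>x. \<bar>f x\<bar> \<le> B" using f by (auto simp: bounded_pos)
  define cutoff :: "nat \<Rightarrow> complex \<Rightarrow> real" where "cutoff r x = max 0 (min 1 (real r + 1 - cmod x))" for r x
  have cut_cont: "continuous_on UNIV (cutoff r)" for r unfolding cutoff_def by (intro continuous_intros)
  then have [measurable]: "cutoff r \<in> borel_measurable borel" for r by (rule borel_measurable_continuous_onI)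
  have cutoff: "0 \<le> cutoff r x" "cutoff r x \<le> 1" for r x by (auto simp: cutoff_def)
  have int: "integrable M f" "integrable M (cutoff r)" "integrable M (\<lambda>x. f x * cutoff r x)"
    and cut: "\<bar>(\<integral>x. f x \<partial>M) - (\<integral>x. f x * cutoff r x \<partial>M)\<bar> \<le> B * (1 - (\<integral>x. cutoff r x \<partial>M))"
    if "prob_space M" and [measurable_cong]: "sets M = sets borel" for M :: "complex measure" and r
  proof -
    interpret prob_space M by fact
    show i: "integrable M f" "integrable M (cutoff r)"
      by (rule integrable_const_bound[where B = B] integrable_const_bound[where B = 1]; use B cutoff in auto)+
    show i3: "integrable M (\<lambda>x. f x * cutoff r x)"
      by (rule Bochner_Integration.integrable_bound[OF i(1)]) (use cutoff in \<open>auto simp: abs_mult mult_left_le\<close>)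
    have i4: "integrable M (\<lambda>x. f x * (1 - cutoff r x))"
      using Bochner_Integration.integrable_diff[OF i(1) i3] by (simp add: right_diff_distrib)
    have "\<bar>(\<integral>x. f x \<partial>M) - (\<integral>x. f x * cutoff r x \<partial>M)\<bar> = \<bar>\<integral>x. f x * (1 - cutoff r x) \<partial>M\<bar>"
      using i i3 by (simp add: right_diff_distrib)
    also have "\<dots> \<le> (\<integral>x. \<bar>f x * (1 - cutoff r x)\<bar> \<partial>M)" by (rule integral_abs_bound)
    also have "\<dots> \<le> (\<integral>x. B * (1 - cutoff r x) \<partial>M)"
    proof (rule integral_mono)
      show "\<bar>f x * (1 - cutoff r x)\<bar> \<le> B * (1 - cutoff r x)" for x
        using B cutoff[of r x] by (simp add: abs_mult mult_right_mono)
    qed (use i i4 in auto)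
    also have "\<dots> = B * (1 - (\<integral>x. cutoff r x \<partial>M))" using i by (simp add: prob_space)
    finally show "\<bar>(\<integral>x. f x \<partial>M) - (\<integral>x. f x * cutoff r x \<partial>M)\<bar> \<le> B * (1 - (\<integral>x. cutoff r x \<partial>M))" .
  qed
  interpret \<nu>: prob_space \<nu> by fact
  have "(\<lambda>r. \<integral>x. cutoff r x \<partial>\<nu>) \<longlonglongrightarrow> (\<integral>x. 1 \<partial>\<nu>)"
  proof (rule integral_dominated_convergence[where w = "\<lambda>_. 1"])
    show "AE x in \<nu>. (\<lambda>r. cutoff r x) \<longlonglongrightarrow> 1"
    proof (intro AE_I2 tendsto_eventually)
      fix x
      show "\<forall>\<^sub>F r in sequentially. cutoff r x = 1"
        using eventually_ge_at_top[of "nat \<lceil>cmod x\<rceil>"] by eventually_elim (auto simp: cutoff_def nat_ceiling_le_eq)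
    qed
  qed (use cutoff \<nu>(2) in \<open>auto cong: measurable_cong_sets\<close>)
  then have lim_cut: "(\<lambda>r. \<integral>x. cutoff r x \<partial>\<nu>) \<longlonglongrightarrow> 1" by (simp add: \<nu>.prob_space)
  show "(\<lambda>n. \<integral>x. f x \<partial>\<mu> n) \<longlonglongrightarrow> (\<integral>x. f x \<partial>\<nu>)"
  proof (rule LIMSEQ_I)
    fix \<epsilon> :: real assume \<epsilon>: "0 < \<epsilon>"
    have "\<forall>\<^sub>F r in sequentially. 1 - \<epsilon> / (8 * B) < (\<integral>x. cutoff r x \<partial>\<nu>)"
      using lim_cut by (rule order_tendstoD) (use \<epsilon> B in auto)
    then obtain r where r: "1 - \<epsilon> / (8 * B) < (\<integral>x. cutoff r x \<partial>\<nu>)" by (auto simp: eventually_sequentially)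
    have r0: "real r + 1 < cmod x \<Longrightarrow> cutoff r x = 0" for x by (simp add: cutoff_def)
    have l1: "(\<lambda>n. \<integral>x. cutoff r x \<partial>\<mu> n) \<longlonglongrightarrow> (\<integral>x. cutoff r x \<partial>\<nu>)"
      by (rule lim[of _ 1 "real r + 1"]) (use cutoff cut_cont r0 in auto)
    have l2: "(\<lambda>n. \<integral>x. f x * cutoff r x \<partial>\<mu> n) \<longlonglongrightarrow> (\<integral>x. f x * cutoff r x \<partial>\<nu>)"
    proof (rule lim[of _ B "real r + 1"])
      show "continuous_on UNIV (\<lambda>x. f x * cutoff r x)" using f cut_cont by (intro continuous_intros) auto
      show "\<bar>f x * cutoff r x\<bar> \<le> B" for x
        using mult_mono[of "\<bar>f x\<bar>" B "cutoff r x" 1] B cutoff by (simp add: abs_mult)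
    qed (simp add: r0)
    have "\<forall>\<^sub>F n in sequentially. 1 - \<epsilon> / (8 * B) < (\<integral>x. cutoff r x \<partial>\<mu> n)"
      using l1 by (rule order_tendstoD) (rule r)
    moreover have "\<forall>\<^sub>F n in sequentially. dist (\<integral>x. f x * cutoff r x \<partial>\<mu> n) (\<integral>x. f x * cutoff r x \<partial>\<nu>) < \<epsilon> / 2"
      using l2 by (rule tendstoD) (use \<epsilon> in simp)
    ultimately have "\<forall>\<^sub>F n in sequentially. norm ((\<integral>x. f x \<partial>\<mu> n) - (\<integral>x. f x \<partial>\<nu>)) < \<epsilon>"
    proof eventually_elim
      fix n assume 1: "1 - \<epsilon> / (8 * B) < (\<integral>x. cutoff r x \<partial>\<mu> n)"
        and 2: "dist (\<integral>x. f x * cutoff r x \<partial>\<mu> n) (\<integral>x. f x * cutoff r x \<partial>\<nu>) < \<epsilon> / 2"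
      have *: "B * (1 - c) \<le> \<epsilon> / 8" if "1 - \<epsilon> / (8 * B) < c" for c
        using that B(1) mult_left_mono[of "1 - c" "\<epsilon> / (8 * B)" B] by simp
      show "norm ((\<integral>x. f x \<partial>\<mu> n) - (\<integral>x. f x \<partial>\<nu>)) < \<epsilon>"
        using cut[OF \<mu>, of n r] cut[OF \<nu>, of r] *[OF 1] *[OF r] 2 \<epsilon> unfolding dist_real_def real_norm_def by linarith
    qed
    then show "\<exists>n0. \<forall>n\<ge>n0. norm ((\<integral>x. f x \<partial>\<mu> n) - (\<integral>x. f x \<partial>\<nu>)) < \<epsilon>"
      by (simp add: eventually_sequentially)
  qed
qed

lemma weak_conv_C_of_edist_reg_log:
  assumes \<mu>: "\<And>n. prob_space (\<mu> n)" "\<And>n. sets (\<mu> n) = sets borel" and \<nu>: "prob_space \<nu>" "sets \<nu> = sets borel"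
    and R: "\<And>n. \<exists>R. AE x in \<mu> n. cmod x \<le> R" "\<exists>R. AE x in \<nu>. cmod x \<le> R"
    and lim: "\<And>\<kappa>. 0 < \<kappa> \<Longrightarrow> \<exists>e. 0 < e \<and> e \<le> 1 \<and> (\<forall>\<^sub>F n in sequentially. edist (reg_log e) (\<mu> n) \<nu> \<le> \<kappa>)"
  shows "weak_conv_C \<mu> \<nu>"
  by (rule weak_conv_C_of_compact_support[OF \<mu> \<nu>])
     (rule tendsto_compact_support[OF \<mu> \<nu> edist_gauss_tendsto_0[OF \<mu> \<nu> R lim]])

lemma integral_le_nn_integral:
  assumes "integrable M f"
  shows "ennreal (integral\<^sup>L M f) \<le> (\<integral>\<^sup>+x. ennreal (f x) \<partial>M)"
proof -
  have "integral\<^sup>L M f \<le> (\<integral>x. max 0 (f x) \<partial>M)" using assms by (intro integral_mono) auto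
  then have "ennreal (integral\<^sup>L M f) \<le> ennreal (\<integral>x. max 0 (f x) \<partial>M)" by (rule ennreal_leI)
  also have "\<dots> = (\<integral>\<^sup>+x. ennreal (max 0 (f x)) \<partial>M)"
    using assms by (intro nn_integral_eq_integral[symmetric]) auto
  also have "\<dots> = (\<integral>\<^sup>+x. ennreal (f x) \<partial>M)"
    by (intro nn_integral_cong) (simp add: max_def ennreal_neg)
  finally show ?thesis .
qed

subsection \<open>The weighted energy and its minimiser\<close>

text \<open>\<open>eintegral\<close> is a difference of two extended integrals. The lower bound on
  \<open>f\<close> keeps the subtracted one at most \<open>C\<close>, and pointwise the positive
  part plus \<open>C\<close> equals \<open>f + C\<close> plus the negative part; integrating this
  identity of nonnegative functions never meets an indeterminate difference.\<close>

lemma eintegral_shift: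
  assumes M: "prob_space M" and [measurable]: "f \<in> borel_measurable M"
    and C: "0 \<le> C" and f: "\<And>x. ereal (- C) \<le> f x"
  shows "eintegral M f = enn2ereal (\<integral>\<^sup>+x. e2ennreal (f x + ereal C) \<partial>M) - ereal C"
proof -
  interpret prob_space M by fact
  define P where "P = (\<integral>\<^sup>+x. e2ennreal (f x) \<partial>M)"
  define Q where "Q = (\<integral>\<^sup>+x. e2ennreal (- f x) \<partial>M)"
  define S where "S = (\<integral>\<^sup>+x. e2ennreal (f x + ereal C) \<partial>M)"
  have pw: "e2ennreal (f x) + ennreal C = e2ennreal (f x + ereal C) + e2ennreal (- f x)" for x
  proof (cases "f x")
    case (real r)
    have "ennreal r + ennreal C = ennreal (r + C) + ennreal (- r)"
    proof (cases "0 \<le> r")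
      case True
      then show ?thesis using C by (simp add: ennreal_neg)
    next
      case False
      then have "ennreal C = ennreal ((r + C) + (- r))" by simp
      also have "\<dots> = ennreal (r + C) + ennreal (- r)"
        using False f[of x] real by (intro ennreal_plus) auto
      finally show ?thesis using False by (simp add: ennreal_neg)
    qed
    then show ?thesis using real by simp
  qed (use f[of x] in \<open>auto simp: e2ennreal_neg\<close>)
  have "P + ennreal C = (\<integral>\<^sup>+x. e2ennreal (f x) + ennreal C \<partial>M)"
    unfolding P_def by (subst nn_integral_add) (auto simp: emeasure_space_1)
  also have "\<dots> = S + Q"
    unfolding pw S_def Q_def by (subst nn_integral_add) auto
  finally have PS: "P + ennreal C = S + Q" .
  have "Q \<le> (\<integral>\<^sup>+x. ennreal C \<partial>M)" unfolding Q_def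
  proof (rule nn_integral_mono)
    fix x show "e2ennreal (- f x) \<le> ennreal C"
      using f[of x] e2ennreal_mono[of "- f x" "ereal C"] by (cases "f x") auto
  qed
  also have "\<dots> = ennreal C" by (simp add: emeasure_space_1)
  finally have "Q < \<infinity>" using le_less_trans ennreal_less_top by (metis infinity_ennreal_def)
  then obtain q where q: "Q = ennreal q" "0 \<le> q" by (cases Q) auto
  have "enn2ereal P - enn2ereal Q = enn2ereal S - ereal C"
  proof (cases "P = top")
    case True
    then have "S = top" using PS q by (cases S) (auto simp flip: ennreal_plus)
    then show ?thesis using True q by simp
  next
    case False
    then obtain p where p: "P = ennreal p" "0 \<le> p" by (cases P) auto
    have "S \<noteq> top" using PS p C by (auto simp: ennreal_plus[symmetric] simp del: ennreal_plus)
    then obtain s where s: "S = ennreal s" "0 \<le> s" by (cases S) auto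
    have "p + C = s + q" using PS p s q C by (simp add: ennreal_plus[symmetric] del: ennreal_plus)
    then show ?thesis using p s q by simp
  qed
  then show ?thesis by (simp add: eintegral_def P_def Q_def S_def)
qed

lemma measurable_log_kernel [measurable]:
  "(\<lambda>(x, y). log_kernel x y) \<in> borel_measurable (borel \<Otimes>\<^sub>M borel)"
  unfolding log_kernel_def by measurable

lemma log_kernel_commute: "log_kernel x y = log_kernel y x"
  by (auto simp: log_kernel_def norm_minus_commute)

definition log1p_sq :: "complex \<Rightarrow> real" where
  "log1p_sq z = ln (1 + (cmod z)\<^sup>2)"

lemma log1p_sq_nonneg: "0 \<le> log1p_sq z"
  by (simp add: log1p_sq_def)

lemma measurable_log1p_sq [measurable]: "log1p_sq \<in> borel_measurable borel"
  unfolding log1p_sq_def by measurable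

text \<open>The square of \<open>|x| + |y|\<close> falls short of the right-hand side by the square
  of \<open>1 - |x| * |y|\<close>. After taking logarithms the variables are separated, so that the
  field at each point can pay for that point's share of the interaction.\<close>

lemma cmod_diff_sq_le: "(cmod (x - y))\<^sup>2 \<le> (1 + (cmod x)\<^sup>2) * (1 + (cmod y)\<^sup>2)"
proof -
  have "(cmod (x - y))\<^sup>2 \<le> (cmod x + cmod y)\<^sup>2"
    by (intro power_mono norm_triangle_ineq4) auto
  also have "\<dots> \<le> (1 + (cmod x)\<^sup>2) * (1 + (cmod y)\<^sup>2)"
    using zero_le_power2[of "1 - cmod x * cmod y"] by (simp add: power2_eq_square algebra_simps)
  finally show ?thesis .
qed

lemma neg_ln_cmod_ge: "x \<noteq> y \<Longrightarrow> - (log1p_sq x + log1p_sq y) / 2 \<le> - ln (cmod (x - y))"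
proof -
  assume ne: "x \<noteq> y"
  have p: "0 < 1 + (cmod x)\<^sup>2" "0 < 1 + (cmod y)\<^sup>2" by (auto simp: add_pos_nonneg)
  have "2 * ln (cmod (x - y)) = ln ((cmod (x - y))\<^sup>2)" using ne by (simp add: ln_realpow)
  also have "\<dots> \<le> ln ((1 + (cmod x)\<^sup>2) * (1 + (cmod y)\<^sup>2))"
    using cmod_diff_sq_le ne p by (subst ln_le_cancel_iff) auto
  also have "\<dots> = log1p_sq x + log1p_sq y" using p by (simp add: log1p_sq_def ln_mult_pos)
  finally show ?thesis by simp
qed

text \<open>The growth condition is made global: the additive constant \<open>C\<close> absorbs the
  bounded region where it may fail. The same \<open>C\<close> serves as the lower bound
  \<open>- C\<close> of \<open>kern\<close>.\<close>

locale external_field =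
  fixes V :: "complex \<Rightarrow> ereal" and \<delta> C :: real
  assumes V_nonneg: "\<And>z. V z \<ge> 0"
    and V_cont: "continuous_on UNIV V"
    and \<delta>_pos: "0 < \<delta>" and C_nonneg: "0 \<le> C"
    and V_growth: "\<And>z. ereal ((1 + \<delta>) * log1p_sq z - C) \<le> V z"
begin

lemma measurable_V [measurable]: "V \<in> borel_measurable borel"
  using V_cont by (rule borel_measurable_continuous_onI)

lemma V_cases: obtains (infinite) "V x = \<infinity>" | (real) a where "V x = ereal a" "0 \<le> a" "(1 + \<delta>) * log1p_sq x - C \<le> a"
  using V_nonneg[of x] V_growth[of x] by (cases "V x") auto

lemma kern_real: "x \<noteq> y \<Longrightarrow> V x = ereal a \<Longrightarrow> V y = ereal b \<Longrightarrow> kern V x y = ereal (- ln (cmod (x - y)) + (a + b) / 2)"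
  by (simp add: kern_def log_kernel_def)

lemma kern_infinite: "x = y \<or> V x = \<infinity> \<or> V y = \<infinity> \<Longrightarrow> kern V x y = \<infinity>"
  using V_nonneg[of x] V_nonneg[of y] by (cases "V x"; cases "V y") (auto simp: kern_def log_kernel_def)

lemma kern_commute: "kern V x y = kern V y x"
  by (simp add: kern_def log_kernel_commute add.commute)

lemma measurable_kern [measurable]: "(\<lambda>(x, y). kern V x y) \<in> borel_measurable (borel \<Otimes>\<^sub>M borel)"
  unfolding kern_def by measurable

text \<open>Half of the field at \<open>x\<close> supplies \<open>(1 + \<delta>) / 2\<close> times
  \<open>log1p_sq x\<close>, of which the interaction takes \<open>1 / 2\<close>; what remains is
  \<open>\<delta> / 2\<close>.\<close>

lemma kern_ge: "ereal (\<delta> / 2 * (log1p_sq x + log1p_sq y) - C) \<le> kern V x y"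
proof (cases "x = y \<or> V x = \<infinity> \<or> V y = \<infinity>")
  case False
  then obtain a b where ab: "V x = ereal a" "V y = ereal b"
    "(1 + \<delta>) * log1p_sq x - C \<le> a" "(1 + \<delta>) * log1p_sq y - C \<le> b"
    by (metis V_cases)
  have "\<delta> / 2 * (log1p_sq x + log1p_sq y) - C = - (log1p_sq x + log1p_sq y) / 2 + (((1 + \<delta>) * log1p_sq x - C) + ((1 + \<delta>) * log1p_sq y - C)) / 2"
    by (simp add: field_simps)
  also have "\<dots> \<le> - ln (cmod (x - y)) + (a + b) / 2"
  proof -
    have "- (log1p_sq x + log1p_sq y) / 2 \<le> - ln (cmod (x - y))" using neg_ln_cmod_ge False by blast
    then show ?thesis using ab(3,4) by (intro add_mono divide_right_mono) auto
  qed
  finally show ?thesis using False ab by (simp add: kern_real)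
qed (simp add: kern_infinite)

text \<open>Coercivity measured by \<open>V\<close> itself: \<open>V\<close> may be large or
  infinite at bounded points, where \<open>kern_ge\<close> says nothing. Since
  \<open>log1p_sq x\<close> is at most \<open>(V x + C) / (1 + \<delta>)\<close>, the fraction
  \<open>\<delta> / (1 + \<delta>)\<close> of the field survives the interaction.\<close>

lemma kern_ge_V:
  assumes "ereal a \<le> V x"
  shows "ereal (\<delta> / (2 * (1 + \<delta>)) * a - C) \<le> kern V x y"
proof (cases "x = y \<or> V x = \<infinity> \<or> V y = \<infinity>")
  case False
  then obtain a' b where ab: "V x = ereal a'" "V y = ereal b"
    "(1 + \<delta>) * log1p_sq x - C \<le> a'" "(1 + \<delta>) * log1p_sq y - C \<le> b"
    by (metis V_cases)
  have aa: "a \<le> a'" using assms ab by simp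
  have l: "log1p_sq x \<le> (a' + C) / (1 + \<delta>)" using ab(3) \<delta>_pos by (simp add: field_simps)
  have "1 - \<delta> / (1 + \<delta>) = 1 / (1 + \<delta>)" using \<delta>_pos by (simp add: field_simps)
  then have "a' - \<delta> / (1 + \<delta>) * a' = a' / (1 + \<delta>)"
    by (metis left_diff_distrib mult_1 mult.commute times_divide_eq_right mult.right_neutral)
  then have "(a' + C) / (1 + \<delta>) = a' - \<delta> / (1 + \<delta>) * a' + C / (1 + \<delta>)" by (simp add: add_divide_distrib)
  moreover have "C / (1 + \<delta>) \<le> C" using \<delta>_pos C_nonneg by (simp add: field_simps)
  ultimately have 1: "\<delta> / (1 + \<delta>) * a' - C \<le> a' - log1p_sq x" using l by linarith
  have "0 \<le> \<delta> * log1p_sq y" using \<delta>_pos log1p_sq_nonneg by simp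
  then have 2: "- C \<le> b - log1p_sq y" using ab(4) by (simp add: algebra_simps)
  have 3: "\<delta> / (1 + \<delta>) * a \<le> \<delta> / (1 + \<delta>) * a'" using aa \<delta>_pos by (intro mult_left_mono) auto
  have "\<delta> / (2 * (1 + \<delta>)) * a - C \<le> - (log1p_sq x + log1p_sq y) / 2 + (a' + b) / 2"
  proof -
    have "\<delta> / (2 * (1 + \<delta>)) * a = \<delta> / (1 + \<delta>) * a / 2" by simp
    moreover have "p - C \<le> - (lx + ly) / 2 + (a1 + b1) / 2"
      if "p = q / 2" "r - C \<le> a1 - lx" "- C \<le> b1 - ly" "q \<le> r" for p q r lx ly a1 b1
      using that by (simp add: field_simps)
    ultimately show ?thesis using 1 2 3 by blast
  qed
  also have "\<dots> \<le> - ln (cmod (x - y)) + (a' + b) / 2" using neg_ln_cmod_ge[of x y] False by simp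
  finally show ?thesis using False ab by (simp add: kern_real)
qed (simp add: kern_infinite)

lemma kern_ge_minus_C: "ereal (- C) \<le> kern V x y"
proof -
  have "ereal (- C) \<le> ereal (\<delta> / 2 * (log1p_sq x + log1p_sq y) - C)"
    using \<delta>_pos log1p_sq_nonneg by simp
  then show ?thesis using kern_ge by (rule order_trans)
qed

text \<open>The kernel, shifted by the constant \<open>C\<close> of the growth condition to become nonnegative; minimisers of
  the energy and of the shifted energy coincide.\<close>

definition K :: "complex \<Rightarrow> complex \<Rightarrow> ennreal" where
  "K x y = e2ennreal (kern V x y + ereal C)"

definition J :: "complex measure \<Rightarrow> complex measure \<Rightarrow> ennreal" where
  "J \<mu> \<nu> = (\<integral>\<^sup>+x. \<integral>\<^sup>+y. K x y \<partial>\<nu> \<partial>\<mu>)"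

lemma K_commute: "K x y = K y x"
  by (simp add: K_def kern_commute)

lemma measurable_K [measurable]: "(\<lambda>(x, y). K x y) \<in> borel_measurable (borel \<Otimes>\<^sub>M borel)"
  unfolding K_def by measurable

lemma K_ge: "ereal r \<le> kern V x y \<Longrightarrow> ennreal (r + C) \<le> K x y"
  using e2ennreal_mono[of "ereal (r + C)" "kern V x y + ereal C"]
  by (simp add: K_def) (metis add_right_mono plus_ereal.simps(1))

lemma K_real: "x \<noteq> y \<Longrightarrow> V x = ereal a \<Longrightarrow> V y = ereal b \<Longrightarrow> K x y = ennreal (- ln (cmod (x - y)) + (a + b) / 2 + C)"
  by (simp add: K_def kern_real)

lemma K_infinite: "x = y \<or> V x = \<infinity> \<or> V y = \<infinity> \<Longrightarrow> K x y = \<infinity>"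
  by (simp add: K_def kern_infinite)

lemma prob_on_C_D: "prob_on_C \<mu> \<Longrightarrow> prob_space \<mu>" "prob_on_C \<mu> \<Longrightarrow> sets \<mu> = sets borel"
  by (auto simp: prob_on_C_def)

lemma J_commute:
  assumes "prob_on_C \<mu>" "prob_on_C \<nu>"
  shows "J \<mu> \<nu> = J \<nu> \<mu>"
proof -
  note [measurable_cong] = prob_on_C_D(2)[OF assms(1)] prob_on_C_D(2)[OF assms(2)]
  interpret \<mu>: prob_space \<mu> using assms prob_on_C_D by blast
  interpret \<nu>: prob_space \<nu> using assms prob_on_C_D by blast
  interpret P: pair_sigma_finite \<mu> \<nu> ..
  have "J \<mu> \<nu> = (\<integral>\<^sup>+y. \<integral>\<^sup>+x. K x y \<partial>\<mu> \<partial>\<nu>)"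
    unfolding J_def by (rule P.Fubini'[symmetric]) measurable
  then show ?thesis by (simp add: J_def K_commute)
qed

lemma energy_eq:
  assumes "prob_on_C \<mu>"
  shows "energy V \<mu> = enn2ereal (J \<mu> \<mu>) - ereal C"
proof -
  note [measurable_cong] = prob_on_C_D(2)[OF assms]
  interpret \<mu>: prob_space \<mu> using assms prob_on_C_D by blast
  interpret P: pair_prob_space \<mu> \<mu> ..
  have "energy V \<mu> = enn2ereal (\<integral>\<^sup>+p. e2ennreal ((case p of (x, y) \<Rightarrow> kern V x y) + ereal C) \<partial>(\<mu> \<Otimes>\<^sub>M \<mu>)) - ereal C"
    unfolding energy_def
    by (rule eintegral_shift) (auto simp: P.prob_space_axioms C_nonneg kern_ge_minus_C)
  also have "(\<integral>\<^sup>+p. e2ennreal ((case p of (x, y) \<Rightarrow> kern V x y) + ereal C) \<partial>(\<mu> \<Otimes>\<^sub>M \<mu>)) = J \<mu> \<mu>"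
    unfolding J_def K_def by (subst \<mu>.nn_integral_fst[symmetric]) auto
  finally show ?thesis .
qed

lemma energy_le_imp_J_le:
  assumes "prob_on_C \<mu>" "prob_on_C \<nu>" "energy V \<mu> \<le> energy V \<nu>"
  shows "J \<mu> \<mu> \<le> J \<nu> \<nu>"
proof -
  have "enn2ereal (J \<mu> \<mu>) - ereal C \<le> enn2ereal (J \<nu> \<nu>) - ereal C"
    using assms by (simp add: energy_eq)
  then show ?thesis by (cases "J \<mu> \<mu>"; cases "J \<nu> \<nu>") (auto simp: ennreal_leI)
qed

end

text \<open>The convex combination is realised as a Bernoulli choice between the two measures, so
  the integral formula is that of the monadic bind.\<close>

lemma mixture_exists:
  assumes "prob_on_C \<mu>" "prob_on_C \<nu>" "0 \<le> s" "s \<le> 1"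
  obtains \<pi> where "prob_on_C \<pi>"
    "\<And>f. f \<in> borel_measurable borel \<Longrightarrow> (\<integral>\<^sup>+x. f x \<partial>\<pi>) = ennreal (1 - s) * (\<integral>\<^sup>+x. f x \<partial>\<mu>) + ennreal s * (\<integral>\<^sup>+x. f x \<partial>\<nu>)"
proof
  define N where "N b = (if b then \<nu> else \<mu>)" for b
  have N: "N \<in> measure_pmf (bernoulli_pmf s) \<rightarrow>\<^sub>M subprob_algebra borel"
    "N \<in> measure_pmf (bernoulli_pmf s) \<rightarrow>\<^sub>M prob_algebra borel"
    using assms by (auto simp: N_def space_subprob_algebra space_prob_algebra prob_on_C_def prob_space_imp_subprob_space)
  let ?\<pi> = "measure_pmf (bernoulli_pmf s) \<bind> N"
  have "prob_space ?\<pi>"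
    by (rule prob_space_bind'[OF _ N(2)]) (simp add: space_prob_algebra measure_pmf.prob_space_axioms)
  moreover have "sets ?\<pi> = sets borel"
    by (rule sets_bind[OF sets_kernel[OF N(1)]]) auto
  ultimately show "prob_on_C ?\<pi>" by (simp add: prob_on_C_def)
  fix f :: "complex \<Rightarrow> ennreal" assume "f \<in> borel_measurable borel"
  then have "(\<integral>\<^sup>+x. f x \<partial>?\<pi>) = (\<integral>\<^sup>+b. \<integral>\<^sup>+x. f x \<partial>N b \<partial>bernoulli_pmf s)"
    by (rule nn_integral_bind[OF _ N(1)])
  also have "\<dots> = ennreal (1 - s) * (\<integral>\<^sup>+x. f x \<partial>\<mu>) + ennreal s * (\<integral>\<^sup>+x. f x \<partial>\<nu>)"
    using assms by (simp add: N_def add.commute mult.commute)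
  finally show "(\<integral>\<^sup>+x. f x \<partial>?\<pi>) = ennreal (1 - s) * (\<integral>\<^sup>+x. f x \<partial>\<mu>) + ennreal s * (\<integral>\<^sup>+x. f x \<partial>\<nu>)" .
qed

section \<open>The minimiser and its variations\<close>

locale equilibrium = external_field +
  fixes \<mu>V :: "complex measure"
  assumes prob_\<mu>V: "prob_on_C \<mu>V"
    and minimal: "\<And>\<nu>. prob_on_C \<nu> \<Longrightarrow> J \<mu>V \<mu>V \<le> J \<nu> \<nu>"
    and finite_energy: "J \<mu>V \<mu>V < \<infinity>"
begin

lemma prob_space_\<mu>V: "prob_space \<mu>V" and sets_\<mu>V [measurable_cong, simp]: "sets \<mu>V = sets borel"
  using prob_\<mu>V by (auto simp: prob_on_C_def)

sublocale \<mu>V: prob_space \<mu>V by (rule prob_space_\<mu>V)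

text \<open>The energy of the mixture of \<open>\<mu>V\<close> and \<nu> with weight
  \<open>s\<close> on \<nu> is a quadratic polynomial in \<open>s\<close> that is at least its value
  at \<open>s = 0\<close>. Dividing the difference by \<open>s\<close> and letting \<open>s\<close>
  tend to 0 leaves the mixed term; finite energy of \<nu> makes the quadratic coefficient
  finite.\<close>

lemma variational_inequality:
  assumes \<nu>: "prob_on_C \<nu>" and fin: "J \<nu> \<nu> < \<infinity>"
  shows "J \<mu>V \<mu>V \<le> J \<mu>V \<nu>"
proof (cases "J \<mu>V \<nu> = \<infinity>")
  case False
  note [measurable_cong] = prob_on_C_D(2)[OF \<nu>]
  interpret \<nu>: prob_space \<nu> using \<nu> prob_on_C_D by blast
  obtain a where a: "J \<mu>V \<mu>V = ennreal a" "0 \<le> a" using finite_energy by (cases "J \<mu>V \<mu>V") auto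
  obtain b where b: "J \<nu> \<nu> = ennreal b" "0 \<le> b" using fin by (cases "J \<nu> \<nu>") auto
  obtain j where j: "J \<mu>V \<nu> = ennreal j" "0 \<le> j" using False by (cases "J \<mu>V \<nu>") auto
  have quad: "a \<le> (1 - s) * ((1 - s) * a + s * j) + s * ((1 - s) * j + s * b)" if s: "0 < s" "s < 1" for s
  proof -
    obtain \<pi> where \<pi>: "prob_on_C \<pi>"
      and I: "\<And>f. f \<in> borel_measurable borel \<Longrightarrow> (\<integral>\<^sup>+x. f x \<partial>\<pi>) = ennreal (1 - s) * (\<integral>\<^sup>+x. f x \<partial>\<mu>V) + ennreal s * (\<integral>\<^sup>+x. f x \<partial>\<nu>)"
      using mixture_exists[OF prob_\<mu>V \<nu>, of s] s by (metis less_imp_le)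
    have m: "(\<lambda>x. \<integral>\<^sup>+y. K x y \<partial>\<mu>V) \<in> borel_measurable borel" "(\<lambda>x. \<integral>\<^sup>+y. K x y \<partial>\<nu>) \<in> borel_measurable borel"
      by measurable
    have "J \<pi> \<pi> = (\<integral>\<^sup>+x. ennreal (1 - s) * (\<integral>\<^sup>+y. K x y \<partial>\<mu>V) + ennreal s * (\<integral>\<^sup>+y. K x y \<partial>\<nu>) \<partial>\<pi>)"
      unfolding J_def by (intro nn_integral_cong I) measurable
    also have "\<dots> = ennreal (1 - s) * (ennreal (1 - s) * J \<mu>V \<mu>V + ennreal s * J \<mu>V \<nu>)
        + ennreal s * (ennreal (1 - s) * J \<nu> \<mu>V + ennreal s * J \<nu> \<nu>)"
      by (subst I) (use m in \<open>auto simp: nn_integral_add nn_integral_cmult J_def cong: measurable_cong_sets\<close>)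
    also have "\<dots> = ennreal ((1 - s) * ((1 - s) * a + s * j) + s * ((1 - s) * j + s * b))"
      unfolding J_commute[OF \<nu> prob_\<mu>V] a b j using s a(2) b(2) j(2)
      by (simp add: ennreal_mult ennreal_plus)
    finally have "ennreal a \<le> ennreal ((1 - s) * ((1 - s) * a + s * j) + s * ((1 - s) * j + s * b))"
      using minimal[OF \<pi>] a by simp
    then show ?thesis using s a(2) b(2) j(2) by (subst (asm) ennreal_le_iff) auto
  qed
  have "(2 - s) * a \<le> 2 * (1 - s) * j + s * b" if s: "0 < s" "s < 1" for s
  proof -
    have "s * ((2 - s) * a) \<le> s * (2 * (1 - s) * j + s * b)" using quad[OF s] by (simp add: algebra_simps)
    then show ?thesis using s by simp
  qed
  then have ev: "\<forall>\<^sub>F s in at_right 0. (2 - s) * a \<le> 2 * (1 - s) * j + s * b"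
    using eventually_at_right_real[OF zero_less_one] by (rule eventually_mono[rotated]) auto
  have "2 * a \<le> 2 * j"
  proof (rule tendsto_le[OF _ _ _ ev])
    show "((\<lambda>s. 2 * (1 - s) * j + s * b) \<longlongrightarrow> 2 * j) (at_right 0)"
      by (rule tendsto_eq_intros refl | simp)+
    show "((\<lambda>s. (2 - s) * a) \<longlongrightarrow> 2 * a) (at_right 0)"
      by (rule tendsto_eq_intros refl | simp)+
  qed simp
  then show ?thesis using a j by (simp add: ennreal_leI)
qed simp

end

section \<open>Sublevel sets of the field and small circles\<close>

context external_field
begin

lemma V_le_imp_cmod_le:
  assumes "V z \<le> ereal \<Lambda>"
  shows "cmod z \<le> exp ((\<Lambda> + C) / 2)"
proof -
  have "ereal ((1 + \<delta>) * log1p_sq z - C) \<le> ereal \<Lambda>" using V_growth assms by (rule order_trans)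
  moreover have "0 \<le> \<delta> * log1p_sq z" using \<delta>_pos log1p_sq_nonneg by simp
  ultimately have "log1p_sq z \<le> \<Lambda> + C" by (simp add: algebra_simps)
  then have "exp (log1p_sq z) \<le> exp (\<Lambda> + C)" by simp
  moreover have "0 < 1 + (cmod z)\<^sup>2" by (simp add: add_pos_nonneg)
  ultimately have "(cmod z)\<^sup>2 \<le> exp (\<Lambda> + C)" by (simp add: log1p_sq_def)
  also have "exp (\<Lambda> + C) = (exp ((\<Lambda> + C) / 2))\<^sup>2" by (simp add: power2_eq_square flip: exp_add)
  finally show ?thesis by (rule power2_le_imp_le) simp
qed

text \<open>Cutting \<open>V\<close> off at \<open>\<Lambda> + \<eta>\<close> gives a finite
  continuous function, uniformly continuous on a ball that contains the bounded sublevel set and its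
  neighbourhood of radius 1. Near the sublevel set its values stay below the cutoff, so they are
  those of \<open>V\<close>; in particular \<open>V\<close> is finite there.\<close>

lemma V_uniform_upper:
  assumes "0 < \<eta>"
  obtains r where "0 < r" "r \<le> 1" "\<And>x y. V x \<le> ereal \<Lambda> \<Longrightarrow> cmod (y - x) \<le> r \<Longrightarrow> V y \<le> V x + ereal \<eta>"
proof -
  define R where "R = exp ((\<Lambda> + C) / 2)"
  define w where "w x = real_of_ereal (min (V x) (ereal (\<Lambda> + \<eta>)))" for x
  have fin: "\<bar>min (V x) (ereal (\<Lambda> + \<eta>))\<bar> \<noteq> \<infinity>" for x
    using V_nonneg[of x] by (cases "V x") (auto simp: min_def)
  have wV: "ereal (w x) = min (V x) (ereal (\<Lambda> + \<eta>))" for x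
    unfolding w_def using fin by (simp add: ereal_real)
  have "continuous_on UNIV (\<lambda>x. min (V x) (ereal (\<Lambda> + \<eta>)))"
    by (intro continuous_intros V_cont)
  then have "continuous_on UNIV (real_of_ereal \<circ> (\<lambda>x. min (V x) (ereal (\<Lambda> + \<eta>))))"
    by (subst (asm) continuous_on_iff_real) (use fin in auto)
  then have "continuous_on UNIV w" by (simp add: w_def[abs_def] comp_def)
  then have "uniformly_continuous_on (cball 0 (R + 1)) w"
    by (intro compact_uniformly_continuous) (auto intro: continuous_on_subset)
  then obtain d where d: "0 < d" "\<And>x y. x \<in> cball 0 (R + 1) \<Longrightarrow> y \<in> cball 0 (R + 1) \<Longrightarrow> dist y x < d \<Longrightarrow> dist (w y) (w x) < \<eta>"
    using assms unfolding uniformly_continuous_on_def by metis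
  show ?thesis
  proof (rule that[of "min (d / 2) 1"])
    fix x y assume x: "V x \<le> ereal \<Lambda>" and y: "cmod (y - x) \<le> min (d / 2) 1"
    have "cmod x \<le> R" using V_le_imp_cmod_le[OF x] by (simp add: R_def)
    moreover have "cmod y \<le> cmod x + 1" using norm_triangle_ineq2[of y x] y by simp
    ultimately have "dist (w y) (w x) < \<eta>" using y d(1) by (intro d(2)) (auto simp: dist_norm)
    then have wy: "w y < w x + \<eta>" by (simp add: dist_real_def)
    have wx: "ereal (w x) = V x" using x assms unfolding wV by (simp add: min_def) (metis order_trans ereal_less_eq(3) le_add_same_cancel1 less_imp_le)
    then have "w x \<le> \<Lambda>" using x by (metis ereal_less_eq(3))
    then have "ereal (w y) < ereal (\<Lambda> + \<eta>)" using wy by simp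
    then have "ereal (w y) = V y" unfolding wV by (auto simp: min_def split: if_splits)
    then show "V y \<le> V x + ereal \<eta>" using wx wy by (metis ereal_less_eq(3) less_imp_le plus_ereal.simps(1))
  qed (use d in auto)
qed

text \<open>The field on the circle is at most \<open>a\<close>, and the logarithmic mean is
  controlled by \<open>integral_ln_circle_measure\<close>. The second conclusion records that the
  bound is nonnegative, so that \<open>ennreal\<close> does not clip it when it is integrated over
  \<open>y\<close>.\<close>

lemma nn_integral_K_circle_le:
  assumes r: "0 < r" and y: "V y = ereal b" and a: "\<And>z. cmod (z - x) = r \<Longrightarrow> V z \<le> ereal a"
  shows "(\<integral>\<^sup>+z. K y z \<partial>circle_measure x r) \<le> ennreal (- ln (max (cmod (x - y)) r) + (b + a) / 2 + C)" (is ?A)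
    and "0 \<le> - ln (max (cmod (x - y)) r) + (b + a) / 2 + C" (is ?B)
proof -
  interpret c: prob_space "circle_measure x r" by (rule prob_space_circle_measure)
  define g where "g z = - ln (cmod (z - y)) + (b + a) / 2 + C" for z
  have ae: "AE z in circle_measure x r. z \<noteq> y \<and> V z \<le> ereal a"
    using AE_circle_measure_neq[OF r, where x = x and y = y] AE_circle_measure[of x r "\<lambda>z. V z \<le> ereal a"] a r by auto
  have ae2: "AE z in circle_measure x r. K y z \<le> ennreal (g z) \<and> 0 \<le> g z"
    using ae
  proof eventually_elim
    fix z assume z: "z \<noteq> y \<and> V z \<le> ereal a"
    then obtain b' where b': "V z = ereal b'" "b' \<le> a" using V_nonneg[of z] by (cases "V z") auto
    have k: "kern V y z = ereal (- ln (cmod (y - z)) + (b + b') / 2)"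
      using z b' y by (intro kern_real) auto
    have le: "- ln (cmod (y - z)) + (b + b') / 2 + C \<le> g z" using b' by (simp add: g_def norm_minus_commute)
    have "- C \<le> - ln (cmod (y - z)) + (b + b') / 2" using kern_ge_minus_C[of y z] unfolding k by simp
    then have "0 \<le> g z" using le by linarith
    then show "K y z \<le> ennreal (g z) \<and> 0 \<le> g z"
      using le z b' y by (subst K_real) (auto intro: ennreal_leI)
  qed
  have int: "integrable (circle_measure x r) g"
    unfolding g_def using integrable_ln_circle_measure[OF r, of x y] by auto
  have "(\<integral>\<^sup>+z. K y z \<partial>circle_measure x r) \<le> (\<integral>\<^sup>+z. ennreal (g z) \<partial>circle_measure x r)"
    using ae2 by (intro nn_integral_mono_AE) auto
  also have "\<dots> = ennreal (\<integral>z. g z \<partial>circle_measure x r)"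
    using ae2 int by (intro nn_integral_eq_integral) auto
  finally have 1: "(\<integral>\<^sup>+z. K y z \<partial>circle_measure x r) \<le> ennreal (\<integral>z. g z \<partial>circle_measure x r)" .
  have "(\<integral>z. g z \<partial>circle_measure x r) = - (\<integral>z. ln (cmod (z - y)) \<partial>circle_measure x r) + (b + a) / 2 + C"
    unfolding g_def using integrable_ln_circle_measure[OF r, of x y] by (simp add: c.prob_space)
  also have "\<dots> \<le> - ln (max (cmod (x - y)) r) + (b + a) / 2 + C"
    using integral_ln_circle_measure[OF r, of x y] by simp
  finally have 2: "(\<integral>z. g z \<partial>circle_measure x r) \<le> - ln (max (cmod (x - y)) r) + (b + a) / 2 + C" .
  have "0 \<le> (\<integral>z. g z \<partial>circle_measure x r)" using ae2 by (intro integral_nonneg_AE) auto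
  with 2 show ?B by linarith
  show ?A using 1 2 by (meson ennreal_leI order_trans)
qed

text \<open>Makes circles admissible in \<open>variational_inequality\<close>. For \<open>y\<close>
  on the circle itself the maximum in the preceding bound is \<open>r\<close>.\<close>

lemma J_circle_finite:
  assumes r: "0 < r" and a: "\<And>z. cmod (z - x) = r \<Longrightarrow> V z \<le> ereal a"
  shows "J (circle_measure x r) (circle_measure x r) < \<infinity>"
proof -
  interpret c: prob_space "circle_measure x r" by (rule prob_space_circle_measure)
  have "AE y in circle_measure x r. (\<integral>\<^sup>+z. K y z \<partial>circle_measure x r) \<le> ennreal (- ln r + a + C)"
  proof (rule AE_circle_measure)
    fix y assume y: "cmod (y - x) = r"
    then obtain b where b: "V y = ereal b" "b \<le> a" using a[OF y] V_nonneg[of y] by (cases "V y") auto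
    have "(\<integral>\<^sup>+z. K y z \<partial>circle_measure x r) \<le> ennreal (- ln (max (cmod (x - y)) r) + (b + a) / 2 + C)"
      by (rule nn_integral_K_circle_le[OF r b(1) a])
    also have "\<dots> \<le> ennreal (- ln r + a + C)"
      using b(2) y by (intro ennreal_leI) (simp add: norm_minus_commute)
    finally show "(\<integral>\<^sup>+z. K y z \<partial>circle_measure x r) \<le> ennreal (- ln r + a + C)" .
  qed (use r in auto)
  then have "J (circle_measure x r) (circle_measure x r) \<le> (\<integral>\<^sup>+y. ennreal (- ln r + a + C) \<partial>circle_measure x r)"
    unfolding J_def by (intro nn_integral_mono_AE)
  also have "\<dots> < \<infinity>" by (simp add: c.emeasure_space_1)
  finally show ?thesis .
qed

lemma reg_log_ge:
  assumes "0 < e" "e \<le> 1"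
  shows "- (log1p_sq x + log1p_sq y) / 2 - ln 2 / 2 \<le> reg_log e x y"
proof -
  let ?a = "1 + (cmod x)\<^sup>2" and ?b = "1 + (cmod y)\<^sup>2"
  have p: "1 \<le> ?a" "1 \<le> ?b" by auto
  then have ab: "1 \<le> ?a * ?b" using mult_mono[of 1 ?a 1 ?b] by simp
  have "(cmod (x - y))\<^sup>2 + e \<le> ?a * ?b + 1" using cmod_diff_sq_le[of x y] assms by linarith
  also have "\<dots> \<le> 2 * (?a * ?b)" using ab by linarith
  finally have "ln ((cmod (x - y))\<^sup>2 + e) \<le> ln (2 * (?a * ?b))"
    using assms ab by (subst ln_le_cancel_iff) (auto simp: add_nonneg_pos)
  also have "\<dots> = ln 2 + ln (?a * ?b)" using ab by (intro ln_mult_pos) linarith+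
  also have "ln (?a * ?b) = ln ?a + ln ?b" by (intro ln_mult_pos add_pos_nonneg) auto
  finally show ?thesis unfolding reg_log_def log1p_sq_def by (simp add: field_simps)
qed

end

section \<open>Support and regularised potential of the minimiser\<close>

context equilibrium
begin

definition m :: real where "m = enn2real (J \<mu>V \<mu>V) - C"

lemma space_\<mu>V: "space \<mu>V = UNIV"
  using sets_eq_imp_space_eq[OF sets_\<mu>V] by simp

lemma J_\<mu>V: "J \<mu>V \<mu>V = ennreal (m + C)" and m_C_nonneg: "0 \<le> m + C"
  using finite_energy by (auto simp: m_def less_top)

text \<open>Coercivity forces the potential \<open>P\<close> of \<open>\<mu>V\<close> above
  \<open>m + C + 1\<close> outside the sublevel set \<open>A\<close>. Conditioning
  \<open>\<mu>V\<close> on \<open>A\<close> gives a competitor of finite energy, and the variational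
  inequality bounds the mean of \<open>P\<close> over \<open>A\<close> below by
  \<open>m + C\<close>. But the mean of \<open>P\<close> over the whole plane equals
  \<open>m + C\<close>, so the complement of \<open>A\<close> is null.\<close>

lemma AE_V_bounded: "\<exists>\<Lambda>\<ge>0. AE x in \<mu>V. V x \<le> ereal \<Lambda>"
proof -
  \<comment> \<open>The level at which the bound of \<open>kern_ge_V\<close> reaches
    \<open>m + 1\<close>.\<close>
  define \<Lambda> where "\<Lambda> = (m + 1 + C) * (2 * (1 + \<delta>)) / \<delta>"
  have \<Lambda>0: "0 \<le> \<Lambda>" using m_C_nonneg \<delta>_pos by (simp add: \<Lambda>_def)
  have \<Lambda>: "\<delta> / (2 * (1 + \<delta>)) * \<Lambda> - C = m + 1" using \<delta>_pos by (simp add: \<Lambda>_def)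
  define P where "P x = (\<integral>\<^sup>+y. K x y \<partial>\<mu>V)" for x
  have [measurable]: "P \<in> borel_measurable borel" unfolding P_def by measurable
  define A where "A = {x. V x \<le> ereal \<Lambda>}"
  have [measurable]: "A \<in> sets borel" unfolding A_def by measurable
  have PB: "ennreal (m + C) + 1 \<le> P x" if "x \<notin> A" for x
  proof -
    have "ereal (m + 1) \<le> kern V x y" for y
      using kern_ge_V[of \<Lambda> x y] that unfolding \<Lambda> by (simp add: A_def)
    then have "ennreal (m + 1 + C) \<le> K x y" for y by (rule K_ge)
    then have "(\<integral>\<^sup>+y. ennreal (m + 1 + C) \<partial>\<mu>V) \<le> P x" unfolding P_def by (intro nn_integral_mono)
    moreover have "ennreal (m + 1 + C) = ennreal (m + C) + 1"
      using m_C_nonneg ennreal_plus[of "m + C" 1] by (simp add: algebra_simps del: ennreal_plus)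
    ultimately show ?thesis by (simp add: \<mu>V.emeasure_space_1)
  qed
  have PA: "ennreal (m + C) * emeasure \<mu>V A \<le> (\<integral>\<^sup>+x. P x * indicator A x \<partial>\<mu>V)"
  proof (cases "emeasure \<mu>V A = 0")
    case False
    let ?\<nu> = "uniform_measure \<mu>V A"
    have A: "emeasure \<mu>V A \<noteq> 0" "emeasure \<mu>V A \<noteq> \<infinity>" using False by auto
    have \<nu>: "prob_on_C ?\<nu>" using A by (auto simp: prob_on_C_def intro: prob_space_uniform_measure)
    have le: "(\<integral>\<^sup>+x. f x \<partial>?\<nu>) \<le> (\<integral>\<^sup>+x. f x \<partial>\<mu>V) / emeasure \<mu>V A" if "f \<in> borel_measurable borel" for f
      using that by (subst nn_integral_uniform_measure) (auto intro!: divide_right_mono_ennreal nn_integral_mono simp: indicator_def)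
    \<comment> \<open>Conditioning on \<open>A\<close> multiplies integrals by at most the inverse
      of the mass of \<open>A\<close>, hence the energy by at most its square.\<close>
    have "J ?\<nu> ?\<nu> \<le> (\<integral>\<^sup>+x. P x / emeasure \<mu>V A \<partial>?\<nu>)"
      unfolding J_def P_def by (intro nn_integral_mono le) measurable
    also have "\<dots> \<le> (\<integral>\<^sup>+x. P x / emeasure \<mu>V A \<partial>\<mu>V) / emeasure \<mu>V A"
      by (rule le) measurable
    also have "(\<integral>\<^sup>+x. P x / emeasure \<mu>V A \<partial>\<mu>V) = J \<mu>V \<mu>V / emeasure \<mu>V A"
      unfolding J_def P_def by (rule nn_integral_divide) measurable
    also have "J \<mu>V \<mu>V / emeasure \<mu>V A / emeasure \<mu>V A < \<infinity>"
    proof -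
      have "0 < measure \<mu>V A" using A by (simp add: \<mu>V.emeasure_eq_measure zero_less_measure_iff)
      then show ?thesis using m_C_nonneg by (simp add: J_\<mu>V \<mu>V.emeasure_eq_measure divide_ennreal)
    qed
    finally have "J \<mu>V \<mu>V \<le> J \<mu>V ?\<nu>" by (intro variational_inequality \<nu>)
    also have "\<dots> = (\<integral>\<^sup>+x. P x \<partial>?\<nu>)" unfolding J_commute[OF prob_\<mu>V \<nu>] by (simp add: J_def P_def)
    also have "\<dots> = (\<integral>\<^sup>+x. P x * indicator A x \<partial>\<mu>V) / emeasure \<mu>V A"
      by (subst nn_integral_uniform_measure) auto
    finally have "ennreal (m + C) * emeasure \<mu>V A \<le> (\<integral>\<^sup>+x. P x * indicator A x \<partial>\<mu>V) / emeasure \<mu>V A * emeasure \<mu>V A"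
      unfolding J_\<mu>V by (rule mult_right_mono) simp
    also have "\<dots> = (\<integral>\<^sup>+x. P x * indicator A x \<partial>\<mu>V)"
    proof -
      have "emeasure \<mu>V A / emeasure \<mu>V A = 1" using A by (intro ennreal_divide_self) (auto simp flip: less_top)
      then show ?thesis by (simp add: ennreal_divide_times)
    qed
    finally show ?thesis .
  qed simp
  have "ennreal (m + C) * emeasure \<mu>V A + (ennreal (m + C) + 1) * emeasure \<mu>V (- A)
     \<le> (\<integral>\<^sup>+x. P x * indicator A x \<partial>\<mu>V) + (\<integral>\<^sup>+x. P x * indicator (- A) x \<partial>\<mu>V)"
  proof (intro add_mono PA)
    have "(ennreal (m + C) + 1) * emeasure \<mu>V (- A) = (\<integral>\<^sup>+x. (ennreal (m + C) + 1) * indicator (- A) x \<partial>\<mu>V)"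
      by (subst nn_integral_cmult_indicator) auto
    also have "\<dots> \<le> (\<integral>\<^sup>+x. P x * indicator (- A) x \<partial>\<mu>V)"
      using PB by (intro nn_integral_mono) (auto simp: indicator_def)
    finally show "(ennreal (m + C) + 1) * emeasure \<mu>V (- A) \<le> (\<integral>\<^sup>+x. P x * indicator (- A) x \<partial>\<mu>V)" .
  qed
  also have "\<dots> = (\<integral>\<^sup>+x. P x \<partial>\<mu>V)"
    by (subst nn_integral_add[symmetric]) (auto intro!: nn_integral_cong simp: indicator_def)
  also have "\<dots> = ennreal (m + C)" using J_\<mu>V by (simp add: J_def P_def)
  finally have "ennreal (m + C) * emeasure \<mu>V A + (ennreal (m + C) + 1) * emeasure \<mu>V (- A) \<le> ennreal (m + C)" .
  moreover have "emeasure \<mu>V A = ennreal (1 - measure \<mu>V (- A))"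
    using \<mu>V.prob_compl[of A] by (simp add: \<mu>V.emeasure_eq_measure Compl_eq_Diff_UNIV space_\<mu>V)
  ultimately have "ennreal ((m + C) * (1 - measure \<mu>V (- A)) + (m + C + 1) * measure \<mu>V (- A)) \<le> ennreal (m + C)"
    using m_C_nonneg by (simp add: \<mu>V.emeasure_eq_measure ennreal_mult ennreal_plus)
  then have "(m + C) * (1 - measure \<mu>V (- A)) + (m + C + 1) * measure \<mu>V (- A) \<le> m + C"
    by (rule ennreal_le_iff[OF m_C_nonneg, THEN iffD1])
  then have "measure \<mu>V (- A) \<le> 0" by (simp add: algebra_simps)
  then have "emeasure \<mu>V (- A) = 0" by (simp add: \<mu>V.emeasure_eq_measure measure_le_0_iff)
  then have "AE x in \<mu>V. x \<in> A" by (intro AE_I[of _ _ "- A"]) auto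
  then show ?thesis using \<Lambda>0 unfolding A_def by auto
qed

text \<open>Infinite values of \<open>V\<close> become 0, so \<open>v\<close> stands for
  \<open>V\<close> only where \<open>V\<close> is finite: almost everywhere for
  \<open>\<mu>V\<close>, and at the points of a configuration of finite energy.\<close>

definition v :: "complex \<Rightarrow> real" where "v x = real_of_ereal (V x)"

definition vbar :: real where "vbar = (\<integral>x. v x \<partial>\<mu>V)"

definition U :: "real \<Rightarrow> complex \<Rightarrow> real" where "U e x = (\<integral>y. reg_log e x y \<partial>\<mu>V)"

lemma measurable_v [measurable]: "v \<in> borel_measurable borel"
  unfolding v_def by measurable

lemma v_nonneg: "0 \<le> v x"
  using V_nonneg by (simp add: v_def real_of_ereal_pos)

lemma AE_V_real_bounded: obtains \<Lambda> R where "0 \<le> \<Lambda>" "AE x in \<mu>V. V x = ereal (v x) \<and> v x \<le> \<Lambda> \<and> cmod x \<le> R"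
proof -
  obtain \<Lambda> where \<Lambda>: "\<Lambda> \<ge> 0" "AE x in \<mu>V. V x \<le> ereal \<Lambda>" using AE_V_bounded by auto
  show ?thesis
  proof (rule that[OF \<Lambda>(1)])
    show "AE x in \<mu>V. V x = ereal (v x) \<and> v x \<le> \<Lambda> \<and> cmod x \<le> exp ((\<Lambda> + C) / 2)"
      using \<Lambda>(2)
    proof eventually_elim
      fix x assume x: "V x \<le> ereal \<Lambda>"
      then show "V x = ereal (v x) \<and> v x \<le> \<Lambda> \<and> cmod x \<le> exp ((\<Lambda> + C) / 2)"
        using V_nonneg[of x] V_le_imp_cmod_le[OF x] by (cases "V x") (auto simp: v_def)
    qed
  qed
qed

lemma integrable_v: "integrable \<mu>V v"
proof -
  obtain \<Lambda> R where *: "AE x in \<mu>V. V x = ereal (v x) \<and> v x \<le> \<Lambda> \<and> cmod x \<le> R" by (rule AE_V_real_bounded)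
  show ?thesis
    by (rule \<mu>V.integrable_const_bound[where B = \<Lambda>]) (use * v_nonneg in auto)
qed

lemma integrable_reg_log:
  assumes "0 < e"
  shows "integrable \<mu>V (reg_log e x)"
proof -
  obtain \<Lambda> R where *: "AE x in \<mu>V. V x = ereal (v x) \<and> v x \<le> \<Lambda> \<and> cmod x \<le> R" by (rule AE_V_real_bounded)
  have "(\<lambda>y. reg_log e x y) \<in> borel_measurable \<mu>V" unfolding reg_log_def by measurable
  then show ?thesis
  proof (rule \<mu>V.integrable_const_bound[rotated])
    show "AE y in \<mu>V. norm (reg_log e x y) \<le> \<bar>ln e\<bar> + \<bar>ln ((cmod x + R)\<^sup>2 + e)\<bar>"
      using *
    proof eventually_elim
      fix y assume "V y = ereal (v y) \<and> v y \<le> \<Lambda> \<and> cmod y \<le> R"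
      then have "cmod (x - y) \<le> cmod x + R" using norm_triangle_ineq4[of x y] by linarith
      then show "norm (reg_log e x y) \<le> \<bar>ln e\<bar> + \<bar>ln ((cmod x + R)\<^sup>2 + e)\<bar>"
        using abs_reg_log_le[OF assms] by simp
    qed
  qed
qed

text \<open>Tests the minimality against the circle of radius \<open>r\<close> around
  \<open>x\<close>. Its potential is at most \<open>reg_log e x y + \<eta> / 6\<close> once
  \<open>e\<close> is small against \<open>r\<^sup>2\<close>, and \<open>V\<close> rises by at most
  \<open>\<eta> / 3\<close> on it. The radius, and with it \<open>e0\<close>, depends on
  \<open>x\<close> only through the bound \<Lambda>.\<close>

lemma potential_ge_near:
  assumes \<eta>: "0 < \<eta>"
  obtains e0 where "0 < e0" "e0 \<le> 1" "\<And>e x a. 0 < e \<Longrightarrow> e \<le> e0 \<Longrightarrow> V x = ereal a \<Longrightarrow> a \<le> \<Lambda> \<Longrightarrow> 2 * m - vbar - \<eta> \<le> 2 * U e x + a"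
proof -
  obtain r where r: "0 < r" "r \<le> 1" and rV: "\<And>x y. V x \<le> ereal \<Lambda> \<Longrightarrow> cmod (y - x) \<le> r \<Longrightarrow> V y \<le> V x + ereal (\<eta> / 3)"
    using V_uniform_upper[of "\<eta> / 3" \<Lambda>] \<eta> by auto
  \<comment> \<open>Chosen such that \<open>M\<^sup>2 + e \<le> M\<^sup>2 * exp (\<eta> / 3)\<close>
    for all \<open>e \<le> e0\<close> and \<open>M \<ge> r\<close>.\<close>
  define e0 where "e0 = min 1 (r\<^sup>2 * (exp (\<eta> / 3) - 1))"
  have e0: "0 < e0" "e0 \<le> 1" using r \<eta> by (auto simp: e0_def)
  show ?thesis
  proof (rule that[OF e0])
    fix e x a assume e: "0 < e" "e \<le> e0" and a: "V x = ereal a" "a \<le> \<Lambda>"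
    have Vz: "V z \<le> ereal (a + \<eta> / 3)" if "cmod (z - x) = r" for z
      using rV[of x z] a that by simp
    define h where "h y = reg_log e x y + \<eta> / 6 + (v y + (a + \<eta> / 3)) / 2 + C" for y
    have maxle: "- ln (max (cmod (x - y)) r) \<le> reg_log e x y + \<eta> / 6" for y
    proof -
      define M where "M = max (cmod (x - y)) r"
      have M: "0 < M" "(cmod (x - y))\<^sup>2 \<le> M\<^sup>2" "r\<^sup>2 \<le> M\<^sup>2" using r unfolding M_def by (auto intro!: power_mono)
      have "e \<le> r\<^sup>2 * (exp (\<eta> / 3) - 1)" using e by (simp add: e0_def)
      also have "\<dots> \<le> M\<^sup>2 * (exp (\<eta> / 3) - 1)" using M \<eta> by (intro mult_right_mono) auto
      finally have "(cmod (x - y))\<^sup>2 + e \<le> M\<^sup>2 * exp (\<eta> / 3)"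
        using M(2) unfolding right_diff_distrib by linarith
      then have "ln ((cmod (x - y))\<^sup>2 + e) \<le> ln (M\<^sup>2 * exp (\<eta> / 3))"
        using e M by (subst ln_le_cancel_iff) (auto simp: add_nonneg_pos)
      also have "\<dots> = 2 * ln M + \<eta> / 3" using M by (simp add: ln_mult_pos ln_realpow)
      finally show ?thesis by (simp add: reg_log_def M_def)
    qed
    have pC: "prob_on_C (circle_measure x r)" by (simp add: prob_on_C_def prob_space_circle_measure)
    obtain \<Lambda>' R where *: "AE y in \<mu>V. V y = ereal (v y) \<and> v y \<le> \<Lambda>' \<and> cmod y \<le> R" by (rule AE_V_real_bounded)
    have hh: "AE y in \<mu>V. (\<integral>\<^sup>+z. K y z \<partial>circle_measure x r) \<le> ennreal (h y) \<and> 0 \<le> h y"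
      using *
    proof eventually_elim
      fix y assume "V y = ereal (v y) \<and> v y \<le> \<Lambda>' \<and> cmod y \<le> R"
      then have y: "V y = ereal (v y)" by simp
      have le: "- ln (max (cmod (x - y)) r) + (v y + (a + \<eta> / 3)) / 2 + C \<le> h y" using maxle[of y] by (simp add: h_def)
      then show "(\<integral>\<^sup>+z. K y z \<partial>circle_measure x r) \<le> ennreal (h y) \<and> 0 \<le> h y"
        using nn_integral_K_circle_le[OF r(1) y Vz, of x] by (meson ennreal_leI order_trans)
    qed
    have ih: "integrable \<mu>V h" unfolding h_def using integrable_v integrable_reg_log[OF e(1), of x] by auto
    have "J \<mu>V \<mu>V \<le> J \<mu>V (circle_measure x r)"
      by (rule variational_inequality[OF pC]) (rule J_circle_finite[OF r(1) Vz])
    also have "\<dots> \<le> (\<integral>\<^sup>+y. ennreal (h y) \<partial>\<mu>V)" unfolding J_def using hh by (intro nn_integral_mono_AE) auto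
    also have "\<dots> = ennreal (\<integral>y. h y \<partial>\<mu>V)" using hh ih by (intro nn_integral_eq_integral) auto
    finally have "ennreal (m + C) \<le> ennreal (\<integral>y. h y \<partial>\<mu>V)" unfolding J_\<mu>V .
    moreover have "0 \<le> (\<integral>y. h y \<partial>\<mu>V)" using hh by (intro integral_nonneg_AE) auto
    ultimately have "m + C \<le> (\<integral>y. h y \<partial>\<mu>V)" by (simp add: ennreal_le_iff)
    also have "\<dots> = U e x + \<eta> / 6 + (vbar + (a + \<eta> / 3)) / 2 + C"
      unfolding h_def U_def vbar_def using integrable_v integrable_reg_log[OF e(1), of x] by (simp add: \<mu>V.prob_space)
    finally show "2 * m - vbar - \<eta> \<le> 2 * U e x + a" using \<eta> by (simp add: field_simps)
  qed
qed

text \<open>Where \<open>V\<close> is large this follows from coercivity alone, which makes \<open>e\<close> independent of \<open>x\<close>.\<close>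

lemma potential_ge:
  assumes \<eta>: "0 < \<eta>"
  obtains e where "0 < e" "e \<le> 1" "\<And>x a. V x = ereal a \<Longrightarrow> 2 * m - vbar - \<eta> \<le> 2 * U e x + a"
proof -
  obtain \<Lambda>' R where *: "AE y in \<mu>V. V y = ereal (v y) \<and> v y \<le> \<Lambda>' \<and> cmod y \<le> R" by (rule AE_V_real_bounded)
  \<comment> \<open>\<open>c\<close> covers the points of the support together with the cost of
    regularising, and \<Lambda> solves \<open>\<delta> / (1 + \<delta>) * \<Lambda> = 2 * m - vbar +
    2 * c + C\<close>: beyond this level the surplus of the field over the logarithm beats all
    constants.\<close>
  define c where "c = ln (1 + R\<^sup>2) / 2 + ln 2 / 2"
  define \<Lambda> where "\<Lambda> = (2 * m - vbar + 2 * c + C) * (1 + \<delta>) / \<delta>"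
  obtain e where e: "0 < e" "e \<le> 1" and near: "\<And>x a. V x = ereal a \<Longrightarrow> a \<le> \<Lambda> \<Longrightarrow> 2 * m - vbar - \<eta> \<le> 2 * U e x + a"
    using potential_ge_near[OF \<eta>, of \<Lambda>] by (metis order_refl)
  show ?thesis
  proof (rule that[OF e])
    fix x a assume a: "V x = ereal a"
    show "2 * m - vbar - \<eta> \<le> 2 * U e x + a"
    proof (cases "a \<le> \<Lambda>")
      case False
      have "- log1p_sq x / 2 - c \<le> U e x"
      proof -
        have "(\<integral>y. - log1p_sq x / 2 - c \<partial>\<mu>V) \<le> (\<integral>y. reg_log e x y \<partial>\<mu>V)"
        proof (rule integral_mono_AE)
          show "AE y in \<mu>V. - log1p_sq x / 2 - c \<le> reg_log e x y"
            using *
          proof eventually_elim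
            fix y assume "V y = ereal (v y) \<and> v y \<le> \<Lambda>' \<and> cmod y \<le> R"
            then have "(cmod y)\<^sup>2 \<le> R\<^sup>2" by (intro power_mono) auto
            then have "log1p_sq y \<le> ln (1 + R\<^sup>2)" unfolding log1p_sq_def by (subst ln_le_cancel_iff) (auto simp: add_pos_nonneg)
            then show "- log1p_sq x / 2 - c \<le> reg_log e x y" using reg_log_ge[OF e, of x y] by (simp add: c_def field_simps)
          qed
        qed (use integrable_reg_log[OF e(1)] in auto)
        then show ?thesis by (simp add: U_def \<mu>V.prob_space)
      qed
      then have 1: "- log1p_sq x - 2 * c \<le> 2 * U e x" by (simp add: field_simps)
      have "(1 + \<delta>) * log1p_sq x - C \<le> a" using V_growth[of x] a by simp
      then have "log1p_sq x \<le> (a + C) / (1 + \<delta>)" using \<delta>_pos by (simp add: field_simps)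
      also have "\<dots> = a - \<delta> / (1 + \<delta>) * a + C / (1 + \<delta>)"
      proof -
        have "1 - \<delta> / (1 + \<delta>) = 1 / (1 + \<delta>)" using \<delta>_pos by (simp add: field_simps)
        then have "a - \<delta> / (1 + \<delta>) * a = a / (1 + \<delta>)"
          by (metis left_diff_distrib mult_1 mult.commute times_divide_eq_right mult.right_neutral)
        then show ?thesis by (simp add: add_divide_distrib)
      qed
      also have "C / (1 + \<delta>) \<le> C" using \<delta>_pos C_nonneg by (simp add: field_simps)
      finally have 2: "log1p_sq x \<le> a - \<delta> / (1 + \<delta>) * a + C" by simp
      have "\<delta> / (1 + \<delta>) * \<Lambda> \<le> \<delta> / (1 + \<delta>) * a" using False \<delta>_pos by (intro mult_left_mono) auto
      moreover have "\<delta> / (1 + \<delta>) * \<Lambda> = 2 * m - vbar + 2 * c + C" using \<delta>_pos by (simp add: \<Lambda>_def)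
      ultimately show ?thesis using 1 2 \<eta> by linarith
    qed (rule near[OF a])
  qed
qed

text \<open>Regularising lowers the kernel, so the bound is inherited from the energy
  \<open>m\<close> of \<open>\<mu>V\<close>; each of the two halves of the field integrates to
  \<open>vbar / 2\<close>.\<close>

lemma reg_energy_le:
  assumes e: "0 < e" "e \<le> 1"
  shows "(\<integral>x. U e x \<partial>\<mu>V) + vbar \<le> m"
proof -
  obtain \<Lambda> R where *: "AE x in \<mu>V. V x = ereal (v x) \<and> v x \<le> \<Lambda> \<and> cmod x \<le> R" by (rule AE_V_real_bounded)
  have S: "AE x in \<mu>V. x \<in> cball 0 R" using * by auto
  have bd: "\<bar>reg_log e x y\<bar> \<le> \<bar>ln e\<bar> + \<bar>ln ((R + R)\<^sup>2 + e)\<bar>" if "x \<in> cball 0 R" "y \<in> cball 0 R" for x y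
    using that norm_triangle_ineq4[of x y] by (intro abs_reg_log_le e) auto
  have iU: "integrable \<mu>V (U e)"
    unfolding U_def using integrable_kernel[OF prob_space_\<mu>V prob_space_\<mu>V sets_\<mu>V sets_\<mu>V measurable_reg_log S S bd] by simp
  define h where "h x y = reg_log e x y + (v x + v y) / 2 + C" for x y
  have Kh: "ennreal (h x y) \<le> K x y" if "V x = ereal (v x)" "V y = ereal (v y)" for x y
  proof (cases "x = y")
    case False
    then have "h x y \<le> - ln (cmod (x - y)) + (v x + v y) / 2 + C"
      using reg_log_le_neg_ln[OF _ e(1)] by (simp add: h_def)
    then show ?thesis using False that by (subst K_real) (auto intro: ennreal_leI)
  qed (simp add: K_infinite)
  have "ennreal (\<integral>x. U e x + v x / 2 + vbar / 2 + C \<partial>\<mu>V) \<le> J \<mu>V \<mu>V"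
  proof -
    have "ennreal (\<integral>x. U e x + v x / 2 + vbar / 2 + C \<partial>\<mu>V) \<le> (\<integral>\<^sup>+x. ennreal (U e x + v x / 2 + vbar / 2 + C) \<partial>\<mu>V)"
      using iU integrable_v by (intro integral_le_nn_integral) auto
    also have "\<dots> \<le> J \<mu>V \<mu>V" unfolding J_def
    proof (rule nn_integral_mono_AE, use * in eventually_elim)
      fix x assume x: "V x = ereal (v x) \<and> v x \<le> \<Lambda> \<and> cmod x \<le> R"
      have "U e x + v x / 2 + vbar / 2 + C = (\<integral>y. h x y \<partial>\<mu>V)"
        unfolding h_def U_def vbar_def using integrable_reg_log[OF e(1), of x] integrable_v
        by (simp add: \<mu>V.prob_space add_divide_distrib)
      then have "ennreal (U e x + v x / 2 + vbar / 2 + C) \<le> (\<integral>\<^sup>+y. ennreal (h x y) \<partial>\<mu>V)"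
        using integrable_reg_log[OF e(1), of x] integrable_v by (simp only:) (rule integral_le_nn_integral, auto simp: h_def)
      also have "\<dots> \<le> (\<integral>\<^sup>+y. K x y \<partial>\<mu>V)"
        by (rule nn_integral_mono_AE, use * in eventually_elim) (use Kh x in auto)
      finally show "ennreal (U e x + v x / 2 + vbar / 2 + C) \<le> (\<integral>\<^sup>+y. K x y \<partial>\<mu>V)" .
    qed
    finally show ?thesis .
  qed
  then have "(\<integral>x. U e x + v x / 2 + vbar / 2 + C \<partial>\<mu>V) \<le> m + C"
    using m_C_nonneg unfolding J_\<mu>V by (simp add: ennreal_le_iff)
  also have "(\<integral>x. U e x + v x / 2 + vbar / 2 + C \<partial>\<mu>V) = (\<integral>x. U e x \<partial>\<mu>V) + vbar / 2 + vbar / 2 + C"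
    using iU integrable_v by (simp add: \<mu>V.prob_space vbar_def)
  finally show ?thesis by simp
qed

end

lemma measurable_cnj [measurable]: "cnj \<in> borel_measurable borel"
  by (intro borel_measurable_continuous_onI continuous_intros)

subsection \<open>Smearing over discs\<close>

text \<open>The logarithmic kernel shifted by \<open>c\<close> and clipped at 0. At distances up to
  \<open>exp c\<close> nothing is clipped, so there superharmonicity and Fatou's lemma apply to a
  nonnegative kernel that is infinite on the diagonal.\<close>

definition pos_log :: "real \<Rightarrow> complex \<Rightarrow> complex \<Rightarrow> ennreal" where
  "pos_log c x y = e2ennreal (log_kernel x y + ereal c)"

lemma measurable_pos_log [measurable]: "(\<lambda>(x, y). pos_log c x y) \<in> borel_measurable (borel \<Otimes>\<^sub>M borel)"
  unfolding pos_log_def by measurable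

lemma measurable_pos_log_compose [measurable]:
  assumes "f \<in> borel_measurable M" "g \<in> borel_measurable M"
  shows "(\<lambda>z. pos_log c (f z) (g z)) \<in> borel_measurable M"
  using measurable_compose[OF measurable_Pair[OF assms] measurable_pos_log] by simp

lemma pos_log_commute: "pos_log c x y = pos_log c y x"
  by (simp add: pos_log_def log_kernel_commute)

lemma pos_log_real: "x \<noteq> y \<Longrightarrow> pos_log c x y = ennreal (c - ln (cmod (x - y)))"
  by (simp add: pos_log_def log_kernel_def)

lemma pos_log_eq [simp]: "pos_log c x x = \<infinity>"
  by (simp add: pos_log_def log_kernel_def)

lemma pos_log_cnj: "pos_log c (cnj x) (cnj y) = pos_log c x y"
  by (cases "x = y") (auto simp: pos_log_real simp flip: complex_cnj_diff)

text \<open>Multiplying by \<open>cis (- Arg a)\<close> preserves absolute values and turns the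
  rotating point into the parametrisation of \<open>circle_measure\<close>; over a circle the
  logarithm has a mean at least its value at the centre. The condition on \<open>c\<close> keeps the
  circle within distance \<open>exp c\<close> of \<open>x\<close>.\<close>

lemma nn_integral_pos_log_rotate_le:
  assumes a: "a \<noteq> 0" and c: "cmod (y - x) + cmod a \<le> exp c"
  shows "(\<integral>\<^sup>+t. pos_log c (y + a * cis (2 * pi * t)) x \<partial>uniform_measure lborel {0..1}) \<le> pos_log c y x"
proof (cases "y = x")
  case False
  define r where "r = cmod a"
  define \<alpha> where "\<alpha> = Arg a"
  have r: "0 < r" using a by (simp add: r_def)
  have aeq: "a = of_real r * cis \<alpha>" using a by (simp add: r_def \<alpha>_def cis_Arg sgn_div_norm scaleR_conv_of_real)
  define w where "w = (y - x) * cis (- \<alpha>)"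
  interpret cm: prob_space "circle_measure w r" by (rule prob_space_circle_measure)
  have cw: "cmod w = cmod (y - x)" by (simp add: w_def norm_mult)
  have eq: "cmod (y + a * cis s - x) = cmod (w + of_real r * cis s)" for s
  proof -
    have "y + a * cis s - x = cis \<alpha> * (w + of_real r * cis s)"
      unfolding w_def aeq by (simp add: algebra_simps cis_mult)
    then show ?thesis by (simp add: norm_mult)
  qed
  have zero: "y + a * cis s = x \<longleftrightarrow> w + of_real r * cis s = 0" for s
    using eq[of s] by (metis norm_eq_zero eq_iff_diff_eq_0)
  have "(\<integral>\<^sup>+t. pos_log c (y + a * cis (2 * pi * t)) x \<partial>uniform_measure lborel {0..1})
    = (\<integral>\<^sup>+t. pos_log c (w + of_real r * cis (2 * pi * t)) 0 \<partial>uniform_measure lborel {0..1})"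
  proof (rule nn_integral_cong)
    fix t show "pos_log c (y + a * cis (2 * pi * t)) x = pos_log c (w + of_real r * cis (2 * pi * t)) 0"
      using eq[of "2 * pi * t"] zero[of "2 * pi * t"] by (simp add: pos_log_def log_kernel_def)
  qed
  also have "\<dots> = (\<integral>\<^sup>+z. pos_log c z 0 \<partial>circle_measure w r)"
    unfolding circle_measure_def by (subst nn_integral_distr) auto
  also have "\<dots> = (\<integral>\<^sup>+z. ennreal (c - ln (cmod (z - 0))) \<partial>circle_measure w r)"
    by (rule nn_integral_cong_AE, use AE_circle_measure_neq[OF r, where x = w and y = 0] in eventually_elim) (simp add: pos_log_real)
  also have "\<dots> = ennreal (\<integral>z. c - ln (cmod (z - 0)) \<partial>circle_measure w r)"
  proof (rule nn_integral_eq_integral)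
    show "integrable (circle_measure w r) (\<lambda>z. c - ln (cmod (z - 0)))"
      using integrable_ln_circle_measure[OF r, of w 0] by simp
    have 1: "AE z in circle_measure w r. cmod (z - w) = r"
      by (rule AE_circle_measure) (use r in auto)
    show "AE z in circle_measure w r. 0 \<le> c - ln (cmod (z - 0))"
      using 1 AE_circle_measure_neq[OF r, where x = w and y = 0]
    proof eventually_elim
      fix z assume z: "cmod (z - w) = r" "z \<noteq> 0"
      have "cmod z \<le> cmod w + r" using norm_triangle_ineq2[of z w] z by simp
      also have "\<dots> \<le> exp c" using c by (simp add: cw r_def)
      finally have "ln (cmod z) \<le> ln (exp c)" using z by (subst ln_le_cancel_iff) auto
      then show "0 \<le> c - ln (cmod (z - 0))" by simp
    qed
  qed
  also have "\<dots> \<le> ennreal (c - ln (cmod (y - x)))"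
  proof (rule ennreal_leI)
    have "(\<integral>z. c - ln (cmod (z - 0)) \<partial>circle_measure w r) = c - (\<integral>z. ln (cmod (z - 0)) \<partial>circle_measure w r)"
      using integrable_ln_circle_measure[OF r, of w 0] by (simp add: cm.prob_space)
    also have "\<dots> \<le> c - ln (max (cmod (w - 0)) r)" using integral_ln_circle_measure[OF r, of w 0] by simp
    also have "\<dots> \<le> c - ln (cmod (y - x))" using False r by (simp add: cw)
    finally show "(\<integral>z. c - ln (cmod (z - 0)) \<partial>circle_measure w r) \<le> c - ln (cmod (y - x))" .
  qed
  finally show ?thesis using False by (simp add: pos_log_real)
qed simp

definition unif_disc :: "real \<Rightarrow> complex measure" where
  "unif_disc r = uniform_measure lborel (ball 0 r)"

lemma sets_unif_disc [simp, measurable_cong]: "sets (unif_disc r) = sets borel"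
  by (simp add: unif_disc_def)

lemma emeasure_ball_pos_finite:
  assumes "0 < r"
  shows "emeasure lborel (ball (0::complex) r) \<noteq> 0" "emeasure lborel (ball (0::complex) r) \<noteq> \<infinity>"
proof -
  show "emeasure lborel (ball (0::complex) r) \<noteq> 0"
    using content_ball_pos[OF assms, of "0::complex"] by (auto simp: measure_def)
  show "emeasure lborel (ball (0::complex) r) \<noteq> \<infinity>"
    using emeasure_bounded_finite[of "ball (0::complex) r"] by (simp add: less_top)
qed

lemma prob_space_unif_disc: "0 < r \<Longrightarrow> prob_space (unif_disc r)"
  unfolding unif_disc_def by (rule prob_space_uniform_measure) (use emeasure_ball_pos_finite in auto)

lemma nn_integral_unif_disc:
  assumes "f \<in> borel_measurable borel"
  shows "(\<integral>\<^sup>+a. f a \<partial>unif_disc r) = (\<integral>\<^sup>+a. f a * indicator (ball 0 r) a \<partial>lborel) / emeasure lborel (ball (0::complex) r)"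
  unfolding unif_disc_def using assms by (subst nn_integral_uniform_measure) auto

lemma nn_integral_unif_disc_rotate:
  assumes [measurable]: "f \<in> borel_measurable borel"
  shows "(\<integral>\<^sup>+a. f (a * cis s) \<partial>unif_disc r) = (\<integral>\<^sup>+a. f a \<partial>unif_disc r)"
proof -
  have "(\<integral>\<^sup>+a. f (a * cis s) * indicator (ball 0 r) a \<partial>lborel)
    = (\<integral>\<^sup>+a. f (cis s * a) * indicator (ball 0 r) (cis s * a) \<partial>lborel)"
    by (intro nn_integral_cong) (auto simp: indicator_def norm_mult mult.commute)
  also have "\<dots> = (\<integral>\<^sup>+a. f a * indicator (ball 0 r) a \<partial>lborel)"
    by (rule nn_integral_lborel_rotate[where f = "\<lambda>a. f a * indicator (ball 0 r) a"])
       (intro borel_measurable_times_ennreal assms borel_measurable_indicator, simp_all)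
  finally show ?thesis by (simp add: nn_integral_unif_disc)
qed

lemma AE_unif_disc: "AE a in unif_disc r. a \<noteq> 0 \<and> cmod a < r"
  unfolding unif_disc_def
proof (rule AE_uniform_measureI)
  show "AE a in lborel. a \<in> ball 0 r \<longrightarrow> a \<noteq> 0 \<and> cmod a < r"
    using AE_lborel_singleton[of "0::complex"] by eventually_elim auto
qed auto

text \<open>Rotation invariance of the disc lets an average over angles be inserted; after
  interchanging the integrals each nonzero \<open>a\<close> contributes a circle of radius
  \<open>|a|\<close> around \<open>y\<close>.\<close>

lemma nn_integral_pos_log_disc_le:
  assumes r: "0 < r" and c: "cmod (y - x) + r \<le> exp c"
  shows "(\<integral>\<^sup>+a. pos_log c (y + a) x \<partial>unif_disc r) \<le> pos_log c y x"
proof -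
  let ?U = "uniform_measure lborel {0..1::real}"
  interpret U: prob_space ?U by (rule prob_space_uniform01)
  interpret D: prob_space "unif_disc r" by (rule prob_space_unif_disc[OF r])
  interpret P: pair_sigma_finite "unif_disc r" ?U ..
  have m: "(\<lambda>(a, t). pos_log c (y + a * cis (2 * pi * t)) x) \<in> borel_measurable (unif_disc r \<Otimes>\<^sub>M ?U)"
    by measurable
  have "(\<integral>\<^sup>+a. pos_log c (y + a) x \<partial>unif_disc r) = (\<integral>\<^sup>+t. \<integral>\<^sup>+a. pos_log c (y + a) x \<partial>unif_disc r \<partial>?U)"
    by (simp add: U.emeasure_space_1)
  also have "\<dots> = (\<integral>\<^sup>+t. \<integral>\<^sup>+a. pos_log c (y + a * cis (2 * pi * t)) x \<partial>unif_disc r \<partial>?U)"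
    by (intro nn_integral_cong nn_integral_unif_disc_rotate[symmetric]) measurable
  also have "\<dots> = (\<integral>\<^sup>+a. \<integral>\<^sup>+t. pos_log c (y + a * cis (2 * pi * t)) x \<partial>?U \<partial>unif_disc r)"
    by (rule P.Fubini'[OF m])
  also have "\<dots> \<le> (\<integral>\<^sup>+a. pos_log c y x \<partial>unif_disc r)"
  proof (rule nn_integral_mono_AE, use AE_unif_disc[of r] in eventually_elim)
    fix a assume "a \<noteq> 0 \<and> cmod a < r"
    then show "(\<integral>\<^sup>+t. pos_log c (y + a * cis (2 * pi * t)) x \<partial>?U) \<le> pos_log c y x"
      using c by (intro nn_integral_pos_log_rotate_le) auto
  qed
  also have "\<dots> = pos_log c y x" by (simp add: D.emeasure_space_1)
  finally show ?thesis .
qed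

text \<open>The antiderivative \<open>y * (ln a + 1) - y * ln y\<close> extends continuously to 0,
  so the singularity is integrable.\<close>

lemma nn_integral_ln_abs_finite:
  assumes a: "0 < a"
  shows "(\<integral>\<^sup>+y\<in>{-a..a}. ennreal (ln a - ln \<bar>y\<bar>) \<partial>lborel) < \<infinity>"
proof -
  let ?F = "\<lambda>y. y * (ln a + 1) - y * ln y"
  have pos: "(\<integral>\<^sup>+y\<in>{0..a}. ennreal (ln a - ln \<bar>y\<bar>) \<partial>lborel) < \<infinity>"
  proof -
    have c1: "continuous_on {0..a} (\<lambda>y. y * ln y)"
      unfolding continuous_on_def
    proof
      fix y assume y: "y \<in> {0..a}"
      show "((\<lambda>y. y * ln y) \<longlongrightarrow> y * ln y) (at y within {0..a})"
      proof (cases "y = 0")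
        case True
        have "((\<lambda>y::real. y * ln y) \<longlongrightarrow> 0) (at_right 0)" by real_asymp
        moreover have "at (0::real) within {0..a} = at_right 0" using a by (rule at_within_Icc_at_right)
        ultimately show ?thesis using True by simp
      qed (intro tendsto_intros, auto)
    qed
    have "continuous_on {0..a} ?F" by (intro continuous_on_diff c1 continuous_intros)
    then have "((\<lambda>y. ln a - ln y) has_integral (?F a - ?F 0)) {0..a}"
      using a by (intro fundamental_theorem_of_calculus_interior)
        (auto intro!: derivative_eq_intros simp flip: has_real_derivative_iff_has_vector_derivative)
    \<comment> \<open>With \<open>ln 0 = 0\<close> the integrand has the value \<open>ln a\<close>
      at 0, which is negative for \<open>a < 1\<close>; changing it there makes it nonnegative on
      the whole interval.\<close>
    then have "((\<lambda>y. if y = 0 then 0 else ln a - ln y) has_integral (?F a - ?F 0)) {0..a}"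
      by (rule has_integral_spike_finite[of "{0}", rotated 2]) auto
    then have "(\<integral>\<^sup>+y\<in>{0..a}. ennreal (if y = 0 then 0 else ln a - ln y) \<partial>lborel) = ennreal (?F a - ?F 0)"
      by (rule nn_integral_has_integral_lebesgue'[rotated]) auto
    moreover have "(\<integral>\<^sup>+y\<in>{0..a}. ennreal (ln a - ln \<bar>y\<bar>) \<partial>lborel) = (\<integral>\<^sup>+y\<in>{0..a}. ennreal (if y = 0 then 0 else ln a - ln y) \<partial>lborel)"
      by (rule nn_integral_cong_AE, use AE_lborel_singleton[of 0] in eventually_elim) (auto simp: indicator_def)
    ultimately show ?thesis by simp
  qed
  have neg: "(\<integral>\<^sup>+y\<in>{-a..0}. ennreal (ln a - ln \<bar>y\<bar>) \<partial>lborel) = (\<integral>\<^sup>+y\<in>{0..a}. ennreal (ln a - ln \<bar>y\<bar>) \<partial>lborel)"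
  proof -
    have "(\<integral>\<^sup>+y\<in>{-a..0}. ennreal (ln a - ln \<bar>y\<bar>) \<partial>lborel) = (\<integral>\<^sup>+y\<in>{-a..0}. ennreal (ln a - ln \<bar>y\<bar>) \<partial>distr lborel borel uminus)"
      by (simp add: lborel_distr_uminus)
    also have "\<dots> = (\<integral>\<^sup>+y\<in>{0..a}. ennreal (ln a - ln \<bar>y\<bar>) \<partial>lborel)"
      by (subst nn_integral_distr) (auto intro!: nn_integral_cong simp: indicator_def)
    finally show ?thesis .
  qed
  have "(\<integral>\<^sup>+y\<in>{-a..a}. ennreal (ln a - ln \<bar>y\<bar>) \<partial>lborel)
    \<le> (\<integral>\<^sup>+y. ennreal (ln a - ln \<bar>y\<bar>) * indicator {-a..0} y + ennreal (ln a - ln \<bar>y\<bar>) * indicator {0..a} y \<partial>lborel)"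
    by (intro nn_integral_mono) (auto simp: indicator_def)
  also have "\<dots> = (\<integral>\<^sup>+y\<in>{-a..0}. ennreal (ln a - ln \<bar>y\<bar>) \<partial>lborel) + (\<integral>\<^sup>+y\<in>{0..a}. ennreal (ln a - ln \<bar>y\<bar>) \<partial>lborel)"
    by (rule nn_integral_add) auto
  also have "\<dots> < \<infinity>" using pos neg by simp
  finally show ?thesis .
qed

text \<open>The singularity fills the real line, but \<open>|z - cnj z| = 2 * |Im z|\<close> depends
  on one coordinate, and the logarithm is integrable in one real variable.\<close>

lemma nn_integral_pos_log_cnj_finite:
  assumes a: "0 < a"
  shows "(\<integral>\<^sup>+z. pos_log c z (cnj z) * indicator (cball 0 a) z \<partial>lborel) < \<infinity>"
proof -
  have [measurable]: "cball (0::complex) a \<in> sets borel" by simp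
  define g where "g y = (ennreal \<bar>c - ln 2 - ln a\<bar> + ennreal (ln a - ln \<bar>y\<bar>)) * indicator {-a..a} y" for y :: real
  have [measurable]: "g \<in> borel_measurable borel" unfolding g_def by measurable
  have "(\<integral>\<^sup>+z. pos_log c z (cnj z) * indicator (cball 0 a) z \<partial>lborel)
     = (\<integral>\<^sup>+x. \<integral>\<^sup>+y. pos_log c (Complex x y) (cnj (Complex x y)) * indicator (cball 0 a) (Complex x y) \<partial>lborel \<partial>lborel)"
    by (rule nn_integral_lborel_complex) measurable
  also have "\<dots> \<le> (\<integral>\<^sup>+x. \<integral>\<^sup>+y. indicator {-a..a} x * g y \<partial>lborel \<partial>lborel)"
  proof (rule nn_integral_mono, rule nn_integral_mono_AE)
    fix x :: real
    show "AE y in lborel. pos_log c (Complex x y) (cnj (Complex x y)) * indicator (cball 0 a) (Complex x y) \<le> indicator {-a..a} x * g y"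
      using AE_lborel_singleton[of 0]
    proof eventually_elim
      fix y :: real assume y: "y \<noteq> 0"
      show "pos_log c (Complex x y) (cnj (Complex x y)) * indicator (cball 0 a) (Complex x y) \<le> indicator {-a..a} x * g y"
      proof (cases "Complex x y \<in> cball 0 a")
        case True
        then have xy: "\<bar>x\<bar> \<le> a" "\<bar>y\<bar> \<le> a"
          using abs_Re_le_cmod[of "Complex x y"] abs_Im_le_cmod[of "Complex x y"] by auto
        have ne: "Complex x y \<noteq> cnj (Complex x y)" using y by (simp add: complex_eq_iff)
        have "Complex x y - cnj (Complex x y) = \<i> * of_real (2 * y)" by (simp add: complex_eq_iff)
        then have "cmod (Complex x y - cnj (Complex x y)) = 2 * \<bar>y\<bar>" by (simp only: norm_mult norm_ii norm_of_real)
        then have "pos_log c (Complex x y) (cnj (Complex x y)) = ennreal (c - ln (2 * \<bar>y\<bar>))" by (simp only: pos_log_real[OF ne])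
        also have "\<dots> \<le> ennreal (\<bar>c - ln 2 - ln a\<bar> + (ln a - ln \<bar>y\<bar>))"
          using y by (intro ennreal_leI) (simp add: ln_mult_pos)
        also have "\<dots> = ennreal \<bar>c - ln 2 - ln a\<bar> + ennreal (ln a - ln \<bar>y\<bar>)"
          using y xy a by (intro ennreal_plus) auto
        finally show ?thesis using True xy by (simp add: g_def indicator_def abs_le_iff)
      qed simp
    qed
  qed
  also have "\<dots> = (\<integral>\<^sup>+x. indicator {-a..a} x \<partial>lborel) * (\<integral>\<^sup>+y. g y \<partial>lborel)"
    by (simp add: nn_integral_cmult nn_integral_multc)
  also have "\<dots> < \<infinity>"
  proof -
    have "(\<integral>\<^sup>+y. g y \<partial>lborel) = (\<integral>\<^sup>+y. ennreal \<bar>c - ln 2 - ln a\<bar> * indicator {-a..a} y + ennreal (ln a - ln \<bar>y\<bar>) * indicator {-a..a} y \<partial>lborel)"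
      by (simp add: g_def distrib_right)
    also have "\<dots> = ennreal \<bar>c - ln 2 - ln a\<bar> * emeasure lborel {-a..a} + (\<integral>\<^sup>+y\<in>{-a..a}. ennreal (ln a - ln \<bar>y\<bar>) \<partial>lborel)"
      by (subst nn_integral_add) (auto simp: nn_integral_cmult_indicator)
    also have "\<dots> < \<infinity>" using nn_integral_ln_abs_finite[OF a] a by (simp add: ennreal_mult_less_top)
    finally show ?thesis using a by (simp add: ennreal_mult_less_top)
  qed
  finally show ?thesis .
qed

section \<open>Interaction of a measure with its complex conjugate\<close>

lemma reg_log_cnj: "reg_log e (cnj x) (cnj y) = reg_log e x y"
  by (simp add: reg_log_def flip: complex_cnj_diff)

lemma measurable_reg_log_compose [measurable]:
  assumes "f \<in> borel_measurable M" "g \<in> borel_measurable M"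
  shows "(\<lambda>z. reg_log e (f z) (g z)) \<in> borel_measurable M"
  using measurable_compose[OF measurable_Pair[OF assms] measurable_reg_log] by simp

lemma reg_log_le_pos_log: "0 < e \<Longrightarrow> ennreal (reg_log e x y + c) \<le> pos_log c x y"
proof (cases "x = y")
  case False
  assume e: "0 < e"
  then show ?thesis using False reg_log_le_neg_ln[OF False e] by (simp add: pos_log_real ennreal_leI)
qed simp

text \<open>The regularised kernels converge pointwise, to infinity on the diagonal; the
  \<open>liminf\<close> puts this into the form required for Fatou's lemma.\<close>

lemma pos_log_le_liminf:
  "pos_log c x y \<le> liminf (\<lambda>n. ennreal (reg_log (1 / (real n + 1)) x y + c))"
proof (cases "x = y")
  case True
  have "(\<lambda>n. - ln (1 / (real n + 1)) / 2 + c) \<longlonglongrightarrow> c + 0 \<or> filterlim (\<lambda>n. - ln (1 / (real n + 1)) / 2 + c) at_top sequentially"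
    by (rule disjI2) real_asymp
  moreover have "\<not> (\<lambda>n. - ln (1 / (real n + 1)) / 2 + c) \<longlonglongrightarrow> c + 0"
  proof
    assume "(\<lambda>n. - ln (1 / (real n + 1)) / 2 + c) \<longlonglongrightarrow> c + 0"
    moreover have "filterlim (\<lambda>n. - ln (1 / (real n + 1)) / 2 + c) at_infinity sequentially"
      by (rule filterlim_at_top_imp_at_infinity) real_asymp
    ultimately show False using not_tendsto_and_filterlim_at_infinity sequentially_bot by blast
  qed
  ultimately have "filterlim (\<lambda>n. reg_log (1 / (real n + 1)) x y + c) at_top sequentially"
    using True by (simp add: reg_log_def)
  then have "(\<lambda>n. ennreal (reg_log (1 / (real n + 1)) x y + c)) \<longlonglongrightarrow> \<infinity>"
    using ennreal_tendsto_top_eq_at_top[of "\<lambda>n. reg_log (1 / (real n + 1)) x y + c" sequentially] by simp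
  then show ?thesis using lim_imp_Liminf[OF sequentially_bot] by fastforce
next
  case False
  have "(\<lambda>n. 1 / (real n + 1)) \<longlonglongrightarrow> 0" by real_asymp
  then have "(\<lambda>n. - ln ((cmod (x - y))\<^sup>2 + 1 / (real n + 1)) / 2 + c) \<longlonglongrightarrow> - ln ((cmod (x - y))\<^sup>2 + 0) / 2 + c"
    using False by (intro tendsto_intros) auto
  then have "(\<lambda>n. ennreal (reg_log (1 / (real n + 1)) x y + c)) \<longlonglongrightarrow> ennreal (- ln ((cmod (x - y))\<^sup>2 + 0) / 2 + c)"
    unfolding reg_log_def by (rule tendsto_ennrealI)
  moreover have "pos_log c x y = ennreal (- ln ((cmod (x - y))\<^sup>2 + 0) / 2 + c)"
    using False by (simp add: pos_log_real ln_realpow)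
  ultimately show ?thesis using lim_imp_Liminf[OF sequentially_bot] by fastforce
qed

text \<open>Positivity of the energy form of \<open>\<phi>\<close> minus its complex conjugate.\<close>

lemma nn_integral_pos_log_cnj_le:
  assumes \<phi>: "prob_space \<phi>" and sets [measurable_cong]: "sets \<phi> = sets borel"
    and R: "AE x in \<phi>. cmod x \<le> R" and c: "(2 * R)\<^sup>2 + 1 \<le> exp (2 * c)"
    and q: "(\<integral>\<^sup>+x. \<integral>\<^sup>+y. pos_log c x y \<partial>\<phi> \<partial>\<phi>) \<le> ennreal q" "0 \<le> q"
  shows "(\<integral>\<^sup>+x. \<integral>\<^sup>+y. pos_log c x (cnj y) \<partial>\<phi> \<partial>\<phi>) \<le> ennreal q"
proof -
  interpret \<phi>: prob_space \<phi> by fact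
  define \<phi>' where "\<phi>' = distr \<phi> borel cnj"
  have \<phi>': "prob_space \<phi>'" "sets \<phi>' = sets borel" unfolding \<phi>'_def by (auto intro: \<phi>.prob_space_distr)
  have R': "AE x in \<phi>'. cmod x \<le> R" unfolding \<phi>'_def using R by (subst AE_distr_iff) auto
  have S: "AE x in \<phi>. x \<in> cball 0 R" "AE x in \<phi>'. x \<in> cball 0 R" using R R' by auto
  have reg: "(\<integral>\<^sup>+x. \<integral>\<^sup>+y. ennreal (reg_log e x (cnj y) + c) \<partial>\<phi> \<partial>\<phi>) \<le> ennreal q" if e: "0 < e" "e \<le> 1" for e
  proof -
    define b where "b = \<bar>ln e\<bar> + \<bar>ln ((2 * R)\<^sup>2 + e)\<bar>"
    have xy: "cmod (x - y) \<le> 2 * R" if "x \<in> cball 0 R" "y \<in> cball 0 R" for x y :: complex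
      using norm_triangle_ineq4[of x y] that by auto
    have bd: "\<bar>reg_log e x y\<bar> \<le> b" if "x \<in> cball 0 R" "y \<in> cball 0 R" for x y
      unfolding b_def using abs_reg_log_le[OF e(1) xy[OF that]] .
    have nn: "0 \<le> reg_log e x y + c" if "x \<in> cball 0 R" "y \<in> cball 0 R" for x y
    proof -
      have "(cmod (x - y))\<^sup>2 \<le> (2 * R)\<^sup>2" using xy[OF that] by (intro power_mono) auto
      then have "(cmod (x - y))\<^sup>2 + e \<le> exp (2 * c)" using c e by linarith
      then have "ln ((cmod (x - y))\<^sup>2 + e) \<le> ln (exp (2 * c))" using e by (subst ln_le_cancel_iff) (auto simp: add_nonneg_pos)
      then show ?thesis by (simp add: reg_log_def)
    qed
    have mk: "(\<lambda>(x, y). reg_log e x (cnj y)) \<in> borel_measurable (borel \<Otimes>\<^sub>M borel)" by measurable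
    have bd': "\<bar>reg_log e x (cnj y)\<bar> \<le> b" if "x \<in> cball 0 R" "y \<in> cball 0 R" for x y using bd[of x "cnj y"] that by simp
    have i1: "x \<in> cball 0 R \<Longrightarrow> integrable \<phi> (reg_log e x)" "integrable \<phi> (\<lambda>x. \<integral>y. reg_log e x y \<partial>\<phi>)" for x
      by (rule integrable_kernel_inner[OF \<phi> \<phi> sets sets measurable_reg_log S(1) S(1), where B = b]
          integrable_kernel[OF \<phi> \<phi> sets sets measurable_reg_log S(1) S(1), where B = b]; use bd in blast)+
    have i2: "x \<in> cball 0 R \<Longrightarrow> integrable \<phi> (\<lambda>y. reg_log e x (cnj y))" "integrable \<phi> (\<lambda>x. \<integral>y. reg_log e x (cnj y) \<partial>\<phi>)" for x
      by (rule integrable_kernel_inner[OF \<phi> \<phi> sets sets mk S(1) S(1), where B = b]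
          integrable_kernel[OF \<phi> \<phi> sets sets mk S(1) S(1), where B = b]; use bd' in blast)+
    define A where "A = (\<integral>x. \<integral>y. reg_log e x y \<partial>\<phi> \<partial>\<phi>)"
    define B where "B = (\<integral>x. \<integral>y. reg_log e x (cnj y) \<partial>\<phi> \<partial>\<phi>)"
    have inner: "(\<integral>y. reg_log e x y \<partial>\<phi>') = (\<integral>y. reg_log e x (cnj y) \<partial>\<phi>)" for x
      unfolding \<phi>'_def by (subst integral_distr) auto
    have "(\<integral>x. \<integral>y. reg_log e x y \<partial>\<phi>' \<partial>\<phi>') = (\<integral>x. \<integral>y. reg_log e (cnj x) (cnj y) \<partial>\<phi> \<partial>\<phi>)"
      unfolding inner by (subst \<phi>'_def, subst integral_distr) auto
    \<comment> \<open>The kernel is invariant under conjugating both arguments, so \<phi> and its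
      conjugate have the same self-interaction \<open>A\<close>; nonnegativity of the form then says
      \<open>B \<le> A\<close>.\<close>
    then have "edist (reg_log e) \<phi> \<phi>' = A - 2 * B + A"
      unfolding edist_def A_def B_def inner reg_log_cnj by simp
    then have "B \<le> A" using edist_reg_log_nonneg[OF e(1) \<phi> sets \<phi>' R R'] by simp
    moreover have "A + c \<le> q"
    proof -
      have "ennreal (A + c) = ennreal (\<integral>x. (\<integral>y. reg_log e x y \<partial>\<phi>) + c \<partial>\<phi>)"
        unfolding A_def using i1(2) by (simp add: \<phi>.prob_space)
      also have "\<dots> \<le> (\<integral>\<^sup>+x. ennreal ((\<integral>y. reg_log e x y \<partial>\<phi>) + c) \<partial>\<phi>)"
        using i1(2) by (intro integral_le_nn_integral) auto
      also have "\<dots> \<le> (\<integral>\<^sup>+x. \<integral>\<^sup>+y. pos_log c x y \<partial>\<phi> \<partial>\<phi>)"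
      proof (rule nn_integral_mono_AE, use S(1) in eventually_elim)
        fix x :: complex assume x: "x \<in> cball 0 R"
        have "ennreal ((\<integral>y. reg_log e x y \<partial>\<phi>) + c) = ennreal (\<integral>y. reg_log e x y + c \<partial>\<phi>)"
          using i1(1)[OF x] by (simp add: \<phi>.prob_space)
        also have "\<dots> \<le> (\<integral>\<^sup>+y. ennreal (reg_log e x y + c) \<partial>\<phi>)"
          using i1(1)[OF x] by (intro integral_le_nn_integral) auto
        also have "\<dots> \<le> (\<integral>\<^sup>+y. pos_log c x y \<partial>\<phi>)" by (intro nn_integral_mono reg_log_le_pos_log e)
        finally show "ennreal ((\<integral>y. reg_log e x y \<partial>\<phi>) + c) \<le> (\<integral>\<^sup>+y. pos_log c x y \<partial>\<phi>)" .
      qed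
      also note q(1)
      finally show ?thesis by (rule ennreal_le_iff[OF q(2), THEN iffD1])
    qed
    ultimately have Bq: "B + c \<le> q" by simp
    have "(\<integral>\<^sup>+x. \<integral>\<^sup>+y. ennreal (reg_log e x (cnj y) + c) \<partial>\<phi> \<partial>\<phi>) = (\<integral>\<^sup>+x. ennreal ((\<integral>y. reg_log e x (cnj y) \<partial>\<phi>) + c) \<partial>\<phi>)"
    proof (rule nn_integral_cong_AE, use S(1) in eventually_elim)
      fix x :: complex assume x: "x \<in> cball 0 R"
      have "AE y in \<phi>. 0 \<le> reg_log e x (cnj y) + c"
        using S(1) by eventually_elim (use nn[OF x] in simp)
      then have "(\<integral>\<^sup>+y. ennreal (reg_log e x (cnj y) + c) \<partial>\<phi>) = ennreal (\<integral>y. reg_log e x (cnj y) + c \<partial>\<phi>)"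
        using i2(1)[OF x] by (intro nn_integral_eq_integral) auto
      then show "(\<integral>\<^sup>+y. ennreal (reg_log e x (cnj y) + c) \<partial>\<phi>) = ennreal ((\<integral>y. reg_log e x (cnj y) \<partial>\<phi>) + c)"
        using i2(1)[OF x] by (simp add: \<phi>.prob_space)
    qed
    also have "\<dots> = ennreal (\<integral>x. (\<integral>y. reg_log e x (cnj y) \<partial>\<phi>) + c \<partial>\<phi>)"
    proof (rule nn_integral_eq_integral)
      show "AE x in \<phi>. 0 \<le> (\<integral>y. reg_log e x (cnj y) \<partial>\<phi>) + c"
        using S(1)
      proof eventually_elim
        fix x :: complex assume x: "x \<in> cball 0 R"
        have "AE y in \<phi>. 0 \<le> reg_log e x (cnj y) + c"
          using S(1) by eventually_elim (use nn[OF x] in simp)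
        then have "0 \<le> (\<integral>y. reg_log e x (cnj y) + c \<partial>\<phi>)" by (rule integral_nonneg_AE)
        then show "0 \<le> (\<integral>y. reg_log e x (cnj y) \<partial>\<phi>) + c" using i2(1)[OF x] by (simp add: \<phi>.prob_space)
      qed
    qed (use i2(2) in auto)
    also have "\<dots> = ennreal (B + c)" unfolding B_def using i2(2) by (simp add: \<phi>.prob_space)
    also have "\<dots> \<le> ennreal q" using Bq by (rule ennreal_leI)
    finally show ?thesis .
  qed
  \<comment> \<open>Fatou's lemma in each variable removes the regularisation, since the bound
    \<open>ennreal q\<close> does not depend on \<open>e\<close>.\<close>
  have "(\<integral>\<^sup>+x. \<integral>\<^sup>+y. pos_log c x (cnj y) \<partial>\<phi> \<partial>\<phi>)
    \<le> (\<integral>\<^sup>+x. \<integral>\<^sup>+y. liminf (\<lambda>n. ennreal (reg_log (1 / (real n + 1)) x (cnj y) + c)) \<partial>\<phi> \<partial>\<phi>)"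
    by (intro nn_integral_mono pos_log_le_liminf)
  also have "\<dots> \<le> (\<integral>\<^sup>+x. liminf (\<lambda>n. \<integral>\<^sup>+y. ennreal (reg_log (1 / (real n + 1)) x (cnj y) + c) \<partial>\<phi>) \<partial>\<phi>)"
    by (intro nn_integral_mono nn_integral_liminf) measurable
  also have "\<dots> \<le> liminf (\<lambda>n. \<integral>\<^sup>+x. \<integral>\<^sup>+y. ennreal (reg_log (1 / (real n + 1)) x (cnj y) + c) \<partial>\<phi> \<partial>\<phi>)"
    by (intro nn_integral_liminf) measurable
  also have "\<dots> \<le> liminf (\<lambda>n. ennreal q)"
    by (intro Liminf_mono always_eventually allI reg) auto
  also have "\<dots> = ennreal q" by (simp add: Liminf_const)
  finally show ?thesis .
qed

section \<open>Convolution with the uniform measure on a disc\<close>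

definition smear :: "complex measure \<Rightarrow> real \<Rightarrow> complex measure" where
  "smear \<mu> r = distr (\<mu> \<Otimes>\<^sub>M unif_disc r) borel (\<lambda>(y, a). y + a)"

lemma prob_on_C_smear:
  assumes r: "0 < r" and \<mu>: "prob_on_C \<mu>"
  shows "prob_on_C (smear \<mu> r)"
proof -
  interpret D: prob_space "unif_disc r" by (rule prob_space_unif_disc[OF r])
  interpret \<mu>: prob_space \<mu> using \<mu> by (simp add: prob_on_C_def)
  have [measurable_cong]: "sets \<mu> = sets borel" using \<mu> by (simp add: prob_on_C_def)
  interpret P: pair_prob_space \<mu> "unif_disc r" ..
  have "prob_space (smear \<mu> r)" unfolding smear_def by (rule P.prob_space_distr) measurable
  then show ?thesis by (simp add: prob_on_C_def smear_def)
qed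

lemma nn_integral_smear:
  assumes r: "0 < r" and \<mu>: "prob_on_C \<mu>" and [measurable]: "f \<in> borel_measurable borel"
  shows "(\<integral>\<^sup>+z. f z \<partial>smear \<mu> r) = (\<integral>\<^sup>+y. \<integral>\<^sup>+a. f (y + a) \<partial>unif_disc r \<partial>\<mu>)"
proof -
  interpret D: prob_space "unif_disc r" by (rule prob_space_unif_disc[OF r])
  have [measurable_cong]: "sets \<mu> = sets borel" using \<mu> by (simp add: prob_on_C_def)
  have "(\<integral>\<^sup>+z. f z \<partial>smear \<mu> r) = (\<integral>\<^sup>+p. f (case p of (y, a) \<Rightarrow> y + a) \<partial>(\<mu> \<Otimes>\<^sub>M unif_disc r))"
    unfolding smear_def by (rule nn_integral_distr) measurable
  also have "\<dots> = (\<integral>\<^sup>+y. \<integral>\<^sup>+a. f (y + a) \<partial>unif_disc r \<partial>\<mu>)"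
    by (subst D.nn_integral_fst[symmetric]) auto
  finally show ?thesis .
qed

text \<open>Convolving with the uniform law on a disc gives a density of at most one over the area
  of the disc, however singular \<mu> is.\<close>

lemma nn_integral_smear_le:
  assumes r: "0 < r" and \<mu>: "prob_on_C \<mu>" and [measurable]: "f \<in> borel_measurable borel"
  shows "(\<integral>\<^sup>+z. f z \<partial>smear \<mu> r) \<le> (\<integral>\<^sup>+z. f z \<partial>lborel) / emeasure lborel (ball (0::complex) r)"
proof -
  interpret \<mu>: prob_space \<mu> using \<mu> by (simp add: prob_on_C_def)
  have "(\<integral>\<^sup>+z. f z \<partial>smear \<mu> r) = (\<integral>\<^sup>+y. \<integral>\<^sup>+a. f (y + a) \<partial>unif_disc r \<partial>\<mu>)"
    by (rule nn_integral_smear[OF r \<mu>]) measurable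
  also have "\<dots> \<le> (\<integral>\<^sup>+y. (\<integral>\<^sup>+z. f z \<partial>lborel) / emeasure lborel (ball (0::complex) r) \<partial>\<mu>)"
  proof (rule nn_integral_mono)
    fix y
    have "(\<integral>\<^sup>+a. f (y + a) \<partial>unif_disc r) = (\<integral>\<^sup>+a. f (y + a) * indicator (ball 0 r) a \<partial>lborel) / emeasure lborel (ball (0::complex) r)"
      by (rule nn_integral_unif_disc) measurable
    also have "\<dots> \<le> (\<integral>\<^sup>+a. f (y + a) \<partial>lborel) / emeasure lborel (ball (0::complex) r)"
      by (intro divide_right_mono_ennreal nn_integral_mono) (auto simp: indicator_def)
    also have "(\<integral>\<^sup>+a. f (y + a) \<partial>lborel) = (\<integral>\<^sup>+z. f z \<partial>lborel)" by (rule nn_integral_lborel_translate) measurable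
    finally show "(\<integral>\<^sup>+a. f (y + a) \<partial>unif_disc r) \<le> (\<integral>\<^sup>+z. f z \<partial>lborel) / emeasure lborel (ball (0::complex) r)" .
  qed
  also have "\<dots> = (\<integral>\<^sup>+z. f z \<partial>lborel) / emeasure lborel (ball (0::complex) r)" by (simp add: \<mu>.emeasure_space_1)
  finally show ?thesis .
qed

lemma AE_smear_cmod_le:
  assumes r: "0 < r" and \<mu>: "prob_on_C \<mu>" and R: "AE x in \<mu>. cmod x \<le> R"
  shows "AE x in smear \<mu> r. cmod x \<le> R + r"
proof -
  have sets: "sets (smear \<mu> r) = sets borel" by (simp add: smear_def)
  let ?f = "\<lambda>x. indicator {x. R + r < cmod x} x :: ennreal"
  have "(\<integral>\<^sup>+z. ?f z \<partial>smear \<mu> r) = (\<integral>\<^sup>+y. \<integral>\<^sup>+a. ?f (y + a) \<partial>unif_disc r \<partial>\<mu>)"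
    by (rule nn_integral_smear[OF r \<mu>]) measurable
  also have "\<dots> = (\<integral>\<^sup>+y. 0 \<partial>\<mu>)"
  proof (rule nn_integral_cong_AE, use R in eventually_elim)
    fix y assume y: "cmod y \<le> R"
    have "(\<integral>\<^sup>+a. ?f (y + a) \<partial>unif_disc r) = (\<integral>\<^sup>+a. 0 \<partial>unif_disc r)"
    proof (rule nn_integral_cong_AE, use AE_unif_disc[of r] in eventually_elim)
      fix a assume "a \<noteq> 0 \<and> cmod a < r"
      then have "cmod (y + a) \<le> R + r" using y norm_triangle_ineq[of y a] by linarith
      then show "?f (y + a) = 0" by simp
    qed
    then show "(\<integral>\<^sup>+a. ?f (y + a) \<partial>unif_disc r) = 0" by simp
  qed
  finally have "(\<integral>\<^sup>+z. ?f z \<partial>smear \<mu> r) = 0" by simp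
  then have "AE z in smear \<mu> r. ?f z = 0" by (subst (asm) nn_integral_0_iff_AE) (auto simp: sets cong: measurable_cong_sets)
  then show ?thesis by eventually_elim (auto simp: indicator_def split: if_splits)
qed

text \<open>The two arguments are smeared one after the other, each time by the inequality for
  discs. The condition on \<open>c\<close> covers the largest distance that occurs: one point
  already moved by up to \<open>r\<close>, the other about to be moved.\<close>

lemma nn_integral_pos_log_smear_le:
  assumes r: "0 < r" and \<mu>: "prob_on_C \<mu>" and R: "AE x in \<mu>. cmod x \<le> R" and c: "2 * R + 2 * r \<le> exp c"
  shows "(\<integral>\<^sup>+x. \<integral>\<^sup>+y. pos_log c x y \<partial>smear \<mu> r \<partial>smear \<mu> r) \<le> (\<integral>\<^sup>+x. \<integral>\<^sup>+y. pos_log c x y \<partial>\<mu> \<partial>\<mu>)"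
proof -
  interpret D: prob_space "unif_disc r" by (rule prob_space_unif_disc[OF r])
  interpret \<mu>: prob_space \<mu> using \<mu> by (simp add: prob_on_C_def)
  have [measurable_cong]: "sets \<mu> = sets borel" using \<mu> by (simp add: prob_on_C_def)
  have [measurable_cong]: "sets (smear \<mu> r) = sets borel" by (simp add: smear_def)
  interpret S: prob_space "smear \<mu> r" using prob_on_C_smear[OF r \<mu>] by (simp add: prob_on_C_def)
  interpret P: pair_sigma_finite "unif_disc r" \<mu> ..
  have one: "(\<integral>\<^sup>+y. pos_log c x y \<partial>smear \<mu> r) \<le> (\<integral>\<^sup>+y. pos_log c x y \<partial>\<mu>)" if x: "cmod x \<le> R + r" for x
  proof -
    have "(\<integral>\<^sup>+y. pos_log c x y \<partial>smear \<mu> r) = (\<integral>\<^sup>+y. \<integral>\<^sup>+a. pos_log c x (y + a) \<partial>unif_disc r \<partial>\<mu>)"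
      by (rule nn_integral_smear[OF r \<mu>]) measurable
    also have "\<dots> \<le> (\<integral>\<^sup>+y. pos_log c x y \<partial>\<mu>)"
    proof (rule nn_integral_mono_AE, use R in eventually_elim)
      fix y assume "cmod y \<le> R"
      then have "cmod (y - x) + r \<le> exp c" using x c norm_triangle_ineq4[of y x] by linarith
      then show "(\<integral>\<^sup>+a. pos_log c x (y + a) \<partial>unif_disc r) \<le> pos_log c x y"
        using nn_integral_pos_log_disc_le[OF r, of y x c] by (simp add: pos_log_commute)
    qed
    finally show ?thesis .
  qed
  have "(\<integral>\<^sup>+x. \<integral>\<^sup>+y. pos_log c x y \<partial>smear \<mu> r \<partial>smear \<mu> r) \<le> (\<integral>\<^sup>+x. \<integral>\<^sup>+y. pos_log c x y \<partial>\<mu> \<partial>smear \<mu> r)"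
    by (rule nn_integral_mono_AE, use AE_smear_cmod_le[OF r \<mu> R] in eventually_elim) (rule one)
  also have "\<dots> = (\<integral>\<^sup>+x. \<integral>\<^sup>+a. \<integral>\<^sup>+y. pos_log c (x + a) y \<partial>\<mu> \<partial>unif_disc r \<partial>\<mu>)"
    by (rule nn_integral_smear[OF r \<mu>]) measurable
  also have "\<dots> = (\<integral>\<^sup>+x. \<integral>\<^sup>+y. \<integral>\<^sup>+a. pos_log c (x + a) y \<partial>unif_disc r \<partial>\<mu> \<partial>\<mu>)"
    by (intro nn_integral_cong P.Fubini'[symmetric]) measurable
  also have "\<dots> \<le> (\<integral>\<^sup>+x. \<integral>\<^sup>+y. pos_log c x y \<partial>\<mu> \<partial>\<mu>)"
  proof (rule nn_integral_mono_AE, use R in eventually_elim)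
    fix x assume x: "cmod x \<le> R"
    show "(\<integral>\<^sup>+y. \<integral>\<^sup>+a. pos_log c (x + a) y \<partial>unif_disc r \<partial>\<mu>) \<le> (\<integral>\<^sup>+y. pos_log c x y \<partial>\<mu>)"
    proof (rule nn_integral_mono_AE, use R in eventually_elim)
      fix y assume "cmod y \<le> R"
      then have "cmod (x - y) + r \<le> exp c" using x c r norm_triangle_ineq4[of x y] by linarith
      then show "(\<integral>\<^sup>+a. pos_log c (x + a) y \<partial>unif_disc r) \<le> pos_log c x y"
        by (rule nn_integral_pos_log_disc_le[OF r])
    qed
  qed
  finally show ?thesis .
qed

context equilibrium
begin

text \<open>Separates the minimal energy into the interaction \<open>m - vbar\<close> and the field
  \<open>vbar\<close>. The pointwise identity has sums of nonnegative terms on both sides, both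
  infinite on the diagonal, so no difference of infinities arises.\<close>

lemma nn_integral_pos_log_\<mu>V:
  assumes R: "AE x in \<mu>V. cmod x \<le> R" and c: "2 * R \<le> exp c" "0 \<le> c"
  shows "(\<integral>\<^sup>+x. \<integral>\<^sup>+y. pos_log c x y \<partial>\<mu>V \<partial>\<mu>V) = ennreal (m - vbar + c)" "0 \<le> m - vbar + c"
proof -
  obtain \<Lambda> R' where AE_V: "AE x in \<mu>V. V x = ereal (v x) \<and> v x \<le> \<Lambda> \<and> cmod x \<le> R'" by (rule AE_V_real_bounded)
  let ?I = "\<integral>\<^sup>+x. \<integral>\<^sup>+y. pos_log c x y \<partial>\<mu>V \<partial>\<mu>V"
  have vbar: "(\<integral>\<^sup>+x. ennreal (v x) \<partial>\<mu>V) = ennreal vbar" "0 \<le> vbar"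
    unfolding vbar_def using integrable_v v_nonneg by (auto intro!: nn_integral_eq_integral integral_nonneg)
  have pt: "K x y + ennreal c = pos_log c x y + (ennreal (v x / 2) + ennreal (v y / 2) + ennreal C)"
    if x: "V x = ereal (v x)" "cmod x \<le> R" and y: "V y = ereal (v y)" "cmod y \<le> R" for x y
  proof (cases "x = y")
    case False
    have "cmod (x - y) \<le> exp c" using x y c norm_triangle_ineq4[of x y] by linarith
    then have "ln (cmod (x - y)) \<le> ln (exp c)" using False by (subst ln_le_cancel_iff) auto
    then have l: "0 \<le> c - ln (cmod (x - y))" by simp
    have "- C \<le> - ln (cmod (x - y)) + (v x + v y) / 2"
      using kern_ge_minus_C[of x y] kern_real[OF False x(1) y(1)] by simp
    then have k: "0 \<le> - ln (cmod (x - y)) + (v x + v y) / 2 + C" by simp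
    have "K x y + ennreal c = ennreal (- ln (cmod (x - y)) + (v x + v y) / 2 + C + c)"
      using K_real[OF False x(1) y(1)] k c by (simp add: ennreal_plus)
    also have "- ln (cmod (x - y)) + (v x + v y) / 2 + C + c = c - ln (cmod (x - y)) + (v x / 2 + v y / 2 + C)" by (simp add: add_divide_distrib)
    also have "ennreal \<dots> = pos_log c x y + (ennreal (v x / 2) + ennreal (v y / 2) + ennreal C)"
      using False l v_nonneg C_nonneg by (simp add: pos_log_real ennreal_plus)
    finally show ?thesis .
  qed (simp add: K_infinite)
  have "(\<integral>\<^sup>+x. \<integral>\<^sup>+y. K x y + ennreal c \<partial>\<mu>V \<partial>\<mu>V) = (\<integral>\<^sup>+x. \<integral>\<^sup>+y. pos_log c x y + (ennreal (v x / 2) + ennreal (v y / 2) + ennreal C) \<partial>\<mu>V \<partial>\<mu>V)"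
    by (rule nn_integral_cong_AE, use AE_V R in eventually_elim, rule nn_integral_cong_AE, use AE_V R in eventually_elim) (use pt in auto)
  moreover have "(\<integral>\<^sup>+x. \<integral>\<^sup>+y. K x y + ennreal c \<partial>\<mu>V \<partial>\<mu>V) = ennreal (m + C + c)"
    using J_\<mu>V m_C_nonneg c by (simp add: nn_integral_add J_def \<mu>V.emeasure_space_1 ennreal_plus)
  moreover have "(\<integral>\<^sup>+x. \<integral>\<^sup>+y. pos_log c x y + (ennreal (v x / 2) + ennreal (v y / 2) + ennreal C) \<partial>\<mu>V \<partial>\<mu>V) = ?I + ennreal (vbar + C)"
  proof -
    have half: "(\<integral>\<^sup>+x. ennreal (v x / 2) \<partial>\<mu>V) = ennreal (vbar / 2)"
      using integrable_v v_nonneg unfolding vbar_def by (subst nn_integral_eq_integral) auto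
    have "(\<integral>\<^sup>+x. \<integral>\<^sup>+y. pos_log c x y + (ennreal (v x / 2) + ennreal (v y / 2) + ennreal C) \<partial>\<mu>V \<partial>\<mu>V)
       = ?I + (ennreal (vbar / 2) + (ennreal (vbar / 2) + ennreal C))"
      by (simp add: nn_integral_add \<mu>V.emeasure_space_1 half add.assoc)
    also have "ennreal (vbar / 2) + (ennreal (vbar / 2) + ennreal C) = ennreal (vbar + C)"
      using vbar C_nonneg by (simp flip: ennreal_plus)
    finally show ?thesis .
  qed
  ultimately have eq: "?I + ennreal (vbar + C) = ennreal (m + C + c)" by simp
  then have "?I \<noteq> \<infinity>" by auto
  then obtain i where i: "?I = ennreal i" "0 \<le> i" by (cases ?I) auto
  have "ennreal (i + (vbar + C)) = ennreal (m + C + c)" using eq i vbar C_nonneg by (simp add: ennreal_plus)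
  then have "i + (vbar + C) = m + C + c" using i vbar C_nonneg m_C_nonneg c by (subst (asm) ennreal_inj) auto
  then have "i = m - vbar + c" by simp
  then show "?I = ennreal (m - vbar + c)" "0 \<le> m - vbar + c" using i by auto
qed

text \<open>Collects what the bound on the normalising constant asks of a trial measure: a bounded
  density, interactions with itself and with its conjugate no larger than the self-interaction of
  \<open>\<mu>V\<close>, a finite mean of the conjugation term, and a field at most \<eta> above
  \<open>vbar\<close>.\<close>

lemma smeared_equilibrium_exists:
  assumes \<eta>: "0 < \<eta>"
  obtains \<phi> B c c1 where "prob_on_C \<phi>" "0 < B"
    "\<And>f. f \<in> borel_measurable borel \<Longrightarrow> (\<integral>\<^sup>+z. f z \<partial>\<phi>) \<le> ennreal B * (\<integral>\<^sup>+z. f z \<partial>lborel)"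
    "0 \<le> m - vbar + c" "0 \<le> c1"
    "(\<integral>\<^sup>+x. \<integral>\<^sup>+y. pos_log c x y \<partial>\<phi> \<partial>\<phi>) \<le> ennreal (m - vbar + c)"
    "(\<integral>\<^sup>+x. \<integral>\<^sup>+y. pos_log c x (cnj y) \<partial>\<phi> \<partial>\<phi>) \<le> ennreal (m - vbar + c)"
    "(\<integral>\<^sup>+z. pos_log c z (cnj z) \<partial>\<phi>) \<le> ennreal c1"
    "(\<integral>\<^sup>+z. e2ennreal (V z) \<partial>\<phi>) \<le> ennreal (vbar + \<eta>)"
proof -
  obtain \<Lambda> R0 where AE0: "AE x in \<mu>V. V x = ereal (v x) \<and> v x \<le> \<Lambda> \<and> cmod x \<le> R0" by (rule AE_V_real_bounded)
  define R where "R = max R0 1"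
  have R1: "1 \<le> R" by (simp add: R_def)
  have AE_V: "AE x in \<mu>V. V x = ereal (v x) \<and> v x \<le> \<Lambda> \<and> cmod x \<le> R" using AE0 by (auto simp: R_def)
  then have AE_R: "AE x in \<mu>V. cmod x \<le> R" by auto
  obtain r where r: "0 < r" "r \<le> 1" and rV: "\<And>x y. V x \<le> ereal \<Lambda> \<Longrightarrow> cmod (y - x) \<le> r \<Longrightarrow> V y \<le> V x + ereal \<eta>"
    using V_uniform_upper[OF \<eta>, of \<Lambda>] by auto
  \<comment> \<open>One constant for two requirements, \<open>2 * R + 2 * r \<le> exp c\<close> for
    smearing and \<open>(2 * (R + r))\<^sup>2 + 1 \<le> exp (2 * c)\<close> for the conjugate; both
    reduce to \<open>c \<le> exp c\<close>.\<close>
  define c where "c = (2 * (R + 1))\<^sup>2 + 1"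
  have c0: "0 \<le> c" by (simp add: c_def)
  have "c \<le> exp c" using exp_ge_add_one_self[of c] by linarith
  moreover have "2 * (R + 1) \<le> (2 * (R + 1))\<^sup>2" using R1 by (intro self_le_power) auto
  ultimately have c1: "2 * R + 2 * r \<le> exp c" using r by (simp add: c_def)
  have "exp c \<le> exp (2 * c)" using c0 by simp
  then have "c \<le> exp (2 * c)" using \<open>c \<le> exp c\<close> by linarith
  then have c2: "(2 * (R + 1))\<^sup>2 + 1 \<le> exp (2 * c)" unfolding c_def[symmetric] .
  have "(2 * (R + r))\<^sup>2 \<le> (2 * (R + 1))\<^sup>2" using R1 r by (intro power_mono) auto
  then have c3: "(2 * (R + r))\<^sup>2 + 1 \<le> exp (2 * c)" using c2 by linarith
  define \<phi> where "\<phi> = smear \<mu>V r"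
  define D where "D = measure lborel (ball (0::complex) r)"
  have D: "emeasure lborel (ball (0::complex) r) = ennreal D" "0 < D"
    using emeasure_ball_pos_finite[OF r(1)] content_ball_pos[OF r(1), of "0::complex"]
    by (auto simp: D_def emeasure_eq_ennreal_measure)
  have p\<phi>: "prob_on_C \<phi>" unfolding \<phi>_def by (rule prob_on_C_smear[OF r(1) prob_\<mu>V])
  then have \<phi>: "prob_space \<phi>" and [measurable_cong]: "sets \<phi> = sets borel" by (auto simp: prob_on_C_def)
  have R\<phi>: "AE x in \<phi>. cmod x \<le> R + r" unfolding \<phi>_def by (rule AE_smear_cmod_le[OF r(1) prob_\<mu>V AE_R])
  have le: "(\<integral>\<^sup>+z. f z \<partial>\<phi>) \<le> ennreal (1 / D) * (\<integral>\<^sup>+z. f z \<partial>lborel)" if "f \<in> borel_measurable borel" for f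
  proof -
    have "(\<integral>\<^sup>+z. f z \<partial>\<phi>) \<le> (\<integral>\<^sup>+z. f z \<partial>lborel) / ennreal D"
      using nn_integral_smear_le[OF r(1) prob_\<mu>V that] by (simp add: \<phi>_def D)
    also have "\<dots> = ennreal (1 / D) * (\<integral>\<^sup>+z. f z \<partial>lborel)"
      using D(2) by (simp add: divide_ennreal_def inverse_ennreal mult.commute inverse_eq_divide)
    finally show ?thesis .
  qed
  have "2 * R \<le> exp c" using c1 r by linarith
  note Q = nn_integral_pos_log_\<mu>V[OF AE_R this c0]
  have e1: "(\<integral>\<^sup>+x. \<integral>\<^sup>+y. pos_log c x y \<partial>\<phi> \<partial>\<phi>) \<le> ennreal (m - vbar + c)"
    using nn_integral_pos_log_smear_le[OF r(1) prob_\<mu>V AE_R c1] Q(1) by (simp add: \<phi>_def)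
  have e2: "(\<integral>\<^sup>+x. \<integral>\<^sup>+y. pos_log c x (cnj y) \<partial>\<phi> \<partial>\<phi>) \<le> ennreal (m - vbar + c)"
    by (rule nn_integral_pos_log_cnj_le[OF \<phi> _ R\<phi> c3 e1 Q(2)]) fact
  have [measurable]: "cball (0::complex) (R + r) \<in> sets borel" by simp
  have "(\<integral>\<^sup>+z. pos_log c z (cnj z) \<partial>\<phi>) = (\<integral>\<^sup>+z. pos_log c z (cnj z) * indicator (cball 0 (R + r)) z \<partial>\<phi>)"
    by (rule nn_integral_cong_AE, use R\<phi> in eventually_elim) auto
  also have "\<dots> \<le> ennreal (1 / D) * (\<integral>\<^sup>+z. pos_log c z (cnj z) * indicator (cball 0 (R + r)) z \<partial>lborel)"
    by (rule le) measurable
  also have "\<dots> < \<infinity>" using nn_integral_pos_log_cnj_finite[of "R + r" c] r R1 by (simp add: ennreal_mult_less_top)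
  finally obtain c1' where e3: "(\<integral>\<^sup>+z. pos_log c z (cnj z) \<partial>\<phi>) = ennreal c1'" "0 \<le> c1'"
    by (cases "\<integral>\<^sup>+z. pos_log c z (cnj z) \<partial>\<phi>") auto
  interpret D: prob_space "unif_disc r" by (rule prob_space_unif_disc[OF r(1)])
  have "(\<integral>\<^sup>+z. e2ennreal (V z) \<partial>\<phi>) = (\<integral>\<^sup>+y. \<integral>\<^sup>+a. e2ennreal (V (y + a)) \<partial>unif_disc r \<partial>\<mu>V)"
    unfolding \<phi>_def by (rule nn_integral_smear[OF r(1) prob_\<mu>V]) measurable
  also have "\<dots> \<le> (\<integral>\<^sup>+y. ennreal (v y + \<eta>) \<partial>\<mu>V)"
  proof (rule nn_integral_mono_AE, use AE_V in eventually_elim)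
    fix y assume y: "V y = ereal (v y) \<and> v y \<le> \<Lambda> \<and> cmod y \<le> R"
    have "(\<integral>\<^sup>+a. e2ennreal (V (y + a)) \<partial>unif_disc r) \<le> (\<integral>\<^sup>+a. ennreal (v y + \<eta>) \<partial>unif_disc r)"
    proof (rule nn_integral_mono_AE, use AE_unif_disc[of r] in eventually_elim)
      fix a assume "a \<noteq> 0 \<and> cmod a < r"
      then have "V (y + a) \<le> ereal (v y + \<eta>)" using rV[of y "y + a"] y by simp
      then show "e2ennreal (V (y + a)) \<le> ennreal (v y + \<eta>)" using e2ennreal_mono by fastforce
    qed
    also have "\<dots> = ennreal (v y + \<eta>)" by (simp add: D.emeasure_space_1)
    finally show "(\<integral>\<^sup>+a. e2ennreal (V (y + a)) \<partial>unif_disc r) \<le> ennreal (v y + \<eta>)" .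
  qed
  also have "\<dots> = ennreal (\<integral>y. v y + \<eta> \<partial>\<mu>V)"
    using integrable_v v_nonneg \<eta> by (intro nn_integral_eq_integral) (auto simp: add_nonneg_nonneg)
  also have "\<dots> = ennreal (vbar + \<eta>)" using integrable_v by (simp add: vbar_def \<mu>V.prob_space)
  finally have e4: "(\<integral>\<^sup>+z. e2ennreal (V z) \<partial>\<phi>) \<le> ennreal (vbar + \<eta>)" .
  show ?thesis
    by (rule that[OF p\<phi> _ le Q(2) e3(2) e1 e2 _ e4]) (use D e3 in auto)
qed

end

subsection \<open>The normalising constant\<close>

text \<open>Induction over the coordinates; each one is traded for Lebesgue measure at the cost of a
  factor \<open>b\<close>.\<close>

lemma nn_integral_PiM_le:
  fixes \<phi> :: "complex measure"
  assumes \<phi>: "prob_space \<phi>" and [measurable_cong]: "sets \<phi> = sets borel"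
    and le: "\<And>f. f \<in> borel_measurable borel \<Longrightarrow> (\<integral>\<^sup>+z. f z \<partial>\<phi>) \<le> b * (\<integral>\<^sup>+z. f z \<partial>lborel)"
    and I: "finite I" and f: "f \<in> borel_measurable (\<Pi>\<^sub>M i\<in>I. borel)"
  shows "(\<integral>\<^sup>+z. f z \<partial>(\<Pi>\<^sub>M i\<in>I. \<phi>)) \<le> b ^ card I * (\<integral>\<^sup>+z. f z \<partial>(\<Pi>\<^sub>M i\<in>I. lborel))"
  using I f
proof (induction I arbitrary: f rule: finite_induct)
  case empty
  then show ?case by (simp add: PiM_empty)
next
  case (insert i I)
  interpret \<phi>: prob_space \<phi> by fact
  interpret P: product_sigma_finite "\<lambda>_. \<phi>" by (simp add: product_sigma_finite_def \<phi>.sigma_finite_measure_axioms)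
  interpret L: product_sigma_finite "\<lambda>_. lborel :: complex measure" by (simp add: product_sigma_finite_def sigma_finite_lborel)
  have s1: "sets (\<Pi>\<^sub>M i\<in>J. \<phi>) = sets (\<Pi>\<^sub>M i\<in>J. borel)" for J by (rule sets_PiM_cong) (auto simp: assms)
  have s2: "sets (\<Pi>\<^sub>M i\<in>J. lborel) = sets (\<Pi>\<^sub>M i\<in>J. borel)" for J by (rule sets_PiM_cong) auto
  have f1: "f \<in> borel_measurable (\<Pi>\<^sub>M i\<in>insert i I. \<phi>)" "f \<in> borel_measurable (\<Pi>\<^sub>M i\<in>insert i I. lborel)"
    using insert.prems by (simp_all cong: measurable_cong_sets add: measurable_cong_sets[OF s1] measurable_cong_sets[OF s2])
  have upd: "(\<lambda>(x, y). f (x(i := y))) \<in> borel_measurable ((\<Pi>\<^sub>M i\<in>I. borel) \<Otimes>\<^sub>M borel)"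
    using measurable_compose[OF measurable_add_dim insert.prems] by (simp add: case_prod_beta' fun_upd_def)
  have m: "(\<lambda>x. \<integral>\<^sup>+y. f (x(i := y)) \<partial>lborel) \<in> borel_measurable (\<Pi>\<^sub>M i\<in>I. borel)"
    by (rule lborel.borel_measurable_nn_integral) (use upd in \<open>simp cong: measurable_cong_sets\<close>)
  have "(\<integral>\<^sup>+z. f z \<partial>(\<Pi>\<^sub>M i\<in>insert i I. \<phi>)) = (\<integral>\<^sup>+x. \<integral>\<^sup>+y. f (x(i := y)) \<partial>\<phi> \<partial>(\<Pi>\<^sub>M i\<in>I. \<phi>))"
    using insert.hyps f1 by (intro P.product_nn_integral_insert) auto
  also have "\<dots> \<le> (\<integral>\<^sup>+x. b * (\<integral>\<^sup>+y. f (x(i := y)) \<partial>lborel) \<partial>(\<Pi>\<^sub>M i\<in>I. \<phi>))"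
  proof (rule nn_integral_mono, rule le)
    fix x assume "x \<in> space (\<Pi>\<^sub>M i\<in>I. \<phi>)"
    then have "x \<in> space (\<Pi>\<^sub>M i\<in>I. borel)" using sets_eq_imp_space_eq[OF s1] by auto
    from measurable_compose[OF measurable_Pair1'[OF this] upd]
    show "(\<lambda>y. f (x(i := y))) \<in> borel_measurable borel" by simp
  qed
  also have "\<dots> = b * (\<integral>\<^sup>+x. \<integral>\<^sup>+y. f (x(i := y)) \<partial>lborel \<partial>(\<Pi>\<^sub>M i\<in>I. \<phi>))"
    by (rule nn_integral_cmult) (use m in \<open>simp add: measurable_cong_sets[OF s1]\<close>)
  also have "\<dots> \<le> b * (b ^ card I * (\<integral>\<^sup>+x. \<integral>\<^sup>+y. f (x(i := y)) \<partial>lborel \<partial>(\<Pi>\<^sub>M i\<in>I. lborel)))"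
    by (intro mult_left_mono insert.IH m) simp
  also have "(\<integral>\<^sup>+x. \<integral>\<^sup>+y. f (x(i := y)) \<partial>lborel \<partial>(\<Pi>\<^sub>M i\<in>I. lborel)) = (\<integral>\<^sup>+z. f z \<partial>(\<Pi>\<^sub>M i\<in>insert i I. lborel))"
    using insert.hyps f1 by (intro L.product_nn_integral_insert[symmetric]) auto
  finally show ?case using insert.hyps by (simp add: mult.assoc)
qed

lemma nn_integral_PiM_component:
  assumes \<phi>: "prob_space \<phi>" and i: "i \<in> I" and f: "f \<in> borel_measurable \<phi>"
  shows "(\<integral>\<^sup>+z. f (z i) \<partial>(\<Pi>\<^sub>M i\<in>I. \<phi>)) = (\<integral>\<^sup>+x. f x \<partial>\<phi>)"
proof -
  interpret \<phi>: prob_space \<phi> by fact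
  interpret P: product_prob_space "\<lambda>_. \<phi>" I ..
  have "(\<integral>\<^sup>+x. f x \<partial>\<phi>) = (\<integral>\<^sup>+x. f x \<partial>distr (\<Pi>\<^sub>M i\<in>I. \<phi>) \<phi> (\<lambda>z. z i))"
    using P.PiM_component[OF i] by simp
  also have "\<dots> = (\<integral>\<^sup>+z. f (z i) \<partial>(\<Pi>\<^sub>M i\<in>I. \<phi>))"
    by (rule nn_integral_distr) (use i f in auto)
  finally show ?thesis by simp
qed

lemma nn_integral_PiM_pair:
  assumes \<phi>: "prob_space \<phi>" and I: "i \<in> I" "j \<in> I" "i \<noteq> j" "finite I"
    and f: "(\<lambda>(x, y). f x y) \<in> borel_measurable (\<phi> \<Otimes>\<^sub>M \<phi>)"
  shows "(\<integral>\<^sup>+z. f (z i) (z j) \<partial>(\<Pi>\<^sub>M i\<in>I. \<phi>)) = (\<integral>\<^sup>+x. \<integral>\<^sup>+y. f x y \<partial>\<phi> \<partial>\<phi>)"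
proof -
  interpret \<phi>: prob_space \<phi> by fact
  interpret P: product_prob_space "\<lambda>_. \<phi>" I ..
  have m: "(\<lambda>z. f (z i) (z j)) \<in> borel_measurable (\<Pi>\<^sub>M i\<in>{i, j}. \<phi>)"
  proof -
    have "(\<lambda>z. (z i, z j)) \<in> (\<Pi>\<^sub>M i\<in>{i, j}. \<phi>) \<rightarrow>\<^sub>M \<phi> \<Otimes>\<^sub>M \<phi>"
      by (intro measurable_Pair measurable_component_singleton) auto
    from measurable_compose[OF this f] show ?thesis by simp
  qed
  have "(\<integral>\<^sup>+x. \<integral>\<^sup>+y. f x y \<partial>\<phi> \<partial>\<phi>) = (\<integral>\<^sup>+p. f (fst p) (snd p) \<partial>(\<phi> \<Otimes>\<^sub>M \<phi>))"
    using \<phi>.nn_integral_fst[OF f] by (simp add: case_prod_beta')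
  also have "\<dots> = (\<integral>\<^sup>+z. f (z i) (z j) \<partial>(\<Pi>\<^sub>M i\<in>{i, j}. \<phi>))"
    by (rule P.product_nn_integral_pair[symmetric]) (use I f in auto)
  also have "(\<Pi>\<^sub>M i\<in>{i, j}. \<phi>) = distr (\<Pi>\<^sub>M i\<in>I. \<phi>) (\<Pi>\<^sub>M i\<in>{i, j}. \<phi>) (\<lambda>z. restrict z {i, j})"
    by (rule P.distr_restrict) (use I in auto)
  also have "(\<integral>\<^sup>+z. f (z i) (z j) \<partial>distr (\<Pi>\<^sub>M i\<in>I. \<phi>) (\<Pi>\<^sub>M i\<in>{i, j}. \<phi>) (\<lambda>z. restrict z {i, j}))
     = (\<integral>\<^sup>+z. f (restrict z {i, j} i) (restrict z {i, j} j) \<partial>(\<Pi>\<^sub>M i\<in>I. \<phi>))"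
    by (rule nn_integral_distr) (use I m in \<open>auto intro: measurable_restrict_subset\<close>)
  finally show ?thesis by simp
qed

lemma ennreal_add_le: "0 \<le> q \<Longrightarrow> ennreal (p + q) \<le> ennreal p + ennreal q"
proof (cases "0 \<le> p")
  case False
  assume "0 \<le> q"
  then have "ennreal (p + q) \<le> ennreal q" using False by (intro ennreal_leI) auto
  then show ?thesis using False by (simp add: ennreal_neg)
qed simp

lemma ennreal_half_double: "0 \<le> w \<Longrightarrow> ennreal (1 / 2) * (ennreal w + ennreal w) = ennreal w"
proof -
  assume w: "0 \<le> w"
  have "ennreal (1 / 2) * (ennreal w + ennreal w) = ennreal (1 / 2) * ennreal (w + w)"
    by (simp only: ennreal_plus[OF w w])
  also have "\<dots> = ennreal (1 / 2 * (w + w))" by (rule ennreal_mult'[symmetric]) simp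
  finally show ?thesis by simp
qed

lemma e2ennreal_add_le:
  assumes "a \<noteq> -\<infinity>" "b \<noteq> -\<infinity>"
  shows "e2ennreal (a + b) \<le> e2ennreal a + e2ennreal b"
proof (cases a; cases b)
  fix r s assume rs: "a = ereal r" "b = ereal s"
  have "ennreal (r + s) \<le> ennreal r + ennreal s"
  proof (cases "0 \<le> s")
    case False
    then have "ennreal (r + s) \<le> ennreal r" by (intro ennreal_leI) auto
    then show ?thesis using False by (simp add: ennreal_neg)
  qed (rule ennreal_add_le)
  then show ?thesis using rs by simp
qed (use assms in auto)

lemma sum_ereal_not_MInf: "finite A \<Longrightarrow> (\<And>x. x \<in> A \<Longrightarrow> f x \<noteq> -\<infinity>) \<Longrightarrow> sum f A \<noteq> (-\<infinity> :: ereal)"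
  by (induction A rule: finite_induct) (auto simp: ereal_plus_eq_MInfty)

lemma e2ennreal_sum_le:
  assumes "finite A" "\<And>x. x \<in> A \<Longrightarrow> f x \<noteq> -\<infinity>"
  shows "e2ennreal (sum f A) \<le> (\<Sum>x\<in>A. e2ennreal (f x))"
  using assms
proof (induction A rule: finite_induct)
  case (insert x A)
  have "e2ennreal (f x + sum f A) \<le> e2ennreal (f x) + e2ennreal (sum f A)"
    using insert by (intro e2ennreal_add_le sum_ereal_not_MInf) auto
  also have "\<dots> \<le> e2ennreal (f x) + (\<Sum>x\<in>A. e2ennreal (f x))" using insert by (intro add_left_mono) auto
  finally show ?case using insert by simp
qed simp

lemma nn_integral_add_sums:
  fixes f :: "'i \<Rightarrow> 'j \<Rightarrow> 'a \<Rightarrow> ennreal"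
  assumes f: "\<And>i j. i \<in> A \<Longrightarrow> j \<in> B i \<Longrightarrow> f i j \<in> borel_measurable M"
    and g: "\<And>i. i \<in> A \<Longrightarrow> g i \<in> borel_measurable M" and h: "\<And>i. i \<in> A \<Longrightarrow> h i \<in> borel_measurable M"
  shows "(\<integral>\<^sup>+z. (\<Sum>i\<in>A. \<Sum>j\<in>B i. f i j z) + (\<Sum>i\<in>A. g i z) + (\<Sum>i\<in>A. h i z) \<partial>M)
    = (\<Sum>i\<in>A. \<Sum>j\<in>B i. \<integral>\<^sup>+z. f i j z \<partial>M) + (\<Sum>i\<in>A. \<integral>\<^sup>+z. g i z \<partial>M) + (\<Sum>i\<in>A. \<integral>\<^sup>+z. h i z \<partial>M)"
proof -
  have m: "(\<lambda>z. \<Sum>j\<in>B i. f i j z) \<in> borel_measurable M" if "i \<in> A" for i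
    using f that by (intro borel_measurable_sum) auto
  have m': "(\<lambda>z. \<Sum>i\<in>A. \<Sum>j\<in>B i. f i j z) \<in> borel_measurable M" "(\<lambda>z. \<Sum>i\<in>A. g i z) \<in> borel_measurable M"
    "(\<lambda>z. \<Sum>i\<in>A. h i z) \<in> borel_measurable M"
    by (auto intro!: borel_measurable_sum m g h)
  show ?thesis
    using m m' f g h by (simp add: nn_integral_add nn_integral_sum)
qed

text \<open>The tangent line of \<^term>\<open>\<lambda>h::real. exp (- h / 2)\<close> at \<open>a\<close> replaces Jensen's inequality
  and tolerates infinite values of \<open>h\<close>.\<close>

lemma exp_neg_half_tangent:
  assumes h: "h \<noteq> -\<infinity>" and ac: "0 \<le> a + c"
  shows "ennreal (exp (- a / 2) * (1 + (a + c) / 2)) \<le> exp_neg_half h + ennreal (exp (- a / 2) / 2) * e2ennreal (h + ereal c)"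
proof (cases h)
  case (real r)
  have "1 + (a - r) / 2 \<le> exp ((a - r) / 2)" by (rule exp_ge_add_one_self)
  then have "exp (- a / 2) * (1 + (a - r) / 2) \<le> exp (- a / 2) * exp ((a - r) / 2)" by (intro mult_left_mono) auto
  also have "\<dots> = exp (- r / 2)" by (simp add: diff_divide_distrib flip: exp_add)
  finally have t: "exp (- a / 2) * (1 + (a - r) / 2) \<le> exp (- r / 2)" .
  have "exp (- a / 2) * (1 + (a + c) / 2) \<le> exp (- r / 2) + exp (- a / 2) / 2 * max 0 (r + c)"
  proof -
    have "exp (- a / 2) * (1 + (a + c) / 2) = exp (- a / 2) * (1 + (a - r) / 2) + exp (- a / 2) / 2 * (r + c)"
      by (simp add: field_simps)
    also have "exp (- a / 2) / 2 * (r + c) \<le> exp (- a / 2) / 2 * max 0 (r + c)" by (intro mult_left_mono) auto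
    finally show ?thesis using t by linarith
  qed
  then have "ennreal (exp (- a / 2) * (1 + (a + c) / 2)) \<le> ennreal (exp (- r / 2) + exp (- a / 2) / 2 * max 0 (r + c))"
    by (rule ennreal_leI)
  also have "\<dots> = ennreal (exp (- r / 2)) + ennreal (exp (- a / 2) / 2 * max 0 (r + c))" by (rule ennreal_plus) auto
  also have "ennreal (exp (- a / 2) / 2 * max 0 (r + c)) = ennreal (exp (- a / 2) / 2) * ennreal (max 0 (r + c))"
    by (rule ennreal_mult) auto
  also have "ennreal (max 0 (r + c)) = ennreal (r + c)" by (simp add: max_def ennreal_neg)
  finally show ?thesis using real by (simp add: exp_neg_half_def)
next
  case PInf
  then show ?thesis by (simp add: ennreal_mult_top)
qed (use h in auto)

lemma measurable_ext_conj [measurable]: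
  assumes "i < 2 * n"
  shows "(\<lambda>z. ext_conj n z i) \<in> borel_measurable (\<Pi>\<^sub>M i\<in>{..<n}. borel)"
proof (cases "i < n")
  case True
  then show ?thesis unfolding ext_conj_def by simp
next
  case False
  then have "i - n \<in> {..<n}" using assms by auto
  then have "(\<lambda>z. z (i - n)) \<in> borel_measurable (\<Pi>\<^sub>M i\<in>{..<n}. borel)" by measurable
  then show ?thesis using False measurable_compose[OF _ measurable_cnj] unfolding ext_conj_def by simp
qed

context external_field
begin

lemma kern_not_MInf: "kern V x y \<noteq> -\<infinity>"
  using kern_ge_minus_C[of x y] by auto

lemma V_not_MInf: "V x \<noteq> -\<infinity>"
  using V_nonneg[of x] by auto

lemma e2ennreal_kern_le: "e2ennreal (kern V x y + ereal c) \<le> pos_log c x y + ennreal (1 / 2) * (e2ennreal (V x) + e2ennreal (V y))"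
proof (cases "x = y \<or> V x = \<infinity> \<or> V y = \<infinity>")
  case True
  then show ?thesis by (auto simp: ennreal_mult_top)
next
  case False
  then obtain a b where ab: "V x = ereal a" "V y = ereal b" "0 \<le> a" "0 \<le> b" by (metis V_cases)
  have "ennreal (c - ln (cmod (x - y)) + (a + b) / 2) \<le> ennreal (c - ln (cmod (x - y))) + ennreal ((a + b) / 2)"
    using ab by (intro ennreal_add_le) auto
  also have "ennreal ((a + b) / 2) = ennreal (1 / 2) * (ennreal a + ennreal b)"
    using ab ennreal_mult'[of "1 / 2" "a + b"] by (simp add: ennreal_plus del: ennreal_half)
  finally show ?thesis using False ab by (simp add: kern_real pos_log_real algebra_simps del: ennreal_half)
qed

lemma measurable_H_n [measurable]: "H_n V n \<in> borel_measurable (\<Pi>\<^sub>M i\<in>{..<n}. borel)"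
proof -
  have k: "(\<lambda>z. kern V (ext_conj n z i) (ext_conj n z j)) \<in> borel_measurable (\<Pi>\<^sub>M i\<in>{..<n}. borel)"
    if "i < 2 * n" "j < 2 * n" for i j
    using measurable_compose[OF measurable_Pair[OF measurable_ext_conj[OF that(1)] measurable_ext_conj[OF that(2)]] measurable_kern] by simp
  have l: "(\<lambda>z. log_kernel (ext_conj n z i) (cnj (ext_conj n z i))) \<in> borel_measurable (\<Pi>\<^sub>M i\<in>{..<n}. borel)"
    if "i < 2 * n" for i
    using measurable_compose[OF measurable_Pair[OF measurable_ext_conj[OF that] measurable_compose[OF measurable_ext_conj[OF that] measurable_cnj]] measurable_log_kernel] by simp
  have v: "(\<lambda>z. V (ext_conj n z i)) \<in> borel_measurable (\<Pi>\<^sub>M i\<in>{..<n}. borel)" if "i < 2 * n" for i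
    using measurable_compose[OF measurable_ext_conj[OF that] measurable_V] by simp
  show ?thesis
    unfolding H_n_def K_n_def
    by (intro borel_measurable_ereal_add borel_measurable_ereal_sum k l v) auto
qed

lemma H_n_not_MInf: "H_n V n z \<noteq> -\<infinity>"
proof -
  let ?Z = "ext_conj n z"
  have "(\<Sum>i<2*n. \<Sum>j\<in>{..<2*n} - {i}. kern V (?Z i) (?Z j)) \<noteq> -\<infinity>"
    by (intro sum_ereal_not_MInf) (auto simp: kern_not_MInf)
  moreover have "(\<Sum>i<2*n. V (?Z i)) \<noteq> -\<infinity>" by (intro sum_ereal_not_MInf) (auto simp: V_not_MInf)
  moreover have "(\<Sum>i<2*n. log_kernel (?Z i) (cnj (?Z i))) \<noteq> -\<infinity>"
    by (intro sum_ereal_not_MInf) (auto simp: log_kernel_def)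
  ultimately show ?thesis unfolding H_n_def K_n_def by (simp add: ereal_plus_eq_MInfty)
qed

text \<open>The constant \<open>N\<^sup>2 * c\<close> is shared out as one \<open>c\<close> to each
  of the \<open>N * (N - 1)\<close> ordered pairs and one to each of the \<open>N\<close>
  conjugation terms. All summands are then replaced by positive parts, so that their means can be
  bounded one by one in \<open>ennreal\<close>.\<close>

lemma e2ennreal_H_n_le:
  fixes n :: nat
  defines "N \<equiv> 2 * n"
  shows "e2ennreal (H_n V n z + ereal ((real N)\<^sup>2 * c))
    \<le> (\<Sum>i<N. \<Sum>j\<in>{..<N} - {i}. pos_log c (ext_conj n z i) (ext_conj n z j)
          + ennreal (1 / 2) * (e2ennreal (V (ext_conj n z i)) + e2ennreal (V (ext_conj n z j))))
      + (\<Sum>i<N. e2ennreal (V (ext_conj n z i))) + (\<Sum>i<N. pos_log c (ext_conj n z i) (cnj (ext_conj n z i)))"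
proof (cases "n = 0")
  case True
  then show ?thesis by (simp add: N_def H_n_def K_n_def)
next
  case False
  then have N1: "1 \<le> N" by (simp add: N_def)
  let ?Z = "ext_conj n z"
  let ?k = "\<lambda>i j. kern V (?Z i) (?Z j)" and ?l = "\<lambda>i. log_kernel (?Z i) (cnj (?Z i))"
  have c1: "(\<Sum>i<N. \<Sum>j\<in>{..<N} - {i}. ereal c) = ereal (real N * ((real N - 1) * c))"
  proof -
    have "(\<Sum>j\<in>{..<N} - {i}. ereal c) = ereal ((real N - 1) * c)" if "i < N" for i
      using that N1 by (subst sum_ereal) (simp add: of_nat_diff)
    then have "(\<Sum>i<N. \<Sum>j\<in>{..<N} - {i}. ereal c) = (\<Sum>i<N. ereal ((real N - 1) * c))" by (intro sum.cong) auto
    then show ?thesis by (subst (asm) sum_ereal) simp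
  qed
  have c2: "(\<Sum>i<N. ereal c) = ereal (real N * c)" by (subst sum_ereal) simp
  have cc: "ereal ((real N)\<^sup>2 * c) = (\<Sum>i<N. \<Sum>j\<in>{..<N} - {i}. ereal c) + (\<Sum>i<N. ereal c)"
    unfolding c1 c2 by (simp add: power2_eq_square algebra_simps)
  have eq: "H_n V n z + ereal ((real N)\<^sup>2 * c)
     = (\<Sum>i<N. \<Sum>j\<in>{..<N} - {i}. ?k i j + ereal c) + (\<Sum>i<N. V (?Z i)) + (\<Sum>i<N. ?l i + ereal c)"
    unfolding cc H_n_def K_n_def N_def[symmetric] sum.distrib by (simp only: ac_simps)
  have "e2ennreal (H_n V n z + ereal ((real N)\<^sup>2 * c)) \<le> e2ennreal (\<Sum>i<N. \<Sum>j\<in>{..<N} - {i}. ?k i j + ereal c) + e2ennreal (\<Sum>i<N. V (?Z i)) + e2ennreal (\<Sum>i<N. ?l i + ereal c)"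
  proof -
    have n1: "(\<Sum>i<N. \<Sum>j\<in>{..<N} - {i}. ?k i j + ereal c) \<noteq> -\<infinity>"
      by (intro sum_ereal_not_MInf) (auto simp: kern_not_MInf)
    have n2: "(\<Sum>i<N. V (?Z i)) \<noteq> -\<infinity>" by (intro sum_ereal_not_MInf) (auto simp: V_not_MInf)
    have n3: "(\<Sum>i<N. ?l i + ereal c) \<noteq> -\<infinity>" by (intro sum_ereal_not_MInf) (auto simp: log_kernel_def)
    have "e2ennreal ((\<Sum>i<N. \<Sum>j\<in>{..<N} - {i}. ?k i j + ereal c) + (\<Sum>i<N. V (?Z i)) + (\<Sum>i<N. ?l i + ereal c))
      \<le> e2ennreal ((\<Sum>i<N. \<Sum>j\<in>{..<N} - {i}. ?k i j + ereal c) + (\<Sum>i<N. V (?Z i))) + e2ennreal (\<Sum>i<N. ?l i + ereal c)"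
      by (rule e2ennreal_add_le) (use n1 n2 n3 in \<open>auto simp: ereal_plus_eq_MInfty\<close>)
    also have "\<dots> \<le> e2ennreal (\<Sum>i<N. \<Sum>j\<in>{..<N} - {i}. ?k i j + ereal c) + e2ennreal (\<Sum>i<N. V (?Z i)) + e2ennreal (\<Sum>i<N. ?l i + ereal c)"
      by (rule add_right_mono, rule e2ennreal_add_le[OF n1 n2])
    finally show ?thesis unfolding eq .
  qed
  also have "\<dots> \<le> (\<Sum>i<N. \<Sum>j\<in>{..<N} - {i}. e2ennreal (?k i j + ereal c)) + (\<Sum>i<N. e2ennreal (V (?Z i))) + (\<Sum>i<N. e2ennreal (?l i + ereal c))"
  proof (intro add_mono)
    have "e2ennreal (\<Sum>i<N. \<Sum>j\<in>{..<N} - {i}. ?k i j + ereal c) \<le> (\<Sum>i<N. e2ennreal (\<Sum>j\<in>{..<N} - {i}. ?k i j + ereal c))"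
      by (rule e2ennreal_sum_le, simp, rule sum_ereal_not_MInf) (auto simp: kern_not_MInf)
    also have "\<dots> \<le> (\<Sum>i<N. \<Sum>j\<in>{..<N} - {i}. e2ennreal (?k i j + ereal c))"
      by (intro sum_mono e2ennreal_sum_le) (auto simp: kern_not_MInf)
    finally show "e2ennreal (\<Sum>i<N. \<Sum>j\<in>{..<N} - {i}. ?k i j + ereal c) \<le> (\<Sum>i<N. \<Sum>j\<in>{..<N} - {i}. e2ennreal (?k i j + ereal c))" .
    show "e2ennreal (\<Sum>i<N. V (?Z i)) \<le> (\<Sum>i<N. e2ennreal (V (?Z i)))"
      by (rule e2ennreal_sum_le) (auto simp: V_not_MInf)
    show "e2ennreal (\<Sum>i<N. ?l i + ereal c) \<le> (\<Sum>i<N. e2ennreal (?l i + ereal c))"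
      by (rule e2ennreal_sum_le) (auto simp: log_kernel_def)
  qed
  also have "\<dots> \<le> (\<Sum>i<N. \<Sum>j\<in>{..<N} - {i}. pos_log c (?Z i) (?Z j) + ennreal (1 / 2) * (e2ennreal (V (?Z i)) + e2ennreal (V (?Z j))))
      + (\<Sum>i<N. e2ennreal (V (?Z i))) + (\<Sum>i<N. pos_log c (?Z i) (cnj (?Z i)))"
    by (intro add_mono sum_mono e2ennreal_kern_le order_refl) (simp add: pos_log_def)
  finally show ?thesis .
qed

end

locale equilibrium_conj = equilibrium +
  assumes V_conj: "\<And>z. V (cnj z) = V z"
begin

text \<open>The coordinates are sampled independently from the trial measure, under which
  \<open>H_n\<close> has mean at most \<open>a\<close>. The tangent at \<open>a\<close> bounds the
  mean of \<open>exp_neg_half (H_n V n z)\<close> below by \<open>exp (- a / 2)\<close>, and the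
  density bound \<open>B\<close> turns the product law into Lebesgue measure at the cost of
  \<open>B ^ n\<close>, a factor exponential in \<open>n\<close>.\<close>

lemma norm_const_lower_bound:
  assumes \<eta>: "0 < \<eta>"
  obtains k where "\<And>n. 1 \<le> n \<Longrightarrow> ennreal (exp (- (2 * real n)\<^sup>2 * (m + \<eta>) / 2 - k * real n)) \<le> norm_const V n"
proof -
  obtain \<phi> B c c1 where p\<phi>: "prob_on_C \<phi>" and B: "0 < B"
    and le: "\<And>f. f \<in> borel_measurable borel \<Longrightarrow> (\<integral>\<^sup>+z. f z \<partial>\<phi>) \<le> ennreal B * (\<integral>\<^sup>+z. f z \<partial>lborel)"
    and q0: "0 \<le> m - vbar + c" and c1: "0 \<le> c1"
    and e1: "(\<integral>\<^sup>+x. \<integral>\<^sup>+y. pos_log c x y \<partial>\<phi> \<partial>\<phi>) \<le> ennreal (m - vbar + c)"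
    and e2: "(\<integral>\<^sup>+x. \<integral>\<^sup>+y. pos_log c x (cnj y) \<partial>\<phi> \<partial>\<phi>) \<le> ennreal (m - vbar + c)"
    and e3: "(\<integral>\<^sup>+z. pos_log c z (cnj z) \<partial>\<phi>) \<le> ennreal c1"
    and e4: "(\<integral>\<^sup>+z. e2ennreal (V z) \<partial>\<phi>) \<le> ennreal (vbar + \<eta>)"
    by (rule smeared_equilibrium_exists[OF \<eta>], rule that, assumption+)
  have \<phi>: "prob_space \<phi>" and sets [measurable_cong]: "sets \<phi> = sets borel" using p\<phi> by (auto simp: prob_on_C_def)
  interpret \<phi>: prob_space \<phi> by fact
  define q where "q = m - vbar + c"
  define w where "w = vbar + \<eta>"
  have vbar0: "0 \<le> vbar" unfolding vbar_def using v_nonneg by (intro Bochner_Integration.integral_nonneg) auto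
  have qw: "0 \<le> q" "0 \<le> w" using q0 vbar0 \<eta> by (auto simp: q_def w_def)
  show ?thesis
  proof (rule that)
    fix n :: nat assume n: "1 \<le> n"
    define N where "N = 2 * n"
    have N: "2 \<le> N" "real N = 2 * real n" using n by (auto simp: N_def)
    define \<Phi> where "\<Phi> = (\<Pi>\<^sub>M i\<in>{..<n}. \<phi>)"
    have s\<Phi> [measurable_cong]: "sets \<Phi> = sets (\<Pi>\<^sub>M i\<in>{..<n}. borel)"
      unfolding \<Phi>_def by (rule sets_PiM_cong) (auto simp: sets)
    interpret PP: product_prob_space "\<lambda>_. \<phi>" "{..<n}" ..
    interpret \<Phi>: prob_space \<Phi> unfolding \<Phi>_def by (rule prob_space_PiM) (rule \<phi>)
    let ?Z = "ext_conj n"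
    have Zm: "(\<lambda>z. ?Z z i) \<in> borel_measurable \<Phi>" if "i < N" for i
      using measurable_ext_conj[of i n] that by (simp add: N_def measurable_cong_sets[OF s\<Phi>])
    have plm: "(\<lambda>z. pos_log c (?Z z i) (?Z z j)) \<in> borel_measurable \<Phi>" "(\<lambda>z. pos_log c (?Z z i) (cnj (?Z z i))) \<in> borel_measurable \<Phi>"
      "(\<lambda>z. e2ennreal (V (?Z z i))) \<in> borel_measurable \<Phi>"
      if "i < N" "j < N" for i j
    proof -
      note Zi = Zm[OF that(1)] and Zj = Zm[OF that(2)]
      show "(\<lambda>z. pos_log c (?Z z i) (?Z z j)) \<in> borel_measurable \<Phi>"
        by (rule measurable_pos_log_compose[OF Zi Zj])
      show "(\<lambda>z. pos_log c (?Z z i) (cnj (?Z z i))) \<in> borel_measurable \<Phi>"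
        by (rule measurable_pos_log_compose[OF Zi measurable_compose[OF Zi measurable_cnj]])
      have "(\<lambda>x. e2ennreal (V x)) \<in> borel_measurable borel" by measurable
      then show "(\<lambda>z. e2ennreal (V (?Z z i))) \<in> borel_measurable \<Phi>" by (rule measurable_compose[OF Zi])
    qed
    have one: "(\<integral>\<^sup>+z. f (z i) \<partial>\<Phi>) = (\<integral>\<^sup>+x. f x \<partial>\<phi>)" if "i < n" "f \<in> borel_measurable borel" for f i
      unfolding \<Phi>_def using that by (intro nn_integral_PiM_component[OF \<phi>]) (auto simp: measurable_cong_sets[OF sets])
    have two: "(\<integral>\<^sup>+z. f (z i) (z j) \<partial>\<Phi>) = (\<integral>\<^sup>+x. \<integral>\<^sup>+y. f x y \<partial>\<phi> \<partial>\<phi>)"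
      if "i < n" "j < n" "i \<noteq> j" "(\<lambda>(x, y). f x y) \<in> borel_measurable (borel \<Otimes>\<^sub>M borel)" for f i j
      unfolding \<Phi>_def using that sets by (intro nn_integral_PiM_pair[OF \<phi>]) (auto simp: measurable_cong_sets[OF sets_pair_measure_cong[OF sets sets]])
    \<comment> \<open>Every index of the extended configuration reduces to one of the
      \<open>n\<close> sampled coordinates, since conjugation does not change
      \<open>V\<close>.\<close>
    have V1: "(\<integral>\<^sup>+z. e2ennreal (V (?Z z i)) \<partial>\<Phi>) \<le> ennreal w" if i: "i < N" for i
    proof -
      obtain i' where i': "i' < n" "\<And>z. V (?Z z i) = V (z i')"
        using i by (cases "i < n") (auto simp: ext_conj_def V_conj N_def intro: that[of i] that[of "i - n"])
      show ?thesis unfolding i'(2) w_def using one[OF i'(1), of "\<lambda>x. e2ennreal (V x)"] e4 by simp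
    qed
    have L1: "(\<integral>\<^sup>+z. pos_log c (?Z z i) (cnj (?Z z i)) \<partial>\<Phi>) \<le> ennreal c1" if i: "i < N" for i
    proof -
      obtain i' where i': "i' < n" "\<And>z. pos_log c (?Z z i) (cnj (?Z z i)) = pos_log c (z i') (cnj (z i'))"
        using i by (cases "i < n") (auto simp: ext_conj_def N_def pos_log_commute intro: that[of i] that[of "i - n"])
      show ?thesis unfolding i'(2) using one[OF i'(1), of "\<lambda>x. pos_log c x (cnj x)"] e3 by simp
    qed
    \<comment> \<open>The index of the conjugate of point \<open>i\<close>. These two points are
      dependent, so their interaction is bounded by \<open>c1\<close> instead of \<open>q\<close>;
      one partner per index makes the excess linear in \<open>N\<close>.\<close>
    define p where "p i = (if i < n then i + n else i - n)" for i
    have pN: "p i < N" "p i \<noteq> i" if "i < N" for i using that n by (auto simp: p_def N_def)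
    have L2: "(\<integral>\<^sup>+z. pos_log c (?Z z i) (?Z z j) \<partial>\<Phi>) \<le> ennreal (q + (if j = p i then c1 else 0))"
      if ij: "i < N" "j < N" "j \<noteq> i" for i j
    proof (cases "j = p i")
      case True
      have "pos_log c (?Z z i) (?Z z j) = pos_log c (?Z z i) (cnj (?Z z i))" for z
        using True ij by (cases "i < n") (auto simp: p_def ext_conj_def N_def)
      then have "(\<integral>\<^sup>+z. pos_log c (?Z z i) (?Z z j) \<partial>\<Phi>) \<le> ennreal c1" using L1[OF ij(1)] by simp
      also have "\<dots> \<le> ennreal (q + (if j = p i then c1 else 0))" using True qw by (intro ennreal_leI) auto
      finally show ?thesis .
    next
      case False
      have mc: "(\<lambda>(x, y). pos_log c x (cnj y)) \<in> borel_measurable (borel \<Otimes>\<^sub>M borel)" by measurable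
      \<comment> \<open>If both points or neither are conjugated, this is the self-interaction of
        \<phi>; if exactly one is, it is the interaction of \<phi> with its conjugate.\<close>
      have "(\<integral>\<^sup>+z. pos_log c (?Z z i) (?Z z j) \<partial>\<Phi>) \<le> ennreal q"
      proof (cases "i < n"; cases "j < n")
        assume "i < n" "j < n"
        then show ?thesis using two[of i j "pos_log c"] e1 ij by (simp add: ext_conj_def q_def)
      next
        assume *: "i < n" "\<not> j < n"
        then have "j - n < n" "i \<noteq> j - n" using False ij by (auto simp: p_def N_def)
        then show ?thesis using two[of i "j - n" "\<lambda>x y. pos_log c x (cnj y)", OF _ _ _ mc] e2 * by (simp add: ext_conj_def q_def)
      next
        assume *: "\<not> i < n" "j < n"
        then have "i - n < n" "j \<noteq> i - n" using False ij by (auto simp: p_def N_def)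
        then show ?thesis using two[of j "i - n" "\<lambda>x y. pos_log c x (cnj y)", OF _ _ _ mc] e2 * by (simp add: ext_conj_def q_def pos_log_commute[of c "cnj _"])
      next
        assume *: "\<not> i < n" "\<not> j < n"
        then have "i - n < n" "j - n < n" "i - n \<noteq> j - n" using ij by (auto simp: N_def)
        then show ?thesis using two[of "i - n" "j - n" "pos_log c"] e1 * by (simp add: ext_conj_def q_def pos_log_cnj)
      qed
      then show ?thesis using False by simp
    qed
    have inner: "(\<integral>\<^sup>+z. pos_log c (?Z z i) (?Z z j) + ennreal (1 / 2) * (e2ennreal (V (?Z z i)) + e2ennreal (V (?Z z j))) \<partial>\<Phi>)
        \<le> ennreal (q + w + (if j = p i then c1 else 0))" if ij: "i < N" "j < N" "j \<noteq> i" for i j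
    proof -
      have "(\<integral>\<^sup>+z. pos_log c (?Z z i) (?Z z j) + ennreal (1 / 2) * (e2ennreal (V (?Z z i)) + e2ennreal (V (?Z z j))) \<partial>\<Phi>)
        = (\<integral>\<^sup>+z. pos_log c (?Z z i) (?Z z j) \<partial>\<Phi>)
          + ennreal (1 / 2) * ((\<integral>\<^sup>+z. e2ennreal (V (?Z z i)) \<partial>\<Phi>) + (\<integral>\<^sup>+z. e2ennreal (V (?Z z j)) \<partial>\<Phi>))"
        using plm ij by (simp add: nn_integral_add nn_integral_cmult del: ennreal_half)
      also have "\<dots> \<le> ennreal (q + (if j = p i then c1 else 0)) + ennreal (1 / 2) * (ennreal w + ennreal w)"
        using ij by (intro add_mono mult_left_mono L2 V1) auto
      also have "ennreal (1 / 2) * (ennreal w + ennreal w) = ennreal w"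
        by (rule ennreal_half_double[OF qw(2)])
      also have "ennreal (q + (if j = p i then c1 else 0)) + ennreal w = ennreal (q + w + (if j = p i then c1 else 0))"
        using qw c1 by (subst ennreal_plus[symmetric]) (auto simp: algebra_simps)
      finally show ?thesis .
    qed
    \<comment> \<open>Collects \<open>N * (N - 1)\<close> pairs at \<open>q + w\<close>,
      \<open>N\<close> field terms at \<open>w\<close>, and \<open>c1\<close> once per ordered
      partner pair and once per conjugation term, rounded up by \<open>N * q\<close>.\<close>
    define A where "A = (real N)\<^sup>2 * (q + w) + 2 * real N * c1"
    have sumj: "(\<Sum>j\<in>{..<N} - {i}. q + w + (if j = p i then c1 else 0)) = (real N - 1) * (q + w) + c1" if i: "i < N" for i
    proof -
      have "(\<Sum>j\<in>{..<N} - {i}. q + w + (if j = p i then c1 else 0)) = (\<Sum>j\<in>{..<N} - {i}. q + w) + c1"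
        using pN[OF i] by (simp add: sum.distrib)
      then show ?thesis using i by (simp add: of_nat_diff)
    qed
    have "(\<integral>\<^sup>+z. e2ennreal (H_n V n z + ereal ((real N)\<^sup>2 * c)) \<partial>\<Phi>)
      \<le> (\<integral>\<^sup>+z. (\<Sum>i<N. \<Sum>j\<in>{..<N} - {i}. pos_log c (?Z z i) (?Z z j)
          + ennreal (1 / 2) * (e2ennreal (V (?Z z i)) + e2ennreal (V (?Z z j))))
      + (\<Sum>i<N. e2ennreal (V (?Z z i))) + (\<Sum>i<N. pos_log c (?Z z i) (cnj (?Z z i))) \<partial>\<Phi>)"
      unfolding N_def by (intro nn_integral_mono e2ennreal_H_n_le)
    also have "\<dots> = (\<Sum>i<N. \<Sum>j\<in>{..<N} - {i}. \<integral>\<^sup>+z. pos_log c (?Z z i) (?Z z j)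
          + ennreal (1 / 2) * (e2ennreal (V (?Z z i)) + e2ennreal (V (?Z z j))) \<partial>\<Phi>)
      + (\<Sum>i<N. \<integral>\<^sup>+z. e2ennreal (V (?Z z i)) \<partial>\<Phi>) + (\<Sum>i<N. \<integral>\<^sup>+z. pos_log c (?Z z i) (cnj (?Z z i)) \<partial>\<Phi>)"
    proof -
      have m0: "(\<lambda>z. pos_log c (?Z z i) (?Z z j) + ennreal (1 / 2) * (e2ennreal (V (?Z z i)) + e2ennreal (V (?Z z j)))) \<in> borel_measurable \<Phi>"
        if "i < N" "j < N" for i j
        using plm that by (intro borel_measurable_add borel_measurable_times_ennreal borel_measurable_const) auto
      show ?thesis by (rule nn_integral_add_sums) (use m0 plm in auto)
    qed
    also have "\<dots> \<le> (\<Sum>i<N. \<Sum>j\<in>{..<N} - {i}. ennreal (q + w + (if j = p i then c1 else 0))) + (\<Sum>i<N. ennreal w) + (\<Sum>i<N. ennreal c1)"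
      by (intro add_mono sum_mono inner V1 L1) auto
    also have "\<dots> = ennreal ((\<Sum>i<N. \<Sum>j\<in>{..<N} - {i}. q + w + (if j = p i then c1 else 0)) + (\<Sum>i<N. w) + (\<Sum>i<N. c1))"
    proof -
      define t where "t i j = q + w + (if j = p i then c1 else 0)" for i j
      have t: "0 \<le> t i j" for i j using qw c1 by (simp add: t_def)
      have "(\<Sum>i<N. \<Sum>j\<in>{..<N} - {i}. ennreal (t i j)) + (\<Sum>i<N. ennreal w) + (\<Sum>i<N. ennreal c1)
        = ennreal (\<Sum>i<N. \<Sum>j\<in>{..<N} - {i}. t i j) + ennreal (\<Sum>i<N. w) + ennreal (\<Sum>i<N. c1)"
        using qw c1 t by (simp add: sum_ennreal sum_nonneg del: sum_constant)
      also have "\<dots> = ennreal ((\<Sum>i<N. \<Sum>j\<in>{..<N} - {i}. t i j) + (\<Sum>i<N. w) + (\<Sum>i<N. c1))"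
        using qw c1 t by (simp add: ennreal_plus sum_nonneg add_nonneg_nonneg)
      finally show ?thesis unfolding t_def .
    qed
    also have "(\<Sum>i<N. \<Sum>j\<in>{..<N} - {i}. q + w + (if j = p i then c1 else 0)) = real N * ((real N - 1) * (q + w) + c1)"
      using sumj by simp
    also have "real N * ((real N - 1) * (q + w) + c1) + (\<Sum>i<N. w) + (\<Sum>i<N. c1) = (real N)\<^sup>2 * (q + w) + 2 * real N * c1 - real N * q"
      by (simp add: power2_eq_square algebra_simps)
    also have "ennreal \<dots> \<le> ennreal A" using qw by (intro ennreal_leI) (simp add: A_def)
    finally have HA: "(\<integral>\<^sup>+z. e2ennreal (H_n V n z + ereal ((real N)\<^sup>2 * c)) \<partial>\<Phi>) \<le> ennreal A" .
    have A0: "0 \<le> A" using qw c1 by (simp add: A_def)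
    \<comment> \<open>Undoing the shift removes \<open>c\<close>, since
      \<open>q + w - c = m + \<eta>\<close>.\<close>
    define a where "a = A - (real N)\<^sup>2 * c"
    have Hm: "H_n V n \<in> borel_measurable \<Phi>" using measurable_H_n[of n] by (simp add: measurable_cong_sets[OF s\<Phi>])
    have em: "exp_neg_half \<in> borel_measurable borel" unfolding exp_neg_half_def[abs_def] by measurable
    define X where "X = (\<integral>\<^sup>+z. exp_neg_half (H_n V n z) \<partial>\<Phi>)"
    have "ennreal (exp (- a / 2) * (1 + A / 2)) = (\<integral>\<^sup>+z. ennreal (exp (- a / 2) * (1 + (a + (real N)\<^sup>2 * c) / 2)) \<partial>\<Phi>)"
      by (simp add: \<Phi>.emeasure_space_1 a_def)
    also have "\<dots> \<le> (\<integral>\<^sup>+z. exp_neg_half (H_n V n z) + ennreal (exp (- a / 2) / 2) * e2ennreal (H_n V n z + ereal ((real N)\<^sup>2 * c)) \<partial>\<Phi>)"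
      by (intro nn_integral_mono exp_neg_half_tangent H_n_not_MInf) (use A0 in \<open>simp add: a_def\<close>)
    also have "\<dots> = X + ennreal (exp (- a / 2) / 2) * (\<integral>\<^sup>+z. e2ennreal (H_n V n z + ereal ((real N)\<^sup>2 * c)) \<partial>\<Phi>)"
      unfolding X_def using measurable_compose[OF Hm em] Hm by (subst nn_integral_add) (auto intro!: nn_integral_cmult)
    also have "\<dots> \<le> X + ennreal (exp (- a / 2) / 2) * ennreal A" by (intro add_left_mono mult_left_mono HA) simp
    also have "ennreal (exp (- a / 2) / 2) * ennreal A = ennreal (exp (- a / 2) * A / 2)" using A0 by (simp add: ennreal_mult[symmetric])
    finally have "ennreal (exp (- a / 2) + exp (- a / 2) * A / 2) \<le> X + ennreal (exp (- a / 2) * A / 2)"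
      by (simp add: algebra_simps)
    then have "ennreal (exp (- a / 2)) + ennreal (exp (- a / 2) * A / 2) \<le> X + ennreal (exp (- a / 2) * A / 2)"
      using A0 by (simp add: ennreal_plus)
    \<comment> \<open>The mean term of the tangent inequality is finite and cancels, which leaves
      the value at the point of tangency.\<close>
    then have Xge: "ennreal (exp (- a / 2)) \<le> X"
      by (simp add: ennreal_add_left_cancel_le add.commute)
    have "X \<le> ennreal B ^ card {..<n} * (\<integral>\<^sup>+z. exp_neg_half (H_n V n z) \<partial>(\<Pi>\<^sub>M i\<in>{..<n}. lborel))"
      unfolding X_def \<Phi>_def
      by (rule nn_integral_PiM_le[OF \<phi> sets le]) (auto intro: measurable_compose[OF measurable_H_n em])
    then have Xle: "X \<le> ennreal (B ^ n) * norm_const V n"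
      using B by (simp add: norm_const_def lebesgue_Cn_def ennreal_power)
    have "ennreal (1 / B ^ n) * ennreal (exp (- a / 2)) \<le> ennreal (1 / B ^ n) * (ennreal (B ^ n) * norm_const V n)"
      using Xge Xle by (intro mult_left_mono) auto
    also have "\<dots> = norm_const V n" using B by (simp add: mult.assoc[symmetric] ennreal_mult[symmetric])
    also have "ennreal (1 / B ^ n) * ennreal (exp (- a / 2)) = ennreal (exp (- (2 * real n)\<^sup>2 * (m + \<eta>) / 2 - (ln B + 2 * c1) * real n))"
    proof -
      have "1 / B ^ n = exp (- (ln B * real n))"
        using B by (simp add: exp_minus inverse_eq_divide exp_of_nat_mult mult.commute[of "ln B"])
      moreover have "- a / 2 = - (2 * real n)\<^sup>2 * (m + \<eta>) / 2 - 2 * c1 * real n"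
        unfolding a_def A_def N(2) q_def w_def by (simp add: field_simps)
      ultimately have "1 / B ^ n * exp (- a / 2) = exp (- (2 * real n)\<^sup>2 * (m + \<eta>) / 2 - (ln B + 2 * c1) * real n)"
        by (simp add: algebra_simps flip: exp_add)
      then show ?thesis using B by (subst ennreal_mult[symmetric]) auto
    qed
    finally show "ennreal (exp (- (2 * real n)\<^sup>2 * (m + \<eta>) / 2 - (ln B + 2 * c1) * real n)) \<le> norm_const V n" .
  qed
qed

end

subsection \<open>Tail estimate\<close>

lemma sum_ext_conj:
  fixes f :: "complex \<Rightarrow> 'b::comm_monoid_add"
  shows "(\<Sum>i<2*n. f (ext_conj n z i)) = (\<Sum>i<n. f (z i)) + (\<Sum>i<n. f (cnj (z i)))"
proof -
  have "{..<2*n} = {..<n} \<union> (\<lambda>i. i + n) ` {..<n}"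
  proof (intro equalityI subsetI)
    fix i assume "i \<in> {..<2*n}"
    then show "i \<in> {..<n} \<union> (\<lambda>i. i + n) ` {..<n}"
      by (cases "i < n") (auto intro!: image_eqI[of _ _ "i - n"])
  qed auto
  then have "(\<Sum>i<2*n. f (ext_conj n z i)) = (\<Sum>i<n. f (ext_conj n z i)) + (\<Sum>i\<in>(\<lambda>i. i + n) ` {..<n}. f (ext_conj n z i))"
    by (simp only:) (rule sum.union_disjoint, auto)
  also have "(\<Sum>i\<in>(\<lambda>i. i + n) ` {..<n}. f (ext_conj n z i)) = (\<Sum>i<n. f (ext_conj n z (i + n)))"
    by (subst sum.reindex) (auto simp: inj_on_def)
  finally show ?thesis by (simp add: ext_conj_def)
qed

lemma nn_integral_inverse_1_plus_square_finite:
  "(\<integral>\<^sup>+x. ennreal (inverse (1 + x\<^sup>2)) \<partial>lborel) < \<infinity>"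
proof -
  have "integrable lborel (\<lambda>x::real. inverse (1 + x\<^sup>2))"
    using integrable_inverse_1_plus_square by (simp add: set_integrable_def)
  then have "(\<integral>\<^sup>+x. ennreal (norm (inverse (1 + x\<^sup>2 :: real))) \<partial>lborel) < \<infinity>"
    by (simp add: integrable_iff_bounded)
  moreover have nrm: "norm (inverse (1 + x\<^sup>2)) = inverse (1 + x\<^sup>2)" for x :: real
    by (rule real_norm_def[THEN trans]) (simp add: add_nonneg_nonneg)
  ultimately show ?thesis unfolding nrm by blast
qed

text \<open>Up to a constant a product of two Cauchy densities is a majorant, because
  \<open>(1 + x\<^sup>2) * (1 + y\<^sup>2)\<close> is at most the square of
  \<open>1 + (x\<^sup>2 + y\<^sup>2)\<close>.\<close>

lemma nn_integral_inverse_square_finite: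
  "(\<integral>\<^sup>+z. ennreal (exp (- 2 * log1p_sq z)) \<partial>lborel) < \<infinity>"
proof -
  have "(\<integral>\<^sup>+z. ennreal (exp (- 2 * log1p_sq z)) \<partial>lborel) = (\<integral>\<^sup>+x. \<integral>\<^sup>+y. ennreal (exp (- 2 * log1p_sq (Complex x y))) \<partial>lborel \<partial>lborel)"
    by (rule nn_integral_lborel_complex) measurable
  also have "\<dots> \<le> (\<integral>\<^sup>+x. \<integral>\<^sup>+y. ennreal (inverse (1 + x\<^sup>2)) * ennreal (inverse (1 + y\<^sup>2)) \<partial>lborel \<partial>lborel)"
  proof (intro nn_integral_mono)
    fix x y :: real
    have p: "0 < 1 + x\<^sup>2" "0 < 1 + y\<^sup>2" "0 < 1 + (x\<^sup>2 + y\<^sup>2)" by (auto simp: add_pos_nonneg)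
    have "exp (- 2 * log1p_sq (Complex x y)) = inverse (exp (log1p_sq (Complex x y)) * exp (log1p_sq (Complex x y)))"
      by (simp add: exp_minus flip: exp_add)
    also have "exp (log1p_sq (Complex x y)) = 1 + (x\<^sup>2 + y\<^sup>2)" using p by (simp add: log1p_sq_def cmod_def)
    also have "inverse ((1 + (x\<^sup>2 + y\<^sup>2)) * (1 + (x\<^sup>2 + y\<^sup>2))) \<le> inverse ((1 + x\<^sup>2) * (1 + y\<^sup>2))"
      using p by (intro le_imp_inverse_le mult_mono) auto
    finally have "exp (- 2 * log1p_sq (Complex x y)) \<le> inverse (1 + x\<^sup>2) * inverse (1 + y\<^sup>2)"
      by simp
    then have "ennreal (exp (- 2 * log1p_sq (Complex x y))) \<le> ennreal (inverse (1 + x\<^sup>2) * inverse (1 + y\<^sup>2))"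
      by (rule ennreal_leI)
    also have "\<dots> = ennreal (inverse (1 + x\<^sup>2)) * ennreal (inverse (1 + y\<^sup>2))"
      using p by (intro ennreal_mult) auto
    finally show "ennreal (exp (- 2 * log1p_sq (Complex x y))) \<le> ennreal (inverse (1 + x\<^sup>2)) * ennreal (inverse (1 + y\<^sup>2))" .
  qed
  also have "\<dots> = (\<integral>\<^sup>+x. ennreal (inverse (1 + x\<^sup>2)) \<partial>lborel) * (\<integral>\<^sup>+y. ennreal (inverse (1 + y\<^sup>2)) \<partial>lborel)"
    by (simp add: nn_integral_cmult nn_integral_multc)
  also have "\<dots> < \<infinity>" using nn_integral_inverse_1_plus_square_finite by (simp add: ennreal_mult_less_top)
  finally show ?thesis .
qed

lemma cmod_diff_cnj_le: "cmod (z - cnj z) \<le> exp (log1p_sq z)"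
proof -
  have "0 < 1 + (cmod z)\<^sup>2" by (simp add: add_pos_nonneg)
  then have "exp (log1p_sq z) = 1 + (cmod z)\<^sup>2" by (simp add: log1p_sq_def)
  moreover have "cmod (z - cnj z) \<le> 2 * cmod z" using norm_triangle_ineq4[of z "cnj z"] by simp
  moreover have "2 * cmod z \<le> 1 + (cmod z)\<^sup>2" using zero_le_power2[of "cmod z - 1"] by (simp add: power2_diff)
  ultimately show ?thesis by linarith
qed

section \<open>Coercivity of the energy of a configuration\<close>

context external_field
begin

text \<open>\<open>H_n\<close> without its conjugation terms. The energy form sees only this part;
  the removed terms enter the density as one factor \<open>cmod (z i - cnj (z i))\<close> per
  point.\<close>

definition energy_sum :: "nat \<Rightarrow> (nat \<Rightarrow> complex) \<Rightarrow> ereal" where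
  "energy_sum n z = K_n V n z + (\<Sum>i<2*n. V (ext_conj n z i))"

lemma measurable_energy_sum [measurable]: "energy_sum n \<in> borel_measurable (\<Pi>\<^sub>M i\<in>{..<n}. borel)"
proof -
  have k: "(\<lambda>z. kern V (ext_conj n z i) (ext_conj n z j)) \<in> borel_measurable (\<Pi>\<^sub>M i\<in>{..<n}. borel)"
    if "i < 2 * n" "j < 2 * n" for i j
    using measurable_compose[OF measurable_Pair[OF measurable_ext_conj[OF that(1)] measurable_ext_conj[OF that(2)]] measurable_kern] by simp
  have v: "(\<lambda>z. V (ext_conj n z i)) \<in> borel_measurable (\<Pi>\<^sub>M i\<in>{..<n}. borel)" if "i < 2 * n" for i
    using measurable_compose[OF measurable_ext_conj[OF that] measurable_V] by simp
  show ?thesis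
    unfolding energy_sum_def K_n_def
    by (intro borel_measurable_ereal_add borel_measurable_ereal_sum k v) auto
qed

text \<open>With \<open>N = 2 * n\<close>, a point occurs in \<open>2 * (N - 1)\<close> ordered
  pairs with weight \<open>\<delta> / 2\<close> and once in the field sum with weight
  \<open>1 + \<delta>\<close>, together \<open>N * \<delta> + 1\<close>; the constants add up to
  \<open>N * (N - 1) * C + N * C\<close>. Conjugation counts every \<open>log1p_sq (z i)\<close>
  twice.\<close>

lemma energy_sum_ge:
  "ereal (2 * (2 * real n) * \<delta> * (\<Sum>i<n. log1p_sq (z i)) - (2 * real n)\<^sup>2 * C) \<le> energy_sum n z"
proof -
  define N where "N = 2 * n"
  define L where "L i = log1p_sq (ext_conj n z i)" for i
  have S: "(\<Sum>i<N. L i) = 2 * (\<Sum>i<n. log1p_sq (z i))"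
    unfolding L_def N_def sum_ext_conj by (simp add: log1p_sq_def)
  have S0: "0 \<le> (\<Sum>i<N. L i)" unfolding L_def by (intro sum_nonneg log1p_sq_nonneg)
  have "ereal (\<Sum>i<N. \<Sum>j\<in>{..<N} - {i}. \<delta> / 2 * (L i + L j) - C) = (\<Sum>i<N. \<Sum>j\<in>{..<N} - {i}. ereal (\<delta> / 2 * (L i + L j) - C))"
    by simp
  also have "\<dots> \<le> K_n V n z" unfolding K_n_def N_def L_def by (intro sum_mono kern_ge)
  finally have 1: "ereal (\<Sum>i<N. \<Sum>j\<in>{..<N} - {i}. \<delta> / 2 * (L i + L j) - C) \<le> K_n V n z" .
  have "ereal (\<Sum>i<N. (1 + \<delta>) * L i - C) = (\<Sum>i<N. ereal ((1 + \<delta>) * L i - C))" by simp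
  also have "\<dots> \<le> (\<Sum>i<2*n. V (ext_conj n z i))" unfolding N_def L_def by (intro sum_mono V_growth)
  finally have 2: "ereal (\<Sum>i<N. (1 + \<delta>) * L i - C) \<le> (\<Sum>i<2*n. V (ext_conj n z i))" .
  have inner: "(\<Sum>j\<in>{..<N} - {i}. \<delta> / 2 * (L i + L j) - C) = \<delta> / 2 * (real N * L i + sum L {..<N}) - real N * C - (\<delta> * L i - C)" if "i < N" for i
  proof -
    have "(\<Sum>j\<in>{..<N} - {i}. \<delta> / 2 * (L i + L j) - C) = (\<Sum>j<N. \<delta> / 2 * (L i + L j) - C) - (\<delta> / 2 * (L i + L i) - C)"
      using that by (subst sum_diff1) auto
    also have "(\<Sum>j<N. \<delta> / 2 * (L i + L j) - C) = \<delta> / 2 * (real N * L i + sum L {..<N}) - real N * C"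
      by (simp only: sum_subtractf sum_distrib_left[symmetric] sum.distrib) simp
    finally show ?thesis by simp
  qed
  have "(\<Sum>i<N. \<Sum>j\<in>{..<N} - {i}. \<delta> / 2 * (L i + L j) - C) = (\<Sum>i<N. \<delta> / 2 * (real N * L i + sum L {..<N}) - real N * C - (\<delta> * L i - C))"
    using inner by simp
  also have "\<dots> = \<delta> / 2 * (real N * sum L {..<N} + real N * sum L {..<N}) - real N * (real N * C) - (\<delta> * sum L {..<N} - real N * C)"
    by (simp only: sum_subtractf sum.distrib sum_distrib_left[symmetric]) simp
  finally have X: "(\<Sum>i<N. \<Sum>j\<in>{..<N} - {i}. \<delta> / 2 * (L i + L j) - C)
     = \<delta> / 2 * (real N * sum L {..<N} + real N * sum L {..<N}) - real N * (real N * C) - (\<delta> * sum L {..<N} - real N * C)" .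
  have Y: "(\<Sum>i<N. (1 + \<delta>) * L i - C) = (1 + \<delta>) * sum L {..<N} - real N * C"
    by (simp only: sum_subtractf sum_distrib_left[symmetric]) simp
  have "(\<Sum>i<N. \<Sum>j\<in>{..<N} - {i}. \<delta> / 2 * (L i + L j) - C) + (\<Sum>i<N. (1 + \<delta>) * L i - C)
     = real N * \<delta> * sum L {..<N} - (real N)\<^sup>2 * C + sum L {..<N}"
    unfolding X Y by (simp add: power2_eq_square algebra_simps)
  moreover have "2 * (2 * real n) * \<delta> * (\<Sum>i<n. log1p_sq (z i)) - (2 * real n)\<^sup>2 * C = real N * \<delta> * sum L {..<N} - (real N)\<^sup>2 * C"
    unfolding S by (simp add: N_def)
  ultimately have "2 * (2 * real n) * \<delta> * (\<Sum>i<n. log1p_sq (z i)) - (2 * real n)\<^sup>2 * C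
    \<le> (\<Sum>i<N. \<Sum>j\<in>{..<N} - {i}. \<delta> / 2 * (L i + L j) - C) + (\<Sum>i<N. (1 + \<delta>) * L i - C)" using S0 by linarith
  then have "ereal (2 * (2 * real n) * \<delta> * (\<Sum>i<n. log1p_sq (z i)) - (2 * real n)\<^sup>2 * C)
    \<le> ereal (\<Sum>i<N. \<Sum>j\<in>{..<N} - {i}. \<delta> / 2 * (L i + L j) - C) + ereal (\<Sum>i<N. (1 + \<delta>) * L i - C)" by simp
  also have "\<dots> \<le> energy_sum n z" unfolding energy_sum_def by (rule add_mono[OF 1 2])
  finally show ?thesis .
qed

text \<open>Finiteness excludes points on the real line, where the conjugation term is infinite. A
  point and its conjugate contribute the same term, which cancels the factor \<open>1 / 2\<close> in
  the exponent, so \<open>cmod (z i - cnj (z i))\<close> enters with power one.\<close>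

lemma exp_neg_half_H_n:
  assumes "H_n V n z \<noteq> \<infinity>"
  obtains h where "energy_sum n z = ereal h" "exp_neg_half (H_n V n z) = ennreal (exp (- h / 2) * (\<Prod>i<n. cmod (z i - cnj (z i))))"
proof -
  let ?L = "\<Sum>i<2*n. log_kernel (ext_conj n z i) (cnj (ext_conj n z i))"
  have H: "H_n V n z = energy_sum n z + ?L" by (simp add: H_n_def energy_sum_def)
  have Lm: "?L \<noteq> -\<infinity>" by (intro sum_ereal_not_MInf) (auto simp: log_kernel_def)
  have Em: "energy_sum n z \<noteq> -\<infinity>" using energy_sum_ge[of n z] by auto
  have fin: "energy_sum n z \<noteq> \<infinity>" "?L \<noteq> \<infinity>" using assms Lm Em unfolding H by auto
  obtain h where h: "energy_sum n z = ereal h" using fin Em by (cases "energy_sum n z") auto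
  have Li: "log_kernel (ext_conj n z i) (cnj (ext_conj n z i)) \<noteq> \<infinity>" if "i < 2 * n" for i
    using fin(2) that unfolding sum_Pinfty by auto
  have ne: "z i \<noteq> cnj (z i)" if "i < n" for i
    using Li[of i] that by (auto simp: ext_conj_def log_kernel_def split: if_splits)
  have "?L = (\<Sum>i<n. log_kernel (z i) (cnj (z i))) + (\<Sum>i<n. log_kernel (cnj (z i)) (cnj (cnj (z i))))"
    by (rule sum_ext_conj[of "\<lambda>w. log_kernel w (cnj w)"])
  also have "\<dots> = (\<Sum>i<n. ereal (- ln (cmod (z i - cnj (z i))))) + (\<Sum>i<n. ereal (- ln (cmod (z i - cnj (z i)))))"
  proof -
    have "log_kernel (cnj (z i)) (cnj (cnj (z i))) = log_kernel (z i) (cnj (z i))" for i by (simp add: log_kernel_commute)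
    then show ?thesis using ne by (simp add: log_kernel_def)
  qed
  also have "\<dots> = ereal (- 2 * (\<Sum>i<n. ln (cmod (z i - cnj (z i)))))" by (simp add: sum_negf)
  finally have L: "?L = ereal (- 2 * (\<Sum>i<n. ln (cmod (z i - cnj (z i)))))" .
  have "exp (- (h + - 2 * (\<Sum>i<n. ln (cmod (z i - cnj (z i))))) / 2) = exp (- h / 2 + (\<Sum>i<n. ln (cmod (z i - cnj (z i)))))"
    by (simp add: field_simps)
  also have "\<dots> = exp (- h / 2) * (\<Prod>i<n. exp (ln (cmod (z i - cnj (z i)))))"
    by (simp only: exp_add exp_sum finite_lessThan)
  also have "(\<Prod>i<n. exp (ln (cmod (z i - cnj (z i))))) = (\<Prod>i<n. cmod (z i - cnj (z i)))"
    using ne by (intro prod.cong) auto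
  finally show ?thesis using that[OF h] unfolding H L h by (simp add: exp_neg_half_def)
qed

text \<open>A convex combination of two lower bounds for the energy: the share
  \<open>1 - \<theta>\<close> uses \<open>t\<close>, the share \<theta> uses coercivity and yields
  \<open>exp (- 3 * S)\<close>, where \<open>S\<close> is the sum of all
  \<open>log1p_sq (z i)\<close>. One \<open>exp S\<close> pays for the product of the distances to
  the conjugates; the rest is an integrable product.\<close>

lemma exp_neg_half_H_n_le:
  assumes n: "3 \<le> 2 * real n * \<delta>" and t: "ereal t < energy_sum n z"
  shows "exp_neg_half (H_n V n z)
    \<le> ennreal (exp (- t / 2 + 3 / (2 * real n * \<delta>) * t / 2 + 3 * real n * C / \<delta>)) * (\<Prod>i<n. ennreal (exp (- 2 * log1p_sq (z i))))"
proof (cases "H_n V n z = \<infinity>")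
  case False
  then obtain h where h: "energy_sum n z = ereal h"
    and eq: "exp_neg_half (H_n V n z) = ennreal (exp (- h / 2) * (\<Prod>i<n. cmod (z i - cnj (z i))))"
    by (rule exp_neg_half_H_n)
  define S where "S = (\<Sum>i<n. log1p_sq (z i))"
  \<comment> \<open>The coercive bound grows like \<open>4 * n * \<delta> * S\<close>; this is the
    share for which half of it is \<open>3 * S\<close>. For \<open>t\<close> of order
    \<open>n\<^sup>2\<close> the loss \<open>\<theta> * t / 2\<close> is of order
    \<open>n\<close>.\<close>
  define \<theta> where "\<theta> = 3 / (2 * real n * \<delta>)"
  have n0: "0 < real n" using n by (cases "n = 0") auto
  have \<theta>: "0 < \<theta>" "\<theta> \<le> 1" using n n0 \<delta>_pos by (auto simp: \<theta>_def)
  have th: "t \<le> h" using t h by simp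
  have hS: "2 * (2 * real n) * \<delta> * S - (2 * real n)\<^sup>2 * C \<le> h" using energy_sum_ge[of n z] h by (simp add: S_def)
  have "(1 - \<theta>) * t \<le> (1 - \<theta>) * h" using \<theta> th by (intro mult_left_mono) auto
  moreover have "\<theta> * (2 * (2 * real n) * \<delta> * S - (2 * real n)\<^sup>2 * C) \<le> \<theta> * h" using \<theta> hS by (intro mult_left_mono) auto
  ultimately have "(1 - \<theta>) * t + \<theta> * (2 * (2 * real n) * \<delta> * S - (2 * real n)\<^sup>2 * C) \<le> h" by (simp add: algebra_simps)
  moreover have "\<theta> * (2 * (2 * real n) * \<delta> * S - (2 * real n)\<^sup>2 * C) = 6 * S - 6 * real n * C / \<delta>"
    using n0 \<delta>_pos by (simp add: \<theta>_def field_simps power2_eq_square)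
  moreover have "6 * real n * C / \<delta> = 2 * (3 * real n * C / \<delta>)" by simp
  moreover have "(1 - \<theta>) * t = t - \<theta> * t" by (simp add: algebra_simps)
  ultimately have "- h / 2 \<le> (- t / 2 + \<theta> * t / 2 + 3 * real n * C / \<delta>) + - 3 * S" by linarith
  then have "exp (- h / 2) \<le> exp (- t / 2 + \<theta> * t / 2 + 3 * real n * C / \<delta>) * exp (- 3 * S)"
    by (simp only: exp_le_cancel_iff flip: exp_add)
  moreover have "(\<Prod>i<n. cmod (z i - cnj (z i))) \<le> exp S"
  proof -
    have "(\<Prod>i<n. cmod (z i - cnj (z i))) \<le> (\<Prod>i<n. exp (log1p_sq (z i)))" by (intro prod_mono) (auto simp: cmod_diff_cnj_le)
    then show ?thesis by (simp add: S_def exp_sum)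
  qed
  ultimately have "exp (- h / 2) * (\<Prod>i<n. cmod (z i - cnj (z i)))
    \<le> exp (- t / 2 + \<theta> * t / 2 + 3 * real n * C / \<delta>) * exp (- 3 * S) * exp S"
    by (intro mult_mono prod_nonneg) auto
  also have "\<dots> = exp (- t / 2 + \<theta> * t / 2 + 3 * real n * C / \<delta>) * exp (- 2 * S)" by (simp add: mult.assoc flip: exp_add)
  also have "exp (- 2 * S) = (\<Prod>i<n. exp (- 2 * log1p_sq (z i)))"
    unfolding S_def sum_distrib_left by (rule exp_sum) simp
  finally have "exp_neg_half (H_n V n z) \<le> ennreal (exp (- t / 2 + \<theta> * t / 2 + 3 * real n * C / \<delta>) * (\<Prod>i<n. exp (- 2 * log1p_sq (z i))))"
    unfolding eq by (rule ennreal_leI)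
  also have "\<dots> = ennreal (exp (- t / 2 + \<theta> * t / 2 + 3 * real n * C / \<delta>)) * ennreal (\<Prod>i<n. exp (- 2 * log1p_sq (z i)))"
    by (intro ennreal_mult prod_nonneg) auto
  also have "ennreal (\<Prod>i<n. exp (- 2 * log1p_sq (z i))) = (\<Prod>i<n. ennreal (exp (- 2 * log1p_sq (z i))))"
    by (rule prod_ennreal[symmetric]) simp
  finally show ?thesis by (simp add: \<theta>_def)
qed (simp add: exp_neg_half_def)

end

context equilibrium_conj
begin

text \<open>Up to factors exponential in \<open>n\<close>, the unnormalised mass has the exponent
  \<open>- (2 * n)\<^sup>2 * (m + \<epsilon>) / 2\<close>, while the normalising constant, bounded
  with half of \<epsilon>, has \<open>- (2 * n)\<^sup>2 * (m + \<epsilon> / 2) / 2\<close>; the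
  difference is \<open>- n\<^sup>2 * \<epsilon>\<close>.\<close>

lemma tail_bound:
  assumes \<epsilon>: "0 < \<epsilon>"
  obtains k n0 where "\<And>n. n0 \<le> n \<Longrightarrow> (\<integral>\<^sup>+z. P_density V n z * indicator {z. ereal ((2 * real n)\<^sup>2 * (m + \<epsilon>)) < energy_sum n z} z \<partial>lebesgue_Cn n)
      \<le> ennreal (exp (k * real n - (real n)\<^sup>2 * \<epsilon>))"
proof -
  obtain k1 where k1: "\<And>n. 1 \<le> n \<Longrightarrow> ennreal (exp (- (2 * real n)\<^sup>2 * (m + \<epsilon> / 2) / 2 - k1 * real n)) \<le> norm_const V n"
    using norm_const_lower_bound[of "\<epsilon> / 2"] \<epsilon> by auto
  define G where "G = (\<integral>\<^sup>+z. ennreal (exp (- 2 * log1p_sq z)) \<partial>lborel)"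
  have "G < \<infinity>" unfolding G_def by (rule nn_integral_inverse_square_finite)
  then obtain g where g: "G = ennreal g" "0 \<le> g" by (cases G) auto
  \<comment> \<open>Positive, so that the power \<open>g1 ^ n\<close> can be written as an
    exponential.\<close>
  define g1 where "g1 = g + 1"
  have g1: "0 < g1" "G \<le> ennreal g1" using g by (auto simp: g1_def intro: ennreal_leI)
  \<comment> \<open>The four linear contributions come from the normalising constant, the share
    \<theta> of \<open>t\<close>, the constant of coercivity and the mass of the majorant. The index
    \<open>n0\<close> ensures that the share \<theta> is at most 1.\<close>
  define k where "k = k1 + 3 * (m + \<epsilon>) / \<delta> + 3 * C / \<delta> + ln g1"
  define n0 where "n0 = nat \<lceil>3 / (2 * \<delta>)\<rceil> + 1"
  interpret L: product_sigma_finite "\<lambda>_. lborel :: complex measure" by (simp add: product_sigma_finite_def sigma_finite_lborel)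
  show ?thesis
  proof (rule that[of n0 k])
    fix n assume n: "n0 \<le> n"
    have n1: "1 \<le> n" using n by (simp add: n0_def)
    have "3 / (2 * \<delta>) \<le> real n" using n by (simp add: n0_def) linarith
    then have n3: "3 \<le> 2 * real n * \<delta>" using \<delta>_pos by (simp add: field_simps)
    define t where "t = (2 * real n)\<^sup>2 * (m + \<epsilon>)"
    define c0 where "c0 = exp (- (2 * real n)\<^sup>2 * (m + \<epsilon> / 2) / 2 - k1 * real n)"
    define A where "A = exp (- t / 2 + 3 / (2 * real n * \<delta>) * t / 2 + 3 * real n * C / \<delta>)"
    have "norm_const V n \<ge> ennreal c0" unfolding c0_def by (rule k1[OF n1])
    then have inv: "inverse (norm_const V n) \<le> ennreal (1 / c0)"
    proof -
      have "inverse (norm_const V n) \<le> inverse (ennreal c0)"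
        using \<open>norm_const V n \<ge> ennreal c0\<close>
      proof (cases "norm_const V n")
        case (real r)
        have c0: "0 < c0" by (simp add: c0_def)
        have "c0 \<le> r" using \<open>norm_const V n \<ge> ennreal c0\<close> real by (simp add: ennreal_le_iff)
        then show ?thesis using real c0 by (simp add: inverse_ennreal ennreal_leI le_imp_inverse_le)
      qed simp
      then show ?thesis by (simp add: inverse_ennreal c0_def inverse_eq_divide)
    qed
    have "(\<integral>\<^sup>+z. P_density V n z * indicator {z. ereal t < energy_sum n z} z \<partial>lebesgue_Cn n)
      \<le> (\<integral>\<^sup>+z. ennreal (1 / c0) * ennreal A * (\<Prod>i<n. ennreal (exp (- 2 * log1p_sq (z i)))) \<partial>lebesgue_Cn n)"
    proof (rule nn_integral_mono)
      fix z
      show "P_density V n z * indicator {z. ereal t < energy_sum n z} z \<le> ennreal (1 / c0) * ennreal A * (\<Prod>i<n. ennreal (exp (- 2 * log1p_sq (z i))))"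
      proof (cases "ereal t < energy_sum n z")
        case True
        have "P_density V n z = inverse (norm_const V n) * exp_neg_half (H_n V n z)"
          by (simp add: P_density_def divide_ennreal_def mult.commute)
        also have "\<dots> \<le> ennreal (1 / c0) * (ennreal A * (\<Prod>i<n. ennreal (exp (- 2 * log1p_sq (z i)))))"
          unfolding A_def by (intro mult_mono inv exp_neg_half_H_n_le[OF n3 True]) auto
        finally show ?thesis using True by (simp add: mult.assoc)
      qed simp
    qed
    also have "\<dots> = ennreal (1 / c0) * ennreal A * (\<integral>\<^sup>+z. (\<Prod>i<n. ennreal (exp (- 2 * log1p_sq (z i)))) \<partial>lebesgue_Cn n)"
      unfolding lebesgue_Cn_def by (rule nn_integral_cmult) measurable
    also have "(\<integral>\<^sup>+z. (\<Prod>i<n. ennreal (exp (- 2 * log1p_sq (z i)))) \<partial>lebesgue_Cn n) = G ^ n"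
      unfolding lebesgue_Cn_def G_def by (subst L.product_nn_integral_prod) auto
    also have "ennreal (1 / c0) * ennreal A * G ^ n \<le> ennreal (1 / c0) * ennreal A * ennreal g1 ^ n"
      by (intro mult_left_mono power_mono g1) auto
    also have "\<dots> = ennreal (1 / c0 * A * g1 ^ n)"
    proof -
      have "0 < c0" "0 < A" by (auto simp: c0_def A_def)
      then show ?thesis using g1(1) by (simp only: ennreal_power ennreal_mult[symmetric] zero_le_divide_1_iff less_imp_le mult_nonneg_nonneg zero_le_power)
    qed
    also have "1 / c0 * A * g1 ^ n = exp (k * real n - (real n)\<^sup>2 * \<epsilon>)"
    proof -
      have c: "1 / c0 = exp ((2 * real n)\<^sup>2 * (m + \<epsilon> / 2) / 2 + k1 * real n)"
        unfolding c0_def by (simp add: exp_minus inverse_eq_divide flip: exp_minus) (simp add: exp_diff exp_add exp_minus divide_simps)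
      have gg: "g1 ^ n = exp (real n * ln g1)" using g1 by (simp add: exp_of_nat_mult)
      have n0: "real n \<noteq> 0" using n1 by simp
      have "3 / (2 * real n * \<delta>) * t / 2 = 3 * real n * (m + \<epsilon>) / \<delta>"
        using n0 \<delta>_pos by (simp add: t_def power2_eq_square field_simps)
      note e = this
      have "(2 * real n)\<^sup>2 * (m + \<epsilon> / 2) / 2 + k1 * real n + (- t / 2 + 3 / (2 * real n * \<delta>) * t / 2 + 3 * real n * C / \<delta>) + real n * ln g1
         = k * real n - (real n)\<^sup>2 * \<epsilon>"
        unfolding e by (simp add: k_def t_def power2_eq_square algebra_simps add_divide_distrib) (simp add: field_simps)
      then show ?thesis unfolding c gg A_def exp_add[symmetric] by simp
    qed
    finally show "(\<integral>\<^sup>+z. P_density V n z * indicator {z. ereal ((2 * real n)\<^sup>2 * (m + \<epsilon>)) < energy_sum n z} z \<partial>lebesgue_Cn n)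
      \<le> ennreal (exp (k * real n - (real n)\<^sup>2 * \<epsilon>))" by (simp add: t_def)
  qed
qed

end

subsection \<open>Empirical measures\<close>

text \<open>\<open>measure_of\<close> returns the given set function only when that is a measure. As
  a push-forward of the uniform law on the indices it is one, and coinciding points are counted with
  multiplicity.\<close>

lemma empirical_eq_distr:
  assumes "0 < m"
  shows "empirical m x = distr (measure_pmf (pmf_of_set {..<m})) borel x"
proof -
  let ?D = "distr (measure_pmf (pmf_of_set {..<m})) borel x"
  have ne: "{..<m} \<noteq> {}" using assms by auto
  have em: "ennreal (real (card {i \<in> {..<m}. x i \<in> A}) / real m) = emeasure ?D A" if A: "A \<in> sets borel" for A
  proof -
    have "emeasure ?D A = emeasure (measure_pmf (pmf_of_set {..<m})) (x -` A)"
      using A by (subst emeasure_distr) auto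
    also have "\<dots> = ennreal (real (card ({..<m} \<inter> x -` A)) / real (card {..<m}))"
      by (rule emeasure_pmf_of_set[OF ne]) simp
    also have "{..<m} \<inter> x -` A = {i \<in> {..<m}. x i \<in> A}" by auto
    finally show ?thesis by simp
  qed
  have s: "sigma_sets UNIV (sets (borel :: complex measure)) = sets borel"
    using sets.sigma_sets_eq[of "borel :: complex measure"] by simp
  have "empirical m x = measure_of UNIV (sets borel) (emeasure ?D)"
    unfolding empirical_def by (rule measure_of_eq) (simp, unfold s, rule em)
  also have "\<dots> = ?D" using measure_of_of_measure[of ?D] by simp
  finally show ?thesis .
qed

lemma integral_empirical:
  fixes f :: "complex \<Rightarrow> real"
  assumes "0 < m" "f \<in> borel_measurable borel"
  shows "(\<integral>z. f z \<partial>empirical m x) = (\<Sum>i<m. f (x i)) / real m"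
proof -
  have ne: "{..<m} \<noteq> {}" using assms by auto
  have "(\<integral>z. f z \<partial>empirical m x) = (\<integral>i. f (x i) \<partial>measure_pmf (pmf_of_set {..<m}))"
    unfolding empirical_eq_distr[OF assms(1)] using assms by (subst integral_distr) auto
  also have "\<dots> = (\<Sum>i<m. f (x i)) / real m"
    by (subst integral_pmf_of_set) (use ne in auto)
  finally show ?thesis .
qed

lemma
  assumes "0 < m"
  shows prob_space_empirical: "prob_space (empirical m x)"
    and sets_empirical: "sets (empirical m x) = sets borel"
    and AE_empirical_bounded: "\<exists>R. AE z in empirical m x. cmod z \<le> R"
proof -
  show "prob_space (empirical m x)"
    unfolding empirical_eq_distr[OF assms] by (rule measure_pmf.prob_space_distr) simp
  show "sets (empirical m x) = sets borel" by (simp add: empirical_eq_distr[OF assms])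
  have "AE z in empirical m x. cmod z \<le> (\<Sum>i<m. cmod (x i))"
    unfolding empirical_eq_distr[OF assms]
  proof (subst AE_distr_iff)
    show "AE i in measure_pmf (pmf_of_set {..<m}). cmod (x i) \<le> (\<Sum>i<m. cmod (x i))"
    proof -
      have "set_pmf (pmf_of_set {..<m}) = {..<m}" using assms by (intro set_pmf_of_set) auto
      then show ?thesis
        using member_le_sum[where f = "\<lambda>i. cmod (x i)" and A = "{..<m}"] by (simp add: AE_measure_pmf_iff)
    qed
  qed auto
  then show "\<exists>R. AE z in empirical m x. cmod z \<le> R" by blast
qed

context external_field
begin

text \<open>The continuous \<open>V\<close> attains its maximum on the compact set and is finite
  there, so on the carrier of \<nu> the field adds at most a constant to the logarithmic
  kernel.\<close>

lemma J_finite_of_finite_log_energy: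
  assumes \<nu>: "prob_on_C \<nu>" and A: "compact A" "A \<subseteq> {z. V z < \<infinity>}" "A \<in> sets \<nu>" "emeasure \<nu> A = 1"
    and fin: "eintegral (\<nu> \<Otimes>\<^sub>M \<nu>) (\<lambda>(x, y). log_kernel x y) < \<infinity>"
  shows "J \<nu> \<nu> < \<infinity>"
proof -
  interpret \<nu>: prob_space \<nu> using \<nu> by (simp add: prob_on_C_def)
  have [measurable_cong]: "sets \<nu> = sets borel" using \<nu> by (simp add: prob_on_C_def)
  have "A \<noteq> {}" using A(4) by auto
  then obtain x0 where x0: "x0 \<in> A" "\<And>y. y \<in> A \<Longrightarrow> V y \<le> V x0"
    using continuous_attains_sup[OF A(1), of V] continuous_on_subset[OF V_cont] by (metis subset_UNIV)
  obtain b where b: "V x0 = ereal b" "0 \<le> b" using x0(1) A(2) V_nonneg[of x0] by (cases "V x0") auto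
  have bd: "V y \<le> ereal b" if "y \<in> A" for y using x0(2)[OF that] b by simp
  have AE_A: "AE x in \<nu>. x \<in> A" using \<nu>.AE_prob_1[of A] A(4) by (simp add: \<nu>.emeasure_eq_measure)
  have le: "K x y \<le> e2ennreal (log_kernel x y) + ennreal (b + C)" if xy: "x \<in> A" "y \<in> A" for x y
  proof -
    obtain a1 a2 where a: "V x = ereal a1" "V y = ereal a2" "a1 \<le> b" "a2 \<le> b"
      using bd[OF xy(1)] bd[OF xy(2)] V_nonneg[of x] V_nonneg[of y] by (cases "V x"; cases "V y") auto
    have lm: "log_kernel x y \<noteq> -\<infinity>" by (simp add: log_kernel_def)
    have "kern V x y + ereal C = log_kernel x y + ereal ((a1 + a2) / 2 + C)"
      using a lm by (cases "log_kernel x y") (auto simp: kern_def)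
    then have "K x y \<le> e2ennreal (log_kernel x y) + e2ennreal (ereal ((a1 + a2) / 2 + C))"
      unfolding K_def using e2ennreal_add_le[OF lm, of "ereal ((a1 + a2) / 2 + C)"] by simp
    also have "\<dots> \<le> e2ennreal (log_kernel x y) + ennreal (b + C)"
      using a by (intro add_left_mono) (auto intro!: ennreal_leI)
    finally show ?thesis .
  qed
  let ?P = "\<integral>\<^sup>+p. e2ennreal (case p of (x, y) \<Rightarrow> log_kernel x y) \<partial>(\<nu> \<Otimes>\<^sub>M \<nu>)"
  \<comment> \<open>In \<open>ereal\<close>, \<open>\<infinity>\<close> minus anything is
    \<open>\<infinity>\<close>, so a finite \<open>eintegral\<close> bounds its positive
    part.\<close>
  have P: "?P < \<infinity>"
  proof (rule ccontr)
    assume "\<not> ?P < \<infinity>"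
    then have "?P = top" by (simp add: not_less top_unique)
    then have "eintegral (\<nu> \<Otimes>\<^sub>M \<nu>) (\<lambda>(x, y). log_kernel x y) = \<infinity>" unfolding eintegral_def by simp
    then show False using fin by simp
  qed
  have "J \<nu> \<nu> \<le> (\<integral>\<^sup>+x. \<integral>\<^sup>+y. e2ennreal (log_kernel x y) + ennreal (b + C) \<partial>\<nu> \<partial>\<nu>)"
    unfolding J_def
    by (rule nn_integral_mono_AE, use AE_A in eventually_elim, rule nn_integral_mono_AE, use AE_A in eventually_elim) (rule le)
  also have "\<dots> = (\<integral>\<^sup>+x. \<integral>\<^sup>+y. e2ennreal (log_kernel x y) \<partial>\<nu> \<partial>\<nu>) + ennreal (b + C)"
  proof -
    have m: "(\<lambda>(x, y). e2ennreal (log_kernel x y)) \<in> borel_measurable (\<nu> \<Otimes>\<^sub>M \<nu>)" by measurable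
    have "(\<integral>\<^sup>+y. e2ennreal (log_kernel x y) + ennreal (b + C) \<partial>\<nu>) = (\<integral>\<^sup>+y. e2ennreal (log_kernel x y) \<partial>\<nu>) + ennreal (b + C)" for x
      by (subst nn_integral_add) (auto simp: \<nu>.emeasure_space_1)
    then show ?thesis by (simp add: nn_integral_add \<nu>.emeasure_space_1)
  qed
  also have "(\<integral>\<^sup>+x. \<integral>\<^sup>+y. e2ennreal (log_kernel x y) \<partial>\<nu> \<partial>\<nu>) = ?P"
    by (subst \<nu>.nn_integral_fst[symmetric]) auto
  also have "?P + ennreal (b + C) < \<infinity>" using P by simp
  finally show ?thesis .
qed

end

section \<open>Energy form of the empirical measure\<close>

context equilibrium
begin

text \<open>Let \<open>N = 2 * n\<close> and let \<open>W\<close> be the sum of \<open>V\<close>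
  over the points. The self-interaction is at most
  \<open>m + \<epsilon> - W / N - ln e / (2 * N)\<close>; twice the mixed term is at least
  \<open>2 * m - vbar - \<eta> - W / N\<close>, by the potential bound summed over the points; the
  last term is at most \<open>m - vbar\<close>. In the sum \<open>W\<close>, \<open>m\<close> and
  \<open>vbar\<close> cancel.\<close>

lemma edist_empirical_le:
  assumes n: "1 \<le> n" and e: "0 < e" "e \<le> 1"
    and G: "\<And>x a. V x = ereal a \<Longrightarrow> 2 * m - vbar - \<eta> \<le> 2 * U e x + a"
    and E: "energy_sum n z \<le> ereal ((2 * real n)\<^sup>2 * (m + \<epsilon>))"
  shows "edist (reg_log e) (empirical (2 * n) (ext_conj n z)) \<mu>V \<le> \<epsilon> + \<eta> - ln e / (4 * real n)"
proof -
  define N where "N = 2 * n"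
  define Z where "Z = ext_conj n z"
  have N: "0 < N" "real N = 2 * real n" using n by (auto simp: N_def)
  have Vfin: "V (Z i) = ereal (v (Z i))" if i: "i < N" for i
  proof -
    have "K_n V n z \<noteq> -\<infinity>" unfolding K_n_def
      by (rule sum_ereal_not_MInf, simp, rule sum_ereal_not_MInf) (auto simp: kern_not_MInf)
    then have "(\<Sum>i<N. V (Z i)) \<noteq> \<infinity>" using E unfolding energy_sum_def N_def Z_def by (cases "K_n V n z") auto
    then have "V (Z i) \<noteq> \<infinity>" using i unfolding sum_Pinfty by auto
    then show ?thesis using V_nonneg[of "Z i"] by (cases "V (Z i)") (auto simp: v_def)
  qed
  have kge: "ereal (reg_log e (Z i) (Z j) + (v (Z i) + v (Z j)) / 2) \<le> kern V (Z i) (Z j)" if ij: "i < N" "j < N" for i j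
  proof (cases "Z i = Z j")
    case False
    then show ?thesis using kern_real[OF False Vfin[OF ij(1)] Vfin[OF ij(2)]] reg_log_le_neg_ln[OF False e(1)] by simp
  qed (simp add: kern_infinite)
  define A where "A = (\<Sum>i<N. \<Sum>j<N. reg_log e (Z i) (Z j))"
  define W where "W = (\<Sum>i<N. v (Z i))"
  have inner: "(\<Sum>j\<in>{..<N} - {i}. reg_log e (Z i) (Z j) + (v (Z i) + v (Z j)) / 2)
      = (\<Sum>j<N. reg_log e (Z i) (Z j)) + (real N * v (Z i) + W) / 2 + ln e / 2 - v (Z i)" if i: "i < N" for i
  proof -
    have "(\<Sum>j\<in>{..<N} - {i}. reg_log e (Z i) (Z j) + (v (Z i) + v (Z j)) / 2)
      = (\<Sum>j<N. reg_log e (Z i) (Z j) + (v (Z i) + v (Z j)) / 2) - (reg_log e (Z i) (Z i) + (v (Z i) + v (Z i)) / 2)"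
      using i by (subst sum_diff1) auto
    also have "(\<Sum>j<N. reg_log e (Z i) (Z j) + (v (Z i) + v (Z j)) / 2) = (\<Sum>j<N. reg_log e (Z i) (Z j)) + (real N * v (Z i) + W) / 2"
      by (simp add: sum.distrib W_def flip: sum_divide_distrib)
    \<comment> \<open>The removed diagonal entry of the regularised kernel is
      \<open>- ln e / 2\<close>.\<close>
    finally show ?thesis by (simp add: reg_log_def)
  qed
  have "(\<Sum>i<N. \<Sum>j\<in>{..<N} - {i}. reg_log e (Z i) (Z j) + (v (Z i) + v (Z j)) / 2)
     = (\<Sum>i<N. (\<Sum>j<N. reg_log e (Z i) (Z j)) + (real N * v (Z i) + W) / 2 + ln e / 2 - v (Z i))"
    using inner by simp
  also have "\<dots> = A + (real N * W + real N * W) / 2 + real N * (ln e / 2) - W"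
    by (simp add: sum.distrib sum_subtractf A_def W_def flip: sum_divide_distrib sum_distrib_left)
  finally have dsum: "(\<Sum>i<N. \<Sum>j\<in>{..<N} - {i}. reg_log e (Z i) (Z j) + (v (Z i) + v (Z j)) / 2) + W
     = A + real N * W + real N * (ln e / 2)" by simp
  have "ereal (\<Sum>i<N. \<Sum>j\<in>{..<N} - {i}. reg_log e (Z i) (Z j) + (v (Z i) + v (Z j)) / 2)
     = (\<Sum>i<N. \<Sum>j\<in>{..<N} - {i}. ereal (reg_log e (Z i) (Z j) + (v (Z i) + v (Z j)) / 2))" by simp
  also have "\<dots> \<le> K_n V n z" unfolding K_n_def N_def[symmetric] Z_def[symmetric] by (intro sum_mono kge) auto
  finally have 1: "ereal (\<Sum>i<N. \<Sum>j\<in>{..<N} - {i}. reg_log e (Z i) (Z j) + (v (Z i) + v (Z j)) / 2) \<le> K_n V n z" .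
  have "ereal W = (\<Sum>i<N. ereal (v (Z i)))" by (simp add: W_def)
  also have "\<dots> = (\<Sum>i<N. V (Z i))" using Vfin by simp
  finally have 2: "ereal W = (\<Sum>i<N. V (Z i))" .
  have "ereal (A + real N * W + real N * (ln e / 2)) \<le> energy_sum n z"
    unfolding energy_sum_def N_def[symmetric] Z_def[symmetric] dsum[symmetric] plus_ereal.simps(1)[symmetric] 2
    by (rule add_right_mono[OF 1])
  then have "ereal (A + real N * W + real N * (ln e / 2)) \<le> ereal ((real N)\<^sup>2 * (m + \<epsilon>))"
    using E unfolding N(2) by (rule order_trans)
  then have main: "A + real N * W + real N * (ln e / 2) \<le> (real N)\<^sup>2 * (m + \<epsilon>)" by simp
  have "2 * m - vbar - \<eta> \<le> 2 * U e (Z i) + v (Z i)" if "i < N" for i by (rule G[OF Vfin[OF that]])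
  then have "(\<Sum>i<N. 2 * m - vbar - \<eta>) \<le> (\<Sum>i<N. 2 * U e (Z i) + v (Z i))" by (intro sum_mono) auto
  then have GU: "real N * (2 * m - vbar - \<eta>) \<le> 2 * (\<Sum>i<N. U e (Z i)) + W"
    by (simp add: sum.distrib W_def flip: sum_distrib_left)
  let ?E = "empirical N Z"
  have rm: "reg_log e x \<in> borel_measurable borel" for x unfolding reg_log_def by measurable
  have Um: "U e \<in> borel_measurable borel" unfolding U_def by measurable
  have Am: "(\<lambda>x. (\<Sum>j<N. reg_log e x (Z j)) / real N) \<in> borel_measurable borel" by measurable
  have e1: "(\<integral>x. \<integral>y. reg_log e x y \<partial>?E \<partial>?E) = A / (real N)\<^sup>2"
    unfolding integral_empirical[OF N(1) rm] integral_empirical[OF N(1) Am]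
    by (simp add: A_def power2_eq_square flip: sum_divide_distrib)
  have e2: "(\<integral>x. \<integral>y. reg_log e x y \<partial>\<mu>V \<partial>?E) = (\<Sum>i<N. U e (Z i)) / real N"
    using integral_empirical[OF N(1) Um] by (simp add: U_def)
  have e3: "(\<integral>x. \<integral>y. reg_log e x y \<partial>\<mu>V \<partial>\<mu>V) \<le> m - vbar"
    using reg_energy_le[OF e] by (simp add: U_def)
  have "A / (real N)\<^sup>2 \<le> m + \<epsilon> - W / real N - ln e / (2 * real N)"
    using main N(1) by (simp add: field_simps power2_eq_square)
  moreover have "2 * m - vbar - \<eta> \<le> 2 * ((\<Sum>i<N. U e (Z i)) / real N) + W / real N"
    using GU N(1) by (simp add: field_simps)
  ultimately have "edist (reg_log e) ?E \<mu>V \<le> \<epsilon> + \<eta> - ln e / (2 * real N)"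
    unfolding edist_def e1 e2 using e3 by linarith
  then show ?thesis unfolding N_def Z_def by simp
qed

text \<open>For a given accuracy \<kappa>, \<open>potential_ge\<close> fixes \<open>e\<close> before
  \<open>n\<close> tends to infinity, so the diagonal cost \<open>- ln e / (4 * n)\<close>
  vanishes.\<close>

lemma weak_conv_C_empirical:
  assumes lim: "\<And>\<epsilon>. 0 < \<epsilon> \<Longrightarrow> \<forall>\<^sub>F n in sequentially. energy_sum n (z n) \<le> ereal ((2 * real n)\<^sup>2 * (m + \<epsilon>))"
  shows "weak_conv_C (\<lambda>n. empirical (2 * n) (ext_conj n (z n))) \<mu>V"
proof -
  let ?E = "\<lambda>n. empirical (2 * n) (ext_conj n (z n))"
  \<comment> \<open>The empirical measure of zero points is not a probability measure, so the index
    is shifted; the limit stays the same.\<close>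
  have "weak_conv_C (\<lambda>n. ?E (Suc n)) \<mu>V"
  proof (rule weak_conv_C_of_edist_reg_log)
    show "prob_space (?E (Suc n))" "sets (?E (Suc n)) = sets borel" "\<exists>R. AE x in ?E (Suc n). cmod x \<le> R" for n
      by (rule prob_space_empirical sets_empirical AE_empirical_bounded; simp)+
    show "\<exists>R. AE x in \<mu>V. cmod x \<le> R" using AE_V_real_bounded by (metis (mono_tags, lifting) eventually_mono)
    fix \<kappa> :: real assume \<kappa>: "0 < \<kappa>"
    obtain e where e: "0 < e" "e \<le> 1" and G: "\<And>x a. V x = ereal a \<Longrightarrow> 2 * m - vbar - \<kappa> / 4 \<le> 2 * U e x + a"
      using potential_ge[of "\<kappa> / 4"] \<kappa> by auto
    have "(\<lambda>n. - ln e / (4 * real n)) \<longlonglongrightarrow> 0" by real_asymp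
    then have "\<forall>\<^sub>F n in sequentially. - ln e / (4 * real n) < \<kappa> / 4" by (rule order_tendstoD) (use \<kappa> in simp)
    moreover have "\<forall>\<^sub>F n in sequentially. energy_sum n (z n) \<le> ereal ((2 * real n)\<^sup>2 * (m + \<kappa> / 4))" using \<kappa> by (intro lim) simp
    moreover have "\<forall>\<^sub>F n in sequentially. (1::nat) \<le> n" by (rule eventually_ge_at_top)
    ultimately have "\<forall>\<^sub>F n in sequentially. edist (reg_log e) (?E n) \<mu>V \<le> \<kappa>"
    proof eventually_elim
      fix n :: nat
      assume 1: "- ln e / (4 * real n) < \<kappa> / 4" and 2: "energy_sum n (z n) \<le> ereal ((2 * real n)\<^sup>2 * (m + \<kappa> / 4))" and 3: "1 \<le> n"
      show "edist (reg_log e) (?E n) \<mu>V \<le> \<kappa>" using edist_empirical_le[OF 3 e G 2] 1 \<kappa> by simp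
    qed
    then have "\<forall>\<^sub>F n in sequentially. edist (reg_log e) (?E (Suc n)) \<mu>V \<le> \<kappa>"
      by (subst eventually_sequentially_Suc[of "\<lambda>n. edist (reg_log e) (?E n) \<mu>V \<le> \<kappa>"])
    then show "\<exists>e. 0 < e \<and> e \<le> 1 \<and> (\<forall>\<^sub>F n in sequentially. edist (reg_log e) (?E (Suc n)) \<mu>V \<le> \<kappa>)" using e by blast
  qed (auto simp: prob_space_\<mu>V)
  note shifted = this
  show ?thesis
    unfolding weak_conv_C_def
  proof (intro allI impI)
    fix f :: "complex \<Rightarrow> real" assume "continuous_on UNIV f \<and> bounded (range f)"
    with shifted have "(\<lambda>n. \<integral>x. f x \<partial>?E (Suc n)) \<longlonglongrightarrow> (\<integral>x. f x \<partial>\<mu>V)"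
      unfolding weak_conv_C_def by simp
    then show "(\<lambda>n. \<integral>x. f x \<partial>?E n) \<longlonglongrightarrow> (\<integral>x. f x \<partial>\<mu>V)" by (rule LIMSEQ_imp_Suc)
  qed
qed

end

section \<open>Almost sure bound on the energy of the configurations\<close>

context equilibrium_conj
begin

lemma AE_energy_sum_le:
  assumes M: "prob_space M"
    and Z_meas: "\<And>n. n \<ge> 1 \<Longrightarrow> Z n \<in> M \<rightarrow>\<^sub>M (\<Pi>\<^sub>M i\<in>{..<n}. (borel :: complex measure))"
    and Z_distr: "\<And>n. n \<ge> 1 \<Longrightarrow> distr M (\<Pi>\<^sub>M i\<in>{..<n}. (borel :: complex measure)) (Z n) = density (lebesgue_Cn n) (P_density V n)"
    and \<epsilon>: "0 < \<epsilon>"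
  shows "AE \<omega> in M. \<forall>\<^sub>F n in sequentially. energy_sum n (Z n \<omega>) \<le> ereal ((2 * real n)\<^sup>2 * (m + \<epsilon>))"
proof -
  interpret M: prob_space M by fact
  obtain k n0 where tail: "\<And>n. n0 \<le> n \<Longrightarrow> (\<integral>\<^sup>+z. P_density V n z * indicator {z. ereal ((2 * real n)\<^sup>2 * (m + \<epsilon>)) < energy_sum n z} z \<partial>lebesgue_Cn n)
      \<le> ennreal (exp (k * real n - (real n)\<^sup>2 * \<epsilon>))"
    using tail_bound[OF \<epsilon>] by blast
  define n1 where "n1 = max 1 n0"
  define S where "S n = {z \<in> space (\<Pi>\<^sub>M i\<in>{..<n}. (borel :: complex measure)). ereal ((2 * real n)\<^sup>2 * (m + \<epsilon>)) < energy_sum n z}" for n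
  have S [measurable]: "S n \<in> sets (\<Pi>\<^sub>M i\<in>{..<n}. borel)" for n
    unfolding S_def using measurable_energy_sum[of n] by measurable
  \<comment> \<open>Small indices are discarded: \<open>Z n\<close> is known to be measurable from
    \<open>n = 1\<close> on, and the tail bound holds from \<open>n0\<close> on.\<close>
  define A where "A n = (if n1 \<le> n then Z n -` S n \<inter> space M else {})" for n
  have A: "A n \<in> sets M" for n unfolding A_def using measurable_sets[OF Z_meas S] by (auto simp: n1_def)
  have sets_leb: "sets (lebesgue_Cn n) = sets (\<Pi>\<^sub>M i\<in>{..<n}. (borel :: complex measure))" for n
    unfolding lebesgue_Cn_def by (rule sets_PiM_cong) auto
  have b: "measure M (A n) \<le> exp (k * real n - (real n)\<^sup>2 * \<epsilon>)" for n
  proof (cases "n1 \<le> n")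
    case True
    then have n: "1 \<le> n" "n0 \<le> n" by (auto simp: n1_def)
    have Pm: "P_density V n \<in> borel_measurable (lebesgue_Cn n)"
    proof -
      have "exp_neg_half \<in> borel_measurable borel" unfolding exp_neg_half_def[abs_def] by measurable
      from measurable_compose[OF measurable_H_n[of n] this]
      have "(\<lambda>z. exp_neg_half (H_n V n z)) \<in> borel_measurable (lebesgue_Cn n)" by (simp add: measurable_cong_sets[OF sets_leb])
      then show ?thesis unfolding P_density_def[abs_def] divide_ennreal_def by measurable
    qed
    have "emeasure M (A n) = emeasure (distr M (\<Pi>\<^sub>M i\<in>{..<n}. borel) (Z n)) (S n)"
      using True Z_meas[OF n(1)] by (simp add: A_def emeasure_distr)
    also have "\<dots> = (\<integral>\<^sup>+z. P_density V n z * indicator (S n) z \<partial>lebesgue_Cn n)"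
      unfolding Z_distr[OF n(1)] using Pm S by (subst emeasure_density) (auto simp: sets_leb)
    also have "\<dots> \<le> (\<integral>\<^sup>+z. P_density V n z * indicator {z. ereal ((2 * real n)\<^sup>2 * (m + \<epsilon>)) < energy_sum n z} z \<partial>lebesgue_Cn n)"
      by (intro nn_integral_mono) (auto simp: S_def indicator_def)
    also have "\<dots> \<le> ennreal (exp (k * real n - (real n)\<^sup>2 * \<epsilon>))" by (rule tail[OF n(2)])
    finally show ?thesis by (simp add: M.emeasure_eq_measure)
  qed (simp add: A_def)
  \<comment> \<open>The quadratic term dominates whatever the sign and size of
    \<open>k\<close>.\<close>
  have s: "summable (\<lambda>n. exp (k * real n - (real n)\<^sup>2 * \<epsilon>))"
  proof (rule summable_comparison_test_bigo)
    show "summable (\<lambda>n. norm (1 / real n ^ 2))"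
      using inverse_power_summable[of 2, where ?'a = real] by (simp add: inverse_eq_divide)
    show "(\<lambda>n. exp (k * real n - (real n)\<^sup>2 * \<epsilon>)) \<in> O(\<lambda>n. 1 / real n ^ 2)" using \<epsilon> by real_asymp
  qed
  have sm: "summable (\<lambda>n. measure M (A n))"
    by (rule summable_comparison_test'[OF s, of 0]) (use b in simp)
  have "AE \<omega> in M. \<forall>\<^sub>F n in sequentially. \<omega> \<in> space M - A n"
    by (rule borel_cantelli_AE1[OF A _ sm]) (simp add: M.emeasure_eq_measure)
  then show ?thesis
  proof eventually_elim
    fix \<omega> assume "\<forall>\<^sub>F n in sequentially. \<omega> \<in> space M - A n"
    then show "\<forall>\<^sub>F n in sequentially. energy_sum n (Z n \<omega>) \<le> ereal ((2 * real n)\<^sup>2 * (m + \<epsilon>))"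
      using eventually_ge_at_top[of n1]
    proof eventually_elim
      fix n assume \<omega>: "\<omega> \<in> space M - A n" and n: "n1 \<le> n"
      then have "Z n \<omega> \<in> space (\<Pi>\<^sub>M i\<in>{..<n}. borel)" using measurable_space[OF Z_meas] by (auto simp: n1_def)
      then show "energy_sum n (Z n \<omega>) \<le> ereal ((2 * real n)\<^sup>2 * (m + \<epsilon>))"
        using \<omega> n by (auto simp: A_def S_def not_less)
    qed
  qed
qed

end

theorem theorem2p1:
  fixes V :: "complex \<Rightarrow> ereal"
    and M :: "'a measure"
    and Z :: "nat \<Rightarrow> 'a \<Rightarrow> (nat \<Rightarrow> complex)"
    and \<mu>V :: "complex measure"
  assumes V_nonneg: "\<And>z. V z \<ge> 0"
    and V_cont: "continuous_on UNIV V"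
    and V_conj: "\<And>z. V (cnj z) = V z"
    and V_growth: "\<exists>\<delta>>0. \<exists>R. \<forall>z. cmod z \<ge> R \<longrightarrow>
                      V z \<ge> ereal ((1 + \<delta>) * ln ((cmod z)\<^sup>2 + 1))"
    and V_capacity: "\<exists>\<mu>. prob_on_C \<mu> \<and>
                      (\<exists>K. compact K \<and> K \<subseteq> {z. V z < \<infinity>} \<and> K \<in> sets \<mu> \<and> emeasure \<mu> K = 1) \<and>
                      eintegral (\<mu> \<Otimes>\<^sub>M \<mu>) (\<lambda>(x, y). log_kernel x y) < \<infinity>"
    and M_prob: "prob_space M"
    and Z_meas: "\<And>n. n \<ge> 1 \<Longrightarrow> Z n \<in> M \<rightarrow>\<^sub>M (\<Pi>\<^sub>M i\<in>{..<n}. (borel :: complex measure))"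
    and Z_distr: "\<And>n. n \<ge> 1 \<Longrightarrow>
                    distr M (\<Pi>\<^sub>M i\<in>{..<n}. (borel :: complex measure)) (Z n)
                      = density (lebesgue_Cn n) (P_density V n)"
    and \<mu>V_prob: "prob_on_C \<mu>V"
    and \<mu>V_min: "\<And>\<nu>. prob_on_C \<nu> \<Longrightarrow> energy V \<mu>V \<le> energy V \<nu>"
  shows "AE \<omega> in M. weak_conv_C (\<lambda>n. empirical (2 * n) (ext_conj n (Z n \<omega>))) \<mu>V"
proof -
  obtain \<delta> R where \<delta>: "0 < \<delta>" and R: "\<And>z. R \<le> cmod z \<Longrightarrow> ereal ((1 + \<delta>) * ln ((cmod z)\<^sup>2 + 1)) \<le> V z"
    using V_growth by auto
  \<comment> \<open>Inside the radius \<open>R\<close> the growth term is at most \<open>C\<close>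
    while \<open>V\<close> is nonnegative; outside, the growth hypothesis applies.\<close>
  define C where "C = (1 + \<delta>) * ln (1 + R\<^sup>2)"
  have C: "0 \<le> C" using \<delta> by (simp add: C_def)
  interpret external_field V \<delta> C
  proof
    fix z
    show "ereal ((1 + \<delta>) * log1p_sq z - C) \<le> V z"
    proof (cases "R \<le> cmod z")
      case True
      have "ereal ((1 + \<delta>) * log1p_sq z - C) \<le> ereal ((1 + \<delta>) * ln ((cmod z)\<^sup>2 + 1))"
        using C by (simp add: log1p_sq_def add.commute)
      then show ?thesis using R[OF True] by (rule order_trans)
    next
      case False
      then have "(cmod z)\<^sup>2 \<le> R\<^sup>2" by (intro power_mono) auto
      then have "log1p_sq z \<le> ln (1 + R\<^sup>2)" unfolding log1p_sq_def by (subst ln_le_cancel_iff) (auto simp: add_pos_nonneg)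
      then have "(1 + \<delta>) * log1p_sq z \<le> C" unfolding C_def using \<delta> by (intro mult_left_mono) auto
      then have "ereal ((1 + \<delta>) * log1p_sq z - C) \<le> 0" by simp
      then show ?thesis using V_nonneg by (rule order_trans)
    qed
  qed (use V_nonneg V_cont \<delta> C in auto)
  have min: "J \<mu>V \<mu>V \<le> J \<nu> \<nu>" if "prob_on_C \<nu>" for \<nu>
    by (rule energy_le_imp_J_le[OF \<mu>V_prob that \<mu>V_min[OF that]])
  obtain \<nu> A where \<nu>: "prob_on_C \<nu>" "compact A" "A \<subseteq> {z. V z < \<infinity>}" "A \<in> sets \<nu>" "emeasure \<nu> A = 1"
    "eintegral (\<nu> \<Otimes>\<^sub>M \<nu>) (\<lambda>(x, y). log_kernel x y) < \<infinity>" using V_capacity by blast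
  have "J \<mu>V \<mu>V < \<infinity>"
    using min[OF \<nu>(1)] J_finite_of_finite_log_energy[OF \<nu>] by (rule le_less_trans)
  interpret equilibrium_conj V \<delta> C \<mu>V
    by unfold_locales (fact \<mu>V_prob min \<open>J \<mu>V \<mu>V < \<infinity>\<close> V_conj)+
  \<comment> \<open>Countably many accuracies keep the exceptional set null, and every positive
    \<epsilon> exceeds one of them.\<close>
  have "AE \<omega> in M. \<forall>k. \<forall>\<^sub>F n in sequentially. energy_sum n (Z n \<omega>) \<le> ereal ((2 * real n)\<^sup>2 * (m + 1 / (real k + 1)))"
    unfolding AE_all_countable by (intro allI AE_energy_sum_le[OF M_prob Z_meas Z_distr]) auto
  then show ?thesis
  proof eventually_elim
    fix \<omega> assume \<omega>: "\<forall>k. \<forall>\<^sub>F n in sequentially. energy_sum n (Z n \<omega>) \<le> ereal ((2 * real n)\<^sup>2 * (m + 1 / (real k + 1)))"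
    show "weak_conv_C (\<lambda>n. empirical (2 * n) (ext_conj n (Z n \<omega>))) \<mu>V"
    proof (rule weak_conv_C_empirical)
      fix \<epsilon> :: real assume \<epsilon>: "0 < \<epsilon>"
      then obtain k where k: "1 / (real k + 1) < \<epsilon>" by (metis nat_approx_posE of_nat_Suc add.commute)
      show "\<forall>\<^sub>F n in sequentially. energy_sum n (Z n \<omega>) \<le> ereal ((2 * real n)\<^sup>2 * (m + \<epsilon>))"
        using \<omega>[rule_format, of k]
      proof eventually_elim
        fix n assume "energy_sum n (Z n \<omega>) \<le> ereal ((2 * real n)\<^sup>2 * (m + 1 / (real k + 1)))"
        also have "\<dots> \<le> ereal ((2 * real n)\<^sup>2 * (m + \<epsilon>))" using k by (simp add: mult_left_mono)
        finally show "energy_sum n (Z n \<omega>) \<le> ereal ((2 * real n)\<^sup>2 * (m + \<epsilon>))" .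
      qed
    qed
  qed
qed

end
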